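(* Let $d\ge1$, $J\ge0$, $\beta\in\mathbb{R}$ and $u(x)=x^4-\beta x^2$ for $x\in\mathbb{R}$. For a finite set $\Lambda\subset\mathbb{Z}^d$ and $\omega\in\mathbb{R}^{\mathbb{Z}^d}$ let $$U_\Lambda^\omega(x_\Lambda)=\sum_{i\in\Lambda}u(x_i)-2J\sum_{\langle ij\rangle:\,i,j\in\Lambda}x_ix_j-2J\sum_{i\in\Lambda,\,j\in N(i)\setminus\Lambda}x_i\omega_j,\qquad x_\Lambda=(x_i)_{i\in\Lambda}\in\mathbb{R}^\Lambda$$ (i.e. the potential with Hamiltonian $H(x)=-2J\sum_{\langle ij\rangle}x_ix_j$ and boundary condition $\omega$). Then $$\inf_{\Lambda}\ \inf_{\omega\in\mathbb{R}^{\mathbb{Z}^d}}\lambda_1\big(U_\Lambda^\omega\big)\ \ge\ \inf_{\Lambda}\ \inf_{\omega\in\mathbb{R}^{\mathbb{Z}^d}}\sigma\big(U_\Lambda^\omega\big)\ \ge\ \frac{\sqrt{\beta^2+8}-\beta}{\sqrt e}\exp\Big[-\tfrac18\beta\Big(\beta+\sqrt{\beta^2+8}\Big)\Big]-4dJ,$$ where $\Lambda$ runs over all finite (nonempty) subsets of $\mathbb{Z}^d$.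
   Context: $\langle ij\rangle$ denotes a nearest-neighbour bond of $\mathbb{Z}^d$ (unordered pair, each counted once), and $N(i)$ is the set of the $2d$ nearest neighbours of $i\in\mathbb{Z}^d$. For $U\in C^\infty(\mathbb{R}^\Lambda)$ with $Z=\int e^{-U}dx<\infty$, let $d\mu_U=e^{-U}dx/Z$ and $D(f)=\int|\nabla f|^2d\mu_U$. The spectral gap $\lambda_1(U)$ is the largest constant $\kappa$ such that $\kappa\,\mathrm{Var}_{\mu_U}(f)\le D(f)$ for all $f\in C_0^\infty(\mathbb{R}^\Lambda)$. The logarithmic Sobolev constant $\sigma(U)$ is the largest constant $\sigma$ such that $\sigma\,\mathrm{Ent}_{\mu_U}(f^2)\le2D(f)$ for all $f$ in the domain of the Dirichlet form $D$ (equivalently, for all $f\in C_0^\infty(\mathbb{R}^\Lambda)$), where $\mathrm{Ent}_\mu(g)=\mu(g\log g)-\mu(g)\log\mu(g)$ for $g\ge0$ and $\mu(g)=\int g\,d\mu$. *)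

theory Defs
  imports "HOL-Analysis.Analysis"
begin

text \<open>
  Since the finite index set \<open>\<Lambda>\<close> varies, \<open>\<real>\<close>-valued configurations on \<open>\<Lambda>\<close> are represented by the
  extensional functions on \<open>\<Lambda>\<close>, that is, by the underlying space of the product measure
  \<^term>\<open>\<Pi>\<^sub>M i\<in>\<Lambda>. (lborel :: real measure)\<close>. Functions on configurations are total functions whose
  values matter only on \<open>configs \<Lambda>\<close>. Continuity and compactness refer to the product topology of
  the function type, which on \<open>configs \<Lambda>\<close> is the Euclidean one.
\<close>

abbreviation configs :: "'i set \<Rightarrow> ('i \<Rightarrow> real) set" where
  "configs \<Lambda> \<equiv> \<Lambda> \<rightarrow>\<^sub>E UNIV"

definition partial_deriv :: "'i \<Rightarrow> (('i \<Rightarrow> real) \<Rightarrow> real) \<Rightarrow> ('i \<Rightarrow> real) \<Rightarrow> real" where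
  "partial_deriv i f x = deriv (\<lambda>t. f (x(i := t))) (x i)"

primrec Ck_on_configs :: "nat \<Rightarrow> 'i set \<Rightarrow> (('i \<Rightarrow> real) \<Rightarrow> real) \<Rightarrow> bool" where
  "Ck_on_configs 0 \<Lambda> f \<longleftrightarrow> continuous_on (configs \<Lambda>) f"
| "Ck_on_configs (Suc k) \<Lambda> f \<longleftrightarrow>
     continuous_on (configs \<Lambda>) f \<and>
     (\<forall>i\<in>\<Lambda>. (\<forall>x\<in>configs \<Lambda>. (\<lambda>t. f (x(i := t))) differentiable (at (x i))) \<and>
            Ck_on_configs k \<Lambda> (partial_deriv i f))"

definition smooth_compact_support :: "'i set \<Rightarrow> (('i \<Rightarrow> real) \<Rightarrow> real) set" where
  "smooth_compact_support \<Lambda> =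
     {f. (\<forall>k. Ck_on_configs k \<Lambda> f) \<and> compact (closure {x \<in> configs \<Lambda>. f x \<noteq> 0})}"

text \<open>
  The potentials \<open>U\<close> of interest are smooth with \<open>exp (- U)\<close> integrable.
\<close>

definition partition_function :: "'i set \<Rightarrow> (('i \<Rightarrow> real) \<Rightarrow> real) \<Rightarrow> real" where
  "partition_function \<Lambda> U = (\<integral>x. exp (- U x) \<partial>(\<Pi>\<^sub>M i\<in>\<Lambda>. lborel))"

definition gibbs_measure :: "'i set \<Rightarrow> (('i \<Rightarrow> real) \<Rightarrow> real) \<Rightarrow> ('i \<Rightarrow> real) measure" where
  "gibbs_measure \<Lambda> U =
     density (\<Pi>\<^sub>M i\<in>\<Lambda>. lborel) (\<lambda>x. ennreal (exp (- U x) / partition_function \<Lambda> U))"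

definition Var :: "'a measure \<Rightarrow> ('a \<Rightarrow> real) \<Rightarrow> real" where
  "Var \<mu> f = (\<integral>x. (f x - (\<integral>y. f y \<partial>\<mu>))\<^sup>2 \<partial>\<mu>)"

text \<open>Note \<^term>\<open>ln (0::real) = 0\<close>, so \<open>0 log 0 = 0\<close> as usual.\<close>

definition Ent :: "'a measure \<Rightarrow> ('a \<Rightarrow> real) \<Rightarrow> real" where
  "Ent \<mu> g = (\<integral>x. g x * ln (g x) \<partial>\<mu>) - (\<integral>x. g x \<partial>\<mu>) * ln (\<integral>x. g x \<partial>\<mu>)"

definition dirichlet_form :: "'i set \<Rightarrow> (('i \<Rightarrow> real) \<Rightarrow> real) \<Rightarrow> (('i \<Rightarrow> real) \<Rightarrow> real) \<Rightarrow> real" where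
  "dirichlet_form \<Lambda> U f = (\<integral>x. (\<Sum>i\<in>\<Lambda>. (partial_deriv i f x)\<^sup>2) \<partial>(gibbs_measure \<Lambda> U))"

text \<open>
  The conditions on the constants below are closed, so each supremum, when finite, is the largest
  admissible constant. Values are extended reals in order that suprema and infima are always
  meaningful.
\<close>

definition spectral_gap :: "'i set \<Rightarrow> (('i \<Rightarrow> real) \<Rightarrow> real) \<Rightarrow> ereal" where
  "spectral_gap \<Lambda> U =
     Sup {ereal \<kappa> | \<kappa>. \<forall>f\<in>smooth_compact_support \<Lambda>.
            \<kappa> * Var (gibbs_measure \<Lambda> U) f \<le> dirichlet_form \<Lambda> U f}"

definition log_sobolev_constant :: "'i set \<Rightarrow> (('i \<Rightarrow> real) \<Rightarrow> real) \<Rightarrow> ereal" where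
  "log_sobolev_constant \<Lambda> U =
     Sup {ereal \<sigma> | \<sigma>. \<forall>f\<in>smooth_compact_support \<Lambda>.
            \<sigma> * Ent (gibbs_measure \<Lambda> U) (\<lambda>x. (f x)\<^sup>2) \<le> 2 * dirichlet_form \<Lambda> U f}"

text \<open>The lattice of dimension \<open>d = CARD('d)\<close> is the type \<^typ>\<open>int ^ 'd\<close>.\<close>

definition neighbours :: "int ^ 'd \<Rightarrow> (int ^ 'd) set" where
  "neighbours i = {j. (\<Sum>k\<in>UNIV. \<bar>i $ k - j $ k\<bar>) = 1}"

text \<open>
  A bond is the two-element set of its endpoints, so each bond counts once and the product of \<open>x\<close>
  over a bond \<open>{i, j}\<close> is \<open>x i * x j\<close>.
\<close>

definition bonds_in :: "(int ^ 'd) set \<Rightarrow> (int ^ 'd) set set" where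
  "bonds_in \<Lambda> = {{i, j} | i j. i \<in> \<Lambda> \<and> j \<in> \<Lambda> \<and> j \<in> neighbours i}"

definition single_site_potential :: "real \<Rightarrow> real \<Rightarrow> real" where
  "single_site_potential \<beta> t = t ^ 4 - \<beta> * t\<^sup>2"

definition spin_potential ::
  "real \<Rightarrow> real \<Rightarrow> (int ^ 'd) set \<Rightarrow> (int ^ 'd \<Rightarrow> real) \<Rightarrow> (int ^ 'd \<Rightarrow> real) \<Rightarrow> real" where
  "spin_potential J \<beta> \<Lambda> \<omega> x =
     (\<Sum>i\<in>\<Lambda>. single_site_potential \<beta> (x i))
     - 2 * J * (\<Sum>b\<in>bonds_in \<Lambda>. \<Prod>i\<in>b. x i)
     - 2 * J * (\<Sum>i\<in>\<Lambda>. \<Sum>j\<in>neighbours i - \<Lambda>. x i * \<omega> j)"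

end

theory Submission
  imports Defs "HOL-Probability.Probability" "HOL-Real_Asymp.Real_Asymp"
begin

text \<open>
  One site. Put \<open>K = sqrt (\<beta>\<^sup>2 + 8) - \<beta>\<close> and \<open>\<rho> = (sqrt (\<beta>\<^sup>2 + 8) + \<beta>) / 4\<close>. Up to a constant, \<open>x\<^sup>4 - \<beta> x\<^sup>2\<close> is
  \<open>K/2 x\<^sup>2 + ((x\<^sup>2 - \<rho>)\<^sub>+)\<^sup>2\<close> plus the bump \<open>((\<rho> - x\<^sup>2)\<^sub>+)\<^sup>2\<close>, whose values lie between \<open>0\<close> and \<open>\<rho>\<^sup>2\<close>. The first part
  stays uniformly convex with modulus \<open>K\<close> when a linear term is added, so it gives the logarithmic
  Sobolev constant \<open>K\<close> (monotone rearrangement, \<open>log_sobolev_interval\<close>); the bump costs a factor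
  \<open>exp (- \<rho>\<^sup>2)\<close> (Holley and Stroock, \<open>site_log_sobolev_perturbation\<close>). Hence the conditional law of one
  spin given all others satisfies a logarithmic Sobolev inequality with constant
  \<open>\<sigma> = K exp (- \<rho>\<^sup>2)\<close>, whatever the others are, and \<open>\<sigma>\<close> is the first term of the bound.

  Many sites. Let \<open>\<pi>\<^sub>i\<close> be the conditional expectation over the spin at \<open>i\<close>. In the chain rule
  \<open>Ent g = \<integral> Ent\<^bsub>\<pi>\<^sub>i\<^esub> g + Ent (\<pi>\<^sub>i g)\<close>, the inequality for one spin bounds the first term on the right by the part of
  the Fisher information of \<open>g\<close> that belongs to \<open>i\<close>. Replacing \<open>g\<close> by \<open>\<pi>\<^sub>i g\<close> removes that part, but the field at \<open>i\<close> depends on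
  the neighbours, so the part belonging to a neighbour \<open>j\<close> grows: with \<open>w\<^sub>j = |\<partial>\<^sub>j g| / sqrt g\<close>, a covariance
  estimate (\<open>site_covariance_le\<close>) gives \<open>w\<^sub>j \<leadsto> w\<^sub>j + (\<kappa>\<^sub>i\<^sub>j / \<sigma>) w\<^sub>i\<close> and \<open>w\<^sub>i \<leadsto> 0\<close>, both pointwise, up to averaging
  (\<open>sqrt_fisher_cond_le\<close>), and for the norms in \<open>L\<^sup>2\<close> of the Gibbs measure (\<open>sqrt_integral_fisher_cond_le\<close>). This is
  the Gauss-Seidel update of the residual of the linear system with matrix \<open>A = \<sigma> - \<kappa>\<close>. Its energy
  identity (\<open>relax_energy_eq_quadratic\<close>) says that the entropies collected along any sequence of sites add up to
  at most \<open>\<langle>w, A\<inverse> w\<rangle> / 2\<close>, and \<open>A \<ge> \<sigma> - 4 d J\<close> because every site has \<open>2 d\<close> neighbours. The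
  sites can be chosen so that the supremum norms of the \<open>w\<^sub>j\<close> become as small as desired (\<open>relax_exhausts\<close>);
  then the remaining function is almost constant and its entropy negligible. No information on the
  interacting measure beyond the existence of moments enters, so the bound is uniform in the region and
  in the boundary condition. If \<open>\<sigma> \<le> 4 d J\<close> there is nothing to prove, since \<open>0\<close> is always an admissible constant.

  The comparison of the two constants is the linearisation of the logarithmic Sobolev inequality at
  constants. Constants do not have compact support, and smooth cut-off functions make up for that.
\<close>

section \<open>Integrals, square roots and entropy\<close>

text \<open>
  Differentiation under the integral sign: difference quotients are dominated by \<open>W\<close> because of the
  mean value theorem, so dominated convergence applies.
\<close>

lemma has_real_derivative_integral:
  fixes F F' :: "real \<Rightarrow> 'a \<Rightarrow> real"
  assumes "\<delta> > 0"
    and int: "\<And>t. \<bar>t - t0\<bar> < \<delta> \<Longrightarrow> integrable M (F t)"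
    and der: "\<And>t y. \<bar>t - t0\<bar> < \<delta> \<Longrightarrow> y \<in> space M \<Longrightarrow>
      ((\<lambda>t. F t y) has_real_derivative F' t y) (at t)"
    and bd: "\<And>t y. \<bar>t - t0\<bar> < \<delta> \<Longrightarrow> y \<in> space M \<Longrightarrow> \<bar>F' t y\<bar> \<le> W y"
    and W: "integrable M W"
  shows "((\<lambda>t. \<integral>y. F t y \<partial>M) has_real_derivative (\<integral>y. F' t0 y \<partial>M)) (at t0)"
    and "integrable M (F' t0)"
proof -
  let ?q = "\<lambda>t y. (F t y - F t0 y) / (t - t0)"
  have qbd: "\<bar>?q t y\<bar> \<le> W y" if "\<bar>t - t0\<bar> < \<delta>" "t \<noteq> t0" "y \<in> space M" for t y
  proof -
    have "\<bar>F t y - F t0 y\<bar> \<le> W y * \<bar>t - t0\<bar>"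
      using field_differentiable_bound[of "ball t0 \<delta>" "\<lambda>t. F t y" "\<lambda>t. F' t y" "W y" t t0]
        der[OF _ that(3)] bd[OF _ that(3)] that \<open>\<delta> > 0\<close>
      by (auto simp: dist_real_def abs_minus_commute intro: has_field_derivative_at_within)
    then show ?thesis using that by (simp add: divide_simps)
  qed
  have seq: "(\<lambda>n. \<integral>y. ?q (X n) y \<partial>M) \<longlonglongrightarrow> (\<integral>y. F' t0 y \<partial>M) \<and> integrable M (F' t0)"
    if X: "\<And>n. X n \<in> ball t0 \<delta> - {t0}" "X \<longlonglongrightarrow> t0" for X
  proof -
    have Xn: "\<bar>X n - t0\<bar> < \<delta>" "X n \<noteq> t0" for n
      using X(1)[of n] by (auto simp: dist_real_def abs_minus_commute)
    have i0: "integrable M (F t0)" using int \<open>\<delta> > 0\<close> by auto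
    have iq: "integrable M (?q (X n))" for n
      using int[OF Xn(1)[of n]] i0 by auto
    have lim: "(\<lambda>n. ?q (X n) y) \<longlonglongrightarrow> F' t0 y" if "y \<in> space M" for y
    proof -
      have "((\<lambda>t. ?q t y) \<longlongrightarrow> F' t0 y) (at t0)"
        using der[of t0 y] that \<open>\<delta> > 0\<close> by (simp add: has_field_derivative_iff)
      then show ?thesis
        using X Xn by (auto simp: tendsto_at_iff_sequentially comp_def)
    qed
    have mF': "F' t0 \<in> borel_measurable M"
      by (rule borel_measurable_LIMSEQ_real[OF lim]) (use iq in auto)
    have mq: "?q (X n) \<in> borel_measurable M" for n
      using iq by (rule borel_measurable_integrable)
    have AElim: "AE y in M. (\<lambda>n. ?q (X n) y) \<longlonglongrightarrow> F' t0 y"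
      using lim by (rule AE_I2)
    have AEbd: "AE y in M. norm (?q (X n) y) \<le> W y" for n
      unfolding real_norm_def using qbd[OF Xn] by (rule AE_I2)
    show ?thesis
      using integral_dominated_convergence[OF mF' mq W AElim AEbd]
        integrable_dominated_convergence[OF mF' mq W AElim AEbd] by simp
  qed
  have "(\<lambda>n. t0 + \<delta> / (real n + 2)) \<longlonglongrightarrow> t0"
    by real_asymp
  moreover have "t0 + \<delta> / (real n + 2) \<in> ball t0 \<delta> - {t0}" for n
    using \<open>\<delta> > 0\<close> by (auto simp: dist_real_def divide_simps)
  ultimately show "integrable M (F' t0)"
    using seq[of "\<lambda>n. t0 + \<delta> / (real n + 2)"] by blast
  have "((\<lambda>t. \<integral>y. ?q t y \<partial>M) \<longlongrightarrow> (\<integral>y. F' t0 y \<partial>M)) (at t0 within ball t0 \<delta>)"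
    unfolding tendsto_at_iff_sequentially comp_def using seq by blast
  then have "((\<lambda>t. \<integral>y. ?q t y \<partial>M) \<longlongrightarrow> (\<integral>y. F' t0 y \<partial>M)) (at t0)"
    using at_within_open[of t0 "ball t0 \<delta>"] \<open>\<delta> > 0\<close> by simp
  then have "((\<lambda>t. ((\<integral>y. F t y \<partial>M) - (\<integral>y. F t0 y \<partial>M)) / (t - t0)) \<longlongrightarrow> (\<integral>y. F' t0 y \<partial>M)) (at t0)"
  proof (rule Lim_transform_within[where d=\<delta>])
    fix t assume "0 < dist t t0" "dist t t0 < \<delta>"
    then have "integrable M (F t)" "integrable M (F t0)"
      using int[of t] int[of t0] \<open>\<delta> > 0\<close> by (auto simp: dist_real_def)
    then show "(\<integral>y. ?q t y \<partial>M) = ((\<integral>y. F t y \<partial>M) - (\<integral>y. F t0 y \<partial>M)) / (t - t0)"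
      by simp
  qed (rule \<open>\<delta> > 0\<close>)
  then show "((\<lambda>t. \<integral>y. F t y \<partial>M) has_real_derivative (\<integral>y. F' t0 y \<partial>M)) (at t0)"
    by (simp add: has_field_derivative_iff)
qed

lemma borel_measurable_derivative:
  fixes f f' :: "real \<Rightarrow> real"
  assumes "\<And>x. (f has_real_derivative f' x) (at x)"
  shows "f' \<in> borel_measurable borel"
proof (rule borel_measurable_LIMSEQ_real)
  have "continuous_on UNIV f"
    using assms by (meson DERIV_continuous_on has_field_derivative_at_within)
  then have [measurable]: "f \<in> borel_measurable borel"
    by (rule borel_measurable_continuous_onI)
  show "(\<lambda>x. (f (x + inverse (real (Suc n))) - f x) / inverse (real (Suc n))) \<in> borel_measurable borel" for n
    by measurable
  show "(\<lambda>n. (f (x + inverse (real (Suc n))) - f x) / inverse (real (Suc n))) \<longlonglongrightarrow> f' x" for x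
  proof -
    have "((\<lambda>h. (f (x + h) - f x) / h) \<longlongrightarrow> f' x) (at 0)"
      using assms[of x] by (simp add: DERIV_def)
    moreover have "(\<lambda>n. inverse (real (Suc n))) \<longlonglongrightarrow> 0"
      by (rule LIMSEQ_inverse_real_of_nat)
    ultimately show ?thesis
      by (auto simp: tendsto_at_iff_sequentially comp_def)
  qed
qed

lemma integral_Icc_tendsto_lborel:
  fixes g :: "real \<Rightarrow> real"
  assumes "integrable lborel g"
  shows "g integrable_on {a..b}"
    and "(\<lambda>n. integral {- real (Suc n)..real (Suc n)} g) \<longlonglongrightarrow> (\<integral>x. g x \<partial>lborel)"
proof -
  have si: "set_integrable lborel {a..b} g" for a b
    unfolding set_integrable_def by (rule integrable_mult_indicator) (use assms in auto)
  show "g integrable_on {a..b}" using set_borel_integral_eq_integral(1)[OF si] .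
  have "(\<lambda>n. \<integral>x. indicator {- real (Suc n)..real (Suc n)} x *\<^sub>R g x \<partial>lborel) \<longlonglongrightarrow> (\<integral>x. g x \<partial>lborel)"
  proof (rule integral_dominated_convergence[where w="\<lambda>x. \<bar>g x\<bar>"])
    show "AE x in lborel. (\<lambda>n. indicator {- real (Suc n)..real (Suc n)} x *\<^sub>R g x) \<longlonglongrightarrow> g x"
    proof (rule AE_I2)
      fix x :: real
      obtain N :: nat where N: "\<bar>x\<bar> \<le> real N" using real_arch_simple by blast
      have "eventually (\<lambda>n. indicator {- real (Suc n)..real (Suc n)} x *\<^sub>R g x = g x) sequentially"
        using eventually_ge_at_top[of N]
        by eventually_elim (use N in \<open>auto simp: indicator_def\<close>)
      then show "(\<lambda>n. indicator {- real (Suc n)..real (Suc n)} x *\<^sub>R g x) \<longlonglongrightarrow> g x"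
        by (rule tendsto_eventually)
    qed
    have [measurable]: "g \<in> borel_measurable borel" using assms by auto
    show "g \<in> borel_measurable lborel" by simp
    show "(\<lambda>x. indicator {- real (Suc n)..real (Suc n)} x *\<^sub>R g x) \<in> borel_measurable lborel" for n
      by measurable
    show "integrable lborel (\<lambda>x. \<bar>g x\<bar>)" using assms by auto
  qed (auto simp: indicator_def)
  moreover have "(\<integral>x. indicator {- real (Suc n)..real (Suc n)} x *\<^sub>R g x \<partial>lborel)
      = integral {- real (Suc n)..real (Suc n)} g" for n
    using set_borel_integral_eq_integral(2)[OF si] by (simp add: set_lebesgue_integral_def)
  ultimately show "(\<lambda>n. integral {- real (Suc n)..real (Suc n)} g) \<longlonglongrightarrow> (\<integral>x. g x \<partial>lborel)"
    by simp
qed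

lemma integral_lborel_pos:
  fixes g :: "'a::euclidean_space \<Rightarrow> real"
  assumes "integrable lborel g" "\<And>x. g x > 0"
  shows "(\<integral>x. g x \<partial>lborel) > 0"
proof -
  have "(\<integral>x. g x \<partial>lborel) \<noteq> 0"
  proof
    assume "(\<integral>x. g x \<partial>lborel) = 0"
    then have "AE x in lborel. g x = 0"
      using integral_nonneg_eq_0_iff_AE[OF assms(1)] assms(2) by (auto intro: less_imp_le)
    then have "AE x in (lborel :: 'a measure). False"
      by eventually_elim (metis assms(2) less_irrefl)
    then show False
      by (simp add: AE_iff_null null_sets_def)
  qed
  moreover have "(\<integral>x. g x \<partial>lborel) \<ge> 0"
    using assms(2) by (intro integral_nonneg_AE) (auto intro: less_imp_le)
  ultimately show ?thesis by simp
qed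

text \<open>
  The integral of \<open>(f + t g)\<^sup>2\<close> is a nonnegative quadratic polynomial in \<open>t\<close>.
\<close>

lemma integral_Cauchy_Schwarz:
  fixes f g :: "'a \<Rightarrow> real"
  assumes f: "integrable M (\<lambda>x. (f x)\<^sup>2)" and g: "integrable M (\<lambda>x. (g x)\<^sup>2)"
    and fg: "integrable M (\<lambda>x. f x * g x)"
  shows "(\<integral>x. f x * g x \<partial>M)\<^sup>2 \<le> (\<integral>x. (f x)\<^sup>2 \<partial>M) * (\<integral>x. (g x)\<^sup>2 \<partial>M)"
proof -
  define a where "a = (\<integral>x. (f x)\<^sup>2 \<partial>M)"
  define b where "b = (\<integral>x. f x * g x \<partial>M)"
  define c where "c = (\<integral>x. (g x)\<^sup>2 \<partial>M)"
  have c0: "c \<ge> 0" unfolding c_def by simp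
  have q: "0 \<le> a + 2 * t * b + t\<^sup>2 * c" for t
  proof -
    have "0 \<le> (\<integral>x. (f x + t * g x)\<^sup>2 \<partial>M)" by simp
    also have "(\<lambda>x. (f x + t * g x)\<^sup>2) = (\<lambda>x. (f x)\<^sup>2 + (2 * t) * (f x * g x) + t\<^sup>2 * (g x)\<^sup>2)"
      by (simp add: fun_eq_iff power2_eq_square algebra_simps)
    also have "(\<integral>x. (f x)\<^sup>2 + (2 * t) * (f x * g x) + t\<^sup>2 * (g x)\<^sup>2 \<partial>M) = a + 2 * t * b + t\<^sup>2 * c"
      unfolding a_def b_def c_def using f g fg by simp
    finally show ?thesis .
  qed
  have "b\<^sup>2 \<le> a * c"
  proof (cases "c = 0")
    case True
    have "b = 0"
    proof (rule ccontr)
      assume "b \<noteq> 0"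
      \<comment> \<open>For \<open>c = 0\<close> the quadratic is affine in \<open>t\<close> and takes the value \<open>- 1\<close> here.\<close>
      then have "a + 2 * (- (a + 1) / (2 * b)) * b = - 1" by (simp add: field_simps)
      then show False using q[of "- (a + 1) / (2 * b)"] True by simp
    qed
    then show ?thesis using True by simp
  next
    case False
    then have "c > 0" using c0 by simp
    then have "a + 2 * (- b / c) * b + (- b / c)\<^sup>2 * c = (a * c - b\<^sup>2) / c"
      by (simp add: power2_eq_square field_simps)
    then show ?thesis using q[of "- b / c"] \<open>c > 0\<close> by (simp add: zero_le_divide_iff)
  qed
  then show ?thesis by (simp add: a_def b_def c_def)
qed

lemma integral_mult_sqrt_bounds:
  fixes p q :: "'a \<Rightarrow> real"
  assumes p: "integrable M p" and q: "integrable M q" and "\<And>x. x \<in> space M \<Longrightarrow> p x \<ge> 0" "\<And>x. x \<in> space M \<Longrightarrow> q x \<ge> 0"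
  shows "integrable M (\<lambda>x. sqrt (p x) * sqrt (q x))"
    and "(\<integral>x. sqrt (p x) * sqrt (q x) \<partial>M) \<le> sqrt (\<integral>x. p x \<partial>M) * sqrt (\<integral>x. q x \<partial>M)"
proof -
  have [measurable]: "p \<in> borel_measurable M" "q \<in> borel_measurable M" using p q by auto
  show i: "integrable M (\<lambda>x. sqrt (p x) * sqrt (q x))"
  proof (rule Bochner_Integration.integrable_bound)
    show "integrable M (\<lambda>x. p x + q x)" using p q by simp
    show "AE x in M. norm (sqrt (p x) * sqrt (q x)) \<le> norm (p x + q x)"
    proof (rule AE_I2)
      fix x assume x: "x \<in> space M"
      have "0 \<le> (sqrt (p x) - sqrt (q x))\<^sup>2" by simp
      also have "\<dots> = p x + q x - 2 * (sqrt (p x) * sqrt (q x))"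
        using assms(3,4)[OF x] by (simp add: power2_diff)
      finally have "2 * (sqrt (p x) * sqrt (q x)) \<le> p x + q x" by simp
      moreover have "sqrt (p x) * sqrt (q x) \<ge> 0" using assms(3,4)[OF x] by simp
      ultimately show "norm (sqrt (p x) * sqrt (q x)) \<le> norm (p x + q x)" by simp
    qed
  qed measurable
  have e: "(\<integral>x. (sqrt (p x))\<^sup>2 \<partial>M) = (\<integral>x. p x \<partial>M)" "(\<integral>x. (sqrt (q x))\<^sup>2 \<partial>M) = (\<integral>x. q x \<partial>M)"
    using assms by (auto intro!: Bochner_Integration.integral_cong)
  have s: "integrable M (\<lambda>x. (sqrt (p x))\<^sup>2)" "integrable M (\<lambda>x. (sqrt (q x))\<^sup>2)"
    using assms by (auto cong: Bochner_Integration.integrable_cong)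
  have "(\<integral>x. sqrt (p x) * sqrt (q x) \<partial>M)\<^sup>2 \<le> (\<integral>x. p x \<partial>M) * (\<integral>x. q x \<partial>M)"
    using integral_Cauchy_Schwarz[OF s i] by (simp add: e)
  then show "(\<integral>x. sqrt (p x) * sqrt (q x) \<partial>M) \<le> sqrt (\<integral>x. p x \<partial>M) * sqrt (\<integral>x. q x \<partial>M)"
    by (simp add: real_le_rsqrt flip: real_sqrt_mult)
qed

lemma integral_square_le_weighted:
  fixes d g :: "'a \<Rightarrow> real"
  assumes d: "integrable M d" and g: "integrable M g" and dg: "integrable M (\<lambda>x. (d x)\<^sup>2 / g x)"
    and pos: "\<And>x. x \<in> space M \<Longrightarrow> g x > 0"
  shows "\<bar>\<integral>x. d x \<partial>M\<bar> \<le> sqrt (\<integral>x. g x \<partial>M) * sqrt (\<integral>x. (d x)\<^sup>2 / g x \<partial>M)"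
proof -
  have nn: "g x \<ge> 0" "(d x)\<^sup>2 / g x \<ge> 0" if "x \<in> space M" for x using pos[OF that] by simp_all
  have "\<bar>\<integral>x. d x \<partial>M\<bar> \<le> (\<integral>x. \<bar>d x\<bar> \<partial>M)" by (rule integral_abs_bound)
  also have "\<dots> = (\<integral>x. sqrt (g x) * sqrt ((d x)\<^sup>2 / g x) \<partial>M)"
  proof (rule Bochner_Integration.integral_cong[OF refl])
    fix x assume "x \<in> space M"
    then show "\<bar>d x\<bar> = sqrt (g x) * sqrt ((d x)\<^sup>2 / g x)" using pos[of x] by (simp add: real_sqrt_divide)
  qed
  also have "\<dots> \<le> sqrt (\<integral>x. g x \<partial>M) * sqrt (\<integral>x. (d x)\<^sup>2 / g x \<partial>M)"
    by (rule integral_mult_sqrt_bounds(2)[OF g dg nn])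
  finally show ?thesis .
qed

text \<open>
  Minkowski's inequality in \<open>L\<^sup>2\<close> for \<open>sqrt p\<close> and \<open>c * sqrt q\<close>, in the form needed to pass from a pointwise bound
  on gradients to a bound on their norms.
\<close>

lemma integral_sqrt_add_square_le:
  fixes p q :: "'a \<Rightarrow> real"
  assumes p: "integrable M p" and q: "integrable M q" and nn: "\<And>x. x \<in> space M \<Longrightarrow> p x \<ge> 0" "\<And>x. x \<in> space M \<Longrightarrow> q x \<ge> 0"
    and "c \<ge> 0"
  shows "integrable M (\<lambda>x. (sqrt (p x) + c * sqrt (q x))\<^sup>2)"
    and "(\<integral>x. (sqrt (p x) + c * sqrt (q x))\<^sup>2 \<partial>M) \<le> (sqrt (\<integral>x. p x \<partial>M) + c * sqrt (\<integral>x. q x \<partial>M))\<^sup>2"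
proof -
  note i = integral_mult_sqrt_bounds[OF p q nn]
  have eq: "(sqrt (p x) + c * sqrt (q x))\<^sup>2 = p x + (2 * c) * (sqrt (p x) * sqrt (q x)) + c\<^sup>2 * q x"
    if "x \<in> space M" for x
    using nn[OF that] by (simp add: power2_sum power_mult_distrib)
  have ii: "integrable M (\<lambda>x. p x + (2 * c) * (sqrt (p x) * sqrt (q x)) + c\<^sup>2 * q x)"
    using p q i(1) by simp
  show "integrable M (\<lambda>x. (sqrt (p x) + c * sqrt (q x))\<^sup>2)"
    using ii by (subst Bochner_Integration.integrable_cong[OF refl eq])
  have "(\<integral>x. (sqrt (p x) + c * sqrt (q x))\<^sup>2 \<partial>M) = (\<integral>x. p x + (2 * c) * (sqrt (p x) * sqrt (q x)) + c\<^sup>2 * q x \<partial>M)"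
    by (rule Bochner_Integration.integral_cong[OF refl eq])
  also have "\<dots> = (\<integral>x. p x \<partial>M) + (2 * c) * (\<integral>x. sqrt (p x) * sqrt (q x) \<partial>M) + c\<^sup>2 * (\<integral>x. q x \<partial>M)"
    using p q i(1) by simp
  also have "\<dots> \<le> (\<integral>x. p x \<partial>M) + (2 * c) * (sqrt (\<integral>x. p x \<partial>M) * sqrt (\<integral>x. q x \<partial>M)) + c\<^sup>2 * (\<integral>x. q x \<partial>M)"
    using i(2) \<open>c \<ge> 0\<close> by (intro add_mono mult_left_mono) auto
  also have "\<dots> = (sqrt (\<integral>x. p x \<partial>M) + c * sqrt (\<integral>x. q x \<partial>M))\<^sup>2"
  proof -
    have "(\<integral>x. p x \<partial>M) \<ge> 0" "(\<integral>x. q x \<partial>M) \<ge> 0"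
      using nn by (auto intro!: integral_nonneg_AE AE_I2)
    then show ?thesis by (simp add: power2_sum power_mult_distrib)
  qed
  finally show "(\<integral>x. (sqrt (p x) + c * sqrt (q x))\<^sup>2 \<partial>M) \<le> (sqrt (\<integral>x. p x \<partial>M) + c * sqrt (\<integral>x. q x \<partial>M))\<^sup>2" .
qed

lemma abs_mult_ln_le:
  fixes s :: real
  assumes "0 < \<epsilon>" "\<epsilon> \<le> s" "s \<le> M"
  shows "\<bar>s * ln s\<bar> \<le> M * (\<bar>ln \<epsilon>\<bar> + \<bar>ln M\<bar>)"
proof -
  have s: "s > 0" using assms by linarith
  have "ln \<epsilon> \<le> ln s" "ln s \<le> ln M" using assms s by auto
  then have "\<bar>ln s\<bar> \<le> \<bar>ln \<epsilon>\<bar> + \<bar>ln M\<bar>" by linarith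
  then show ?thesis using assms s by (simp add: abs_mult mult_mono)
qed

text \<open>
  Continuity at \<open>0\<close> is what allows entropies to converge for functions with zeros.
\<close>

lemma continuous_on_mult_ln: "continuous_on {0..} (\<lambda>s::real. s * ln s)"
proof (rule continuous_on_eq_continuous_within[THEN iffD2], intro ballI)
  fix s :: real assume s: "s \<in> {0..}"
  show "continuous (at s within {0..}) (\<lambda>s. s * ln s)"
  proof (cases "s = 0")
    case True
    have "((\<lambda>s::real. s * ln s) \<longlongrightarrow> 0) (at_right 0)" by real_asymp
    then have "((\<lambda>s::real. s * ln s) \<longlongrightarrow> 0) (at 0 within {0..})"
      by (simp add: at_within_Ici_at_right)
    then show ?thesis using True by (simp add: continuous_within)
  next
    case False
    then show ?thesis using s by (intro continuous_intros) auto
  qed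
qed

lemma (in prob_space) Ent_tendsto:
  fixes g :: "nat \<Rightarrow> 'a \<Rightarrow> real"
  assumes m: "\<And>n. g n \<in> borel_measurable M" and l: "l \<in> borel_measurable M"
    and b: "\<And>n x. x \<in> space M \<Longrightarrow> 0 \<le> g n x" "\<And>n x. x \<in> space M \<Longrightarrow> g n x \<le> C"
    and lim: "\<And>x. x \<in> space M \<Longrightarrow> (\<lambda>n. g n x) \<longlonglongrightarrow> l x"
  shows "(\<lambda>n. Ent M (g n)) \<longlonglongrightarrow> Ent M l"
proof -
  have [measurable]: "g n \<in> borel_measurable M" "l \<in> borel_measurable M" for n using m l by auto
  have lb: "0 \<le> l x" "l x \<le> C" if "x \<in> space M" for x
    using LIMSEQ_le_const[OF lim[OF that]] LIMSEQ_le_const2[OF lim[OF that]] b[OF that] by auto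
  obtain K where K: "\<And>s. s \<in> {0..C} \<Longrightarrow> \<bar>s * ln s\<bar> \<le> K"
  proof -
    have "compact ((\<lambda>s::real. s * ln s) ` {0..C})"
      by (intro compact_continuous_image continuous_on_subset[OF continuous_on_mult_ln]) auto
    then show ?thesis using that unfolding bounded_iff[THEN sym] 
      by (metis compact_imp_bounded bounded_iff imageI real_norm_def)
  qed
  have i1: "(\<lambda>n. \<integral>x. g n x \<partial>M) \<longlonglongrightarrow> (\<integral>x. l x \<partial>M)"
    by (rule integral_dominated_convergence[where w="\<lambda>_. C"]) (use lim b in \<open>auto intro!: AE_I2\<close>)
  have i2: "(\<lambda>n. \<integral>x. g n x * ln (g n x) \<partial>M) \<longlonglongrightarrow> (\<integral>x. l x * ln (l x) \<partial>M)"
  proof (rule integral_dominated_convergence[where w="\<lambda>_. K"])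
    show "AE x in M. (\<lambda>n. g n x * ln (g n x)) \<longlonglongrightarrow> l x * ln (l x)"
      by (rule AE_I2, rule continuous_on_tendsto_compose[OF continuous_on_mult_ln lim])
        (use lb b in auto)
    show "AE x in M. norm (g n x * ln (g n x)) \<le> K" for n
      by (rule AE_I2) (use K b in auto)
  qed auto
  have nn: "(\<integral>x. g n x \<partial>M) \<ge> 0" "(\<integral>x. l x \<partial>M) \<ge> 0" for n
    using b(1) lb(1) by (auto intro!: integral_nonneg_AE AE_I2)
  have i3: "(\<lambda>n. (\<integral>x. g n x \<partial>M) * ln (\<integral>x. g n x \<partial>M)) \<longlonglongrightarrow> (\<integral>x. l x \<partial>M) * ln (\<integral>x. l x \<partial>M)"
    by (rule continuous_on_tendsto_compose[OF continuous_on_mult_ln i1]) (use nn in auto)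
  show ?thesis unfolding Ent_def by (rule tendsto_diff[OF i2 i3])
qed

text \<open>
  The entropy is the infimum over \<open>c > 0\<close> of \<open>\<integral> g ln (g / c) - g + c\<close>, and the integrand is at most
  \<open>(g - c)\<^sup>2 / c\<close>.
\<close>

lemma (in prob_space) Ent_le_square_deviation:
  assumes g: "g \<in> borel_measurable M" and b: "\<And>x. x \<in> space M \<Longrightarrow> \<epsilon> \<le> g x" "\<And>x. x \<in> space M \<Longrightarrow> g x \<le> C" "\<epsilon> > 0"
    and c: "c > 0"
  shows "Ent M g \<le> (\<integral>x. (g x - c)\<^sup>2 \<partial>M) / c"
proof -
  have [measurable]: "g \<in> borel_measurable M" by (rule g)
  have g0: "g x > 0" if "x \<in> space M" for x using b(1)[OF that] b(3) by linarith
  have ig: "integrable M g"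
    by (rule integrable_const_bound[of _ C]) (use g0 b in \<open>auto intro!: AE_I2 simp: abs_of_pos\<close>)
  have ig2: "integrable M (\<lambda>x. (g x)\<^sup>2)"
    by (rule integrable_const_bound[of _ "C\<^sup>2"]) (use g0 b in \<open>auto intro!: AE_I2 power_mono simp: less_imp_le\<close>)
  have il: "integrable M (\<lambda>x. g x * ln (g x))"
  proof (rule integrable_const_bound[of _ "C * (\<bar>ln \<epsilon>\<bar> + \<bar>ln C\<bar>)"])
    show "AE x in M. norm (g x * ln (g x)) \<le> C * (\<bar>ln \<epsilon>\<bar> + \<bar>ln C\<bar>)"
      unfolding real_norm_def by (rule AE_I2, rule abs_mult_ln_le[OF b(3) b(1) b(2)])
  qed measurable
  define m where "m = (\<integral>x. g x \<partial>M)"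
  have "m \<ge> (\<integral>x. \<epsilon> \<partial>M)" unfolding m_def using b(1) by (intro integral_mono ig) auto
  then have m0: "m > 0" using b(3) by (simp add: prob_space)
  have "(\<integral>x. g x * ln (g x) \<partial>M) \<le> (\<integral>x. g x * ln c + (g x)\<^sup>2 / c - g x \<partial>M)"
  proof (rule integral_mono[OF il])
    fix x assume x: "x \<in> space M"
    have "ln (g x / c) \<le> g x / c - 1" using g0[OF x] c by (intro ln_le_minus_one) auto
    then have "g x * (ln (g x) - ln c) \<le> g x * (g x / c - 1)"
      using g0[OF x] c by (intro mult_left_mono) (auto simp: ln_divide_pos)
    then show "g x * ln (g x) \<le> g x * ln c + (g x)\<^sup>2 / c - g x"
      by (simp add: power2_eq_square algebra_simps)
  qed (use ig ig2 in auto)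
  also have "\<dots> = m * ln c + (\<integral>x. (g x)\<^sup>2 \<partial>M) / c - m"
    unfolding m_def using ig ig2 by simp
  finally have 1: "(\<integral>x. g x * ln (g x) \<partial>M) \<le> m * ln c + (\<integral>x. (g x)\<^sup>2 \<partial>M) / c - m" .
  have "ln (c / m) \<le> c / m - 1" using m0 c by (intro ln_le_minus_one) auto
  then have "m * (ln c - ln m) \<le> m * (c / m - 1)"
    using m0 c by (intro mult_left_mono) (auto simp: ln_divide_pos)
  then have 2: "m * ln c - m * ln m \<le> c - m" using m0 by (simp add: algebra_simps)
  have eq: "(g x - c)\<^sup>2 = (g x)\<^sup>2 - 2 * c * g x + c\<^sup>2" for x by (simp add: power2_diff)
  have "(\<integral>x. (g x - c)\<^sup>2 \<partial>M) = (\<integral>x. (g x)\<^sup>2 \<partial>M) - 2 * c * m + c\<^sup>2"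
    unfolding eq m_def using ig ig2 by (simp add: prob_space)
  then have "(\<integral>x. (g x - c)\<^sup>2 \<partial>M) / c = (\<integral>x. (g x)\<^sup>2 \<partial>M) / c - 2 * m + c"
    using c by (simp add: power2_eq_square field_simps)
  then show ?thesis unfolding Ent_def m_def[symmetric] using 1 2 by linarith
qed

section \<open>Uniformly convex potentials on the line\<close>

text \<open>
  With \<open>A\<close> and \<open>B\<close> the primitives of \<open>q\<close> and \<open>p\<close> that vanish at \<open>a\<close>, the map is \<open>B\<inverse> \<circ> A\<close>. Fixing both end points is
  what later makes the boundary terms disappear.
\<close>

lemma monotone_rearrangement:
  fixes p q :: "real \<Rightarrow> real"
  assumes "a < b" and p: "continuous_on {a..b} p" "\<And>x. x \<in> {a..b} \<Longrightarrow> p x > 0"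
    and q: "continuous_on {a..b} q" "\<And>x. x \<in> {a..b} \<Longrightarrow> q x > 0"
    and eq: "integral {a..b} p = integral {a..b} q"
  obtains T where "continuous_on {a..b} T" "T a = a" "T b = b"
    "\<And>x. x \<in> {a<..<b} \<Longrightarrow> T x \<in> {a<..<b}"
    "\<And>x. x \<in> {a<..<b} \<Longrightarrow> (T has_real_derivative q x / p (T x)) (at x)"
proof -
  let ?I = "{a..b}"
  define A where "A x = integral {a..x} q" for x
  define B where "B x = integral {a..x} p" for x
  have A': "(A has_real_derivative q x) (at x within ?I)" 
   and B': "(B has_real_derivative p x) (at x within ?I)" if "x \<in> ?I" for x
    unfolding A_def B_def
    using integral_has_vector_derivative[OF q(1) that] integral_has_vector_derivative[OF p(1) that]
    by (auto simp: has_real_derivative_iff_has_vector_derivative)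
  have contA: "continuous_on ?I A" and contB: "continuous_on ?I B"
    using A' B' by (meson DERIV_continuous_on)+
  have A'i: "(A has_real_derivative q x) (at x)" 
   and B'i: "(B has_real_derivative p x) (at x)" if "x \<in> {a<..<b}" for x
    using A'[of x] B'[of x] that by (auto simp: at_within_Icc_at)
  have smA: "A x < A y" if "x \<in> ?I" "y \<in> ?I" "x < y" for x y
  proof (rule DERIV_pos_imp_increasing_open[OF \<open>x < y\<close>])
    fix z assume "x < z" "z < y"
    then have "z \<in> {a<..<b}" "z \<in> ?I" using that by auto
    then show "\<exists>D. (A has_real_derivative D) (at z) \<and> D > 0" using A'i q(2) by blast
  qed (use that in \<open>auto intro: continuous_on_subset[OF contA]\<close>)
  have smB: "B x < B y" if "x \<in> ?I" "y \<in> ?I" "x < y" for x y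
  proof (rule DERIV_pos_imp_increasing_open[OF \<open>x < y\<close>])
    fix z assume "x < z" "z < y"
    then have "z \<in> {a<..<b}" "z \<in> ?I" using that by auto
    then show "\<exists>D. (B has_real_derivative D) (at z) \<and> D > 0" using B'i p(2) by blast
  qed (use that in \<open>auto intro: continuous_on_subset[OF contB]\<close>)
  have ends: "A a = 0" "B a = 0" "A b = B b" using eq by (auto simp: A_def B_def)
  have injB: "inj_on B ?I" 
    by (intro inj_onI) (metis smB linorder_neqE_linordered_idom order_less_irrefl)
  have rng: "A x \<in> B ` ?I" if "x \<in> ?I" for x
  proof -
    have "A a \<le> A x" "A x \<le> A b" using smA that by (metis atLeastAtMost_iff order_le_less \<open>a < b\<close> order_refl less_imp_le)+
    then have "\<exists>y\<ge>a. y \<le> b \<and> B y = A x"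
      using IVT'[of B a "A x" b] contB ends \<open>a < b\<close> by auto
    then show ?thesis by force
  qed
  define G where "G = the_inv_into ?I B"
  have GB: "G (B x) = x" if "x \<in> ?I" for x
    unfolding G_def by (rule the_inv_into_f_f[OF injB that])
  define T where "T x = G (A x)" for x
  have T: "T x \<in> ?I" "B (T x) = A x" if "x \<in> ?I" for x
    using rng[OF that] GB unfolding T_def by auto
  have contG: "continuous_on (B ` ?I) G"
    by (rule continuous_on_inv[OF contB]) (use GB in auto)
  have contT: "continuous_on ?I T"
    unfolding T_def
    by (rule continuous_on_compose2[OF contG contA]) (use rng in auto)
  have "T a = a" "T b = b"
    unfolding T_def using ends GB \<open>a < b\<close> by (metis atLeastAtMost_iff less_imp_le order_refl)+
  have Tint: "T x \<in> {a<..<b}" if "x \<in> {a<..<b}" for x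
  proof -
    have x: "x \<in> ?I" using that by auto
    have "A a < A x" "A x < A b" using smA that by auto
    then have "B a < B (T x)" "B (T x) < B b" using T[OF x] ends by auto
    then have "T x \<noteq> a" "T x \<noteq> b" by auto
    then show ?thesis using T(1)[OF x] by auto
  qed
  have Tder: "(T has_real_derivative q x / p (T x)) (at x)" if x: "x \<in> {a<..<b}" for x
  proof -
    note t = Tint[OF x]
    have "(G has_derivative (*) (inverse (p (T x)))) (at (B (T x)))"
    proof (rule has_derivative_inverse_strong[where S="{a<..<b}" and f=B and x="T x"])
      show "(B has_derivative (*) (p (T x))) (at (T x))"
        using B'i[OF t] by (simp add: has_field_derivative_def)
      show "continuous_on {a<..<b} B" using contB by (rule continuous_on_subset) auto
      show "(*) (p (T x)) \<circ> (*) (inverse (p (T x))) = id"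
        using p(2)[of "T x"] t by (auto simp: fun_eq_iff)
    qed (use t GB in auto)
    then have "(G has_real_derivative inverse (p (T x))) (at (B (T x)))"
      by (simp add: has_field_derivative_def)
    then have "(G has_real_derivative inverse (p (T x))) (at (A x))"
      using T(2)[of x] x by auto
    from DERIV_chain2[OF this A'i[OF x]] show ?thesis
      unfolding T_def by (simp add: field_simps)
  qed
  show thesis
    using that[of T] contT \<open>T a = a\<close> \<open>T b = b\<close> Tint Tder by blast
qed

text \<open>
  The transport proof of the Bakry-Emery criterion. Let \<open>T\<close> transport \<open>c f e\<^sup>-\<^sup>v\<close> to \<open>e\<^sup>-\<^sup>v\<close>, where \<open>c\<close> normalises. Taking
  logarithms in the Monge-Ampere equation \<open>c f e\<^sup>-\<^sup>v = e\<^sup>-\<^sup>v\<^sup>\<circ>\<^sup>T T'\<close> and using convexity of \<open>v\<close> and \<open>ln T' \<le> T' - 1\<close> gives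
  \<open>ln (c f) \<le> T' - 1 - v' (T - x) - K/2 (T - x)\<^sup>2\<close>. Multiplied by \<open>c f e\<^sup>-\<^sup>v\<close>, the right-hand side is the derivative of
  \<open>c f e\<^sup>-\<^sup>v (T - x)\<close> up to a term that a completed square bounds by the Fisher information. On a compact
  interval \<open>T - x\<close> vanishes at both ends.
\<close>

lemma log_sobolev_interval:
  fixes v v' f f' :: "real \<Rightarrow> real"
  assumes "a < b" "K > 0"
    and v: "\<And>x. (v has_real_derivative v' x) (at x)"
    and conv: "\<And>x y. v y \<ge> v x + v' x * (y - x) + K / 2 * (y - x)\<^sup>2"
    and f: "\<And>x. (f has_real_derivative f' x) (at x)" "\<And>x. f x > 0"
    and int: "(\<lambda>x. (f' x)\<^sup>2 / f x * exp (- v x)) integrable_on {a..b}"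
  defines "P \<equiv> integral {a..b} (\<lambda>x. exp (- v x))"
    and "F \<equiv> integral {a..b} (\<lambda>x. f x * exp (- v x))"
  shows "integral {a..b} (\<lambda>x. f x * ln (f x) * exp (- v x)) - F * ln (F / P)
    \<le> 1 / (2 * K) * integral {a..b} (\<lambda>x. (f' x)\<^sup>2 / f x * exp (- v x))"
proof -
  let ?I = "{a..b}"
  have cv: "continuous_on S v" and cf: "continuous_on S f" for S
    using v f(1) by (meson DERIV_continuous_on has_field_derivative_at_within)+
  have fp0: "f x \<noteq> 0" for x using f(2)[of x] by auto
  have ipos: "integral ?I g > 0" if "continuous_on ?I g" "\<And>x. g x > 0" for g :: "real \<Rightarrow> real"
  proof -
    have "integral ?I g \<noteq> 0"
      using integral_eq_0_iff[OF that(1) \<open>a < b\<close>] that(2) \<open>a < b\<close>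
      by (metis atLeastAtMost_iff less_eq_real_def less_irrefl)
    moreover have "integral ?I g \<ge> 0" 
      using that by (intro integral_nonneg integrable_continuous_real) (auto intro: less_imp_le)
    ultimately show ?thesis by simp
  qed
  have P: "P > 0" and F: "F > 0"
    unfolding P_def F_def by (intro ipos continuous_intros cv cf; simp add: f(2))+
  define c where "c = P / F"
  have c: "c > 0" using P F by (simp add: c_def)
  let ?p = "\<lambda>x. exp (- v x)"
  have iq: "integral ?I (\<lambda>x. c * f x * ?p x) = P"
    using F by (simp add: mult.assoc c_def flip: F_def)
  obtain T where T: "continuous_on {a..b} T" "T a = a" "T b = b"
    "\<And>x. x \<in> {a<..<b} \<Longrightarrow> T x \<in> {a<..<b}"
    "\<And>x. x \<in> {a<..<b} \<Longrightarrow> (T has_real_derivative (c * f x * ?p x) / ?p (T x)) (at x)"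
  proof (rule monotone_rearrangement[of a b ?p "\<lambda>x. c * f x * ?p x"])
    show "integral {a..b} ?p = integral {a..b} (\<lambda>x. c * f x * exp (- v x))"
      unfolding iq by (simp add: P_def)
  qed (use \<open>a < b\<close> f(2) c in \<open>auto intro!: continuous_intros cv cf\<close>)
  \<comment> \<open>The boundary term of the integration by parts.\<close>
  define G where "G x = c * f x * ?p x * (T x - x)" for x
  define T' where "T' x = (c * f x * ?p x) / ?p (T x)" for x
  define G' where "G' x = c * f' x * ?p x * (T x - x) - c * f x * v' x * ?p x * (T x - x)
       + c * f x * ?p x * (T' x - 1)" for x
  have G'i: "(G' has_integral (G b - G a)) ?I"
  proof (rule fundamental_theorem_of_calculus_interior)
    show "continuous_on ?I G" unfolding G_def by (intro continuous_intros T(1) cv cf)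
    fix x assume x: "x \<in> {a<..<b}"
    have "(G has_real_derivative G' x) (at x)"
      unfolding G_def G'_def T'_def
      by (rule derivative_eq_intros v f(1) T(5)[OF x] refl)+ (simp add: algebra_simps)
    then show "(G has_vector_derivative G' x) (at x)"
      by (simp add: has_real_derivative_iff_has_vector_derivative)
  qed (use \<open>a < b\<close> in auto)
  \<comment> \<open>What remains to be bounded: entropy density minus Fisher information density.\<close>
  define L where "L x = c * (f x * ln (f x) * ?p x) + ln c * (c * (f x * ?p x)) - c / (2 * K) * ((f' x)\<^sup>2 / f x * ?p x)" for x
  have i1: "(\<lambda>x. f x * ln (f x) * ?p x) integrable_on ?I"
    and i2: "(\<lambda>x. f x * ?p x) integrable_on ?I"
    by (intro integrable_continuous_real continuous_intros cv cf; simp add: fp0)+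
  have Li: "(L has_integral (c * integral ?I (\<lambda>x. f x * ln (f x) * ?p x) + ln c * (c * F)
      - c / (2 * K) * integral ?I (\<lambda>x. (f' x)\<^sup>2 / f x * ?p x))) ?I"
    unfolding L_def F_def
    by (intro has_integral_diff has_integral_add has_integral_mult_right integrable_integral i1 i2 int)
  have key: "L x \<le> G' x" if x: "x \<in> {a<..<b}" for x
  proof -
    have cf0: "c * f x > 0" using c f(2) by simp
    have T'pos: "T' x > 0" unfolding T'_def using c f(2) by simp
    have "ln (T' x) \<le> T' x - 1" using T'pos by (rule ln_le_minus_one)
    moreover have "ln (T' x) = ln (c * f x) - v x + v (T x)"
    proof -
      have "ln (T' x) = ln (c * f x * ?p x) - ln (?p (T x))"
        unfolding T'_def by (rule ln_divide_pos) (use cf0 in auto)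
      also have "ln (c * f x * ?p x) = ln (c * f x) + ln (?p x)"
        by (rule ln_mult_pos) (use cf0 in auto)
      finally show ?thesis by simp
    qed
    moreover have "v (T x) \<ge> v x + v' x * (T x - x) + K / 2 * (T x - x)\<^sup>2" by (rule conv)
    ultimately have lnb: "ln (c * f x) \<le> T' x - 1 - v' x * (T x - x) - K / 2 * (T x - x)\<^sup>2" by linarith
    have sq: "f' x * (T x - x) + f x * (K / 2) * (T x - x)\<^sup>2 \<ge> - 1 / (2 * K) * ((f' x)\<^sup>2 / f x)"
    proof -
      have "0 \<le> (f' x + K * f x * (T x - x))\<^sup>2 / (2 * K * f x)" using \<open>K > 0\<close> f(2)[of x] by simp
      also have "\<dots> = f' x * (T x - x) + f x * (K / 2) * (T x - x)\<^sup>2 + 1 / (2 * K) * ((f' x)\<^sup>2 / f x)"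
        using \<open>K > 0\<close> f(2)[of x] by (simp add: field_simps power2_eq_square)
      finally show ?thesis by simp
    qed
    have "f x * ln (c * f x) \<le> f x * (T' x - 1 - v' x * (T x - x) - K / 2 * (T x - x)\<^sup>2)"
      using f(2)[of x] lnb by simp
    also have "\<dots> = f x * (T' x - 1) - f x * v' x * (T x - x) - f x * (K / 2) * (T x - x)\<^sup>2"
      by (simp add: algebra_simps)
    finally have "f x * ln (c * f x) - 1 / (2 * K) * ((f' x)\<^sup>2 / f x)
        \<le> f' x * (T x - x) - f x * v' x * (T x - x) + f x * (T' x - 1)"
      using sq by linarith
    then have "(c * ?p x) * (f x * ln (c * f x) - 1 / (2 * K) * ((f' x)\<^sup>2 / f x))
        \<le> (c * ?p x) * (f' x * (T x - x) - f x * v' x * (T x - x) + f x * (T' x - 1))"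
      using c by (intro mult_left_mono) auto
    also have "\<dots> = G' x" by (simp add: G'_def algebra_simps)
    also have "(c * ?p x) * (f x * ln (c * f x) - 1 / (2 * K) * ((f' x)\<^sup>2 / f x)) = L x"
      using c f(2)[of x] by (simp add: L_def ln_mult_pos algebra_simps)
    finally show ?thesis .
  qed
  have "integral ?I L \<le> integral ?I G'"
  proof -
    have "integral {a<..<b} L \<le> integral {a<..<b} G'"
      using Li G'i key by (intro integral_le) (auto simp: integrable_on_open_interval_real)
    then show ?thesis by (simp add: integral_open_interval_real)
  qed
  then have "c * integral ?I (\<lambda>x. f x * ln (f x) * ?p x) + ln c * (c * F)
      - c / (2 * K) * integral ?I (\<lambda>x. (f' x)\<^sup>2 / f x * ?p x) \<le> 0"
    using integral_unique[OF Li] integral_unique[OF G'i] by (simp add: G_def T)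
  then have "c * (integral ?I (\<lambda>x. f x * ln (f x) * ?p x) + ln c * F
      - 1 / (2 * K) * integral ?I (\<lambda>x. (f' x)\<^sup>2 / f x * ?p x)) \<le> 0"
    by (simp add: algebra_simps)
  then have "integral ?I (\<lambda>x. f x * ln (f x) * ?p x) + ln c * F
      - 1 / (2 * K) * integral ?I (\<lambda>x. (f' x)\<^sup>2 / f x * ?p x) \<le> 0"
    using c by (simp add: mult_le_0_iff)
  moreover have "ln c * F = - (F * ln (F / P))"
    using F P by (simp add: c_def ln_div algebra_simps)
  ultimately show ?thesis by linarith
qed

lemma log_sobolev_line:
  fixes v v' f f' :: "real \<Rightarrow> real"
  assumes "K > 0"
    and v: "\<And>x. (v has_real_derivative v' x) (at x)"
    and conv: "\<And>x y. v y \<ge> v x + v' x * (y - x) + K / 2 * (y - x)\<^sup>2"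
    and iv: "integrable lborel (\<lambda>x. exp (- v x))"
    and f: "\<And>x. (f has_real_derivative f' x) (at x)" "\<And>x. \<epsilon> \<le> f x" "\<And>x. f x \<le> M" "\<epsilon> > 0"
    and f': "\<And>x. \<bar>f' x\<bar> \<le> B"
  defines "P \<equiv> \<integral>x. exp (- v x) \<partial>lborel"
    and "F \<equiv> \<integral>x. f x * exp (- v x) \<partial>lborel"
  shows "(\<integral>x. f x * ln (f x) * exp (- v x) \<partial>lborel) - F * ln (F / P)
    \<le> 1 / (2 * K) * (\<integral>x. (f' x)\<^sup>2 / f x * exp (- v x) \<partial>lborel)"
proof -
  have f0: "f x > 0" for x using f(2)[of x] f(4) by linarith
  have bint: "integrable lborel (\<lambda>x. g x * exp (- v x))"
    if "g \<in> borel_measurable borel" "\<And>x. \<bar>g x\<bar> \<le> C" for g C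
  proof (rule Bochner_Integration.integrable_bound)
    show "integrable lborel (\<lambda>x. C * exp (- v x))" using iv by simp
    show "(\<lambda>x. g x * exp (- v x)) \<in> borel_measurable lborel"
      using borel_measurable_integrable[OF iv] that(1) by simp
    have "C \<ge> 0" using that(2)[of 0] by linarith
    show "AE x in lborel. norm (g x * exp (- v x)) \<le> norm (C * exp (- v x))"
      by (rule AE_I2) (use that(2) \<open>C \<ge> 0\<close> in \<open>simp add: abs_mult mult_right_mono\<close>)
  qed
  have "continuous_on UNIV f"
    using f by (meson DERIV_continuous_on has_field_derivative_at_within)
  then have [measurable]: "f \<in> borel_measurable borel"
    by (rule borel_measurable_continuous_onI)
  have [measurable]: "f' \<in> borel_measurable borel"
    using borel_measurable_derivative[OF f(1)] .
  have iF: "integrable lborel (\<lambda>x. f x * exp (- v x))"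
    by (rule bint[of _ M]) (use f0 f in \<open>auto simp: abs_of_pos\<close>)
  have iE: "integrable lborel (\<lambda>x. f x * ln (f x) * exp (- v x))"
  proof (rule bint[of _ "M * (\<bar>ln \<epsilon>\<bar> + \<bar>ln M\<bar>)"])
    show "\<bar>f x * ln (f x)\<bar> \<le> M * (\<bar>ln \<epsilon>\<bar> + \<bar>ln M\<bar>)" for x
      by (rule abs_mult_ln_le[OF f(4) f(2) f(3)])
  qed measurable
  have iD: "integrable lborel (\<lambda>x. (f' x)\<^sup>2 / f x * exp (- v x))"
  proof (rule bint[of _ "B\<^sup>2 / \<epsilon>"])
    fix x
    have "(f' x)\<^sup>2 \<le> B\<^sup>2" using f'[of x] by (metis abs_ge_zero power2_abs power_mono)
    then show "\<bar>(f' x)\<^sup>2 / f x\<bar> \<le> B\<^sup>2 / \<epsilon>"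
      using f(2)[of x] f0[of x] f(4) by (simp add: frac_le)
  qed measurable
  let ?I = "\<lambda>n::nat. {- real (Suc n)..real (Suc n)}"
  have "P > 0" unfolding P_def by (rule integral_lborel_pos[OF iv]) simp
  have "F > 0" unfolding F_def by (rule integral_lborel_pos[OF iF]) (simp add: f0)
  have lE: "(\<lambda>n. integral (?I n) (\<lambda>x. f x * ln (f x) * exp (- v x)) 
      - integral (?I n) (\<lambda>x. f x * exp (- v x)) * ln (integral (?I n) (\<lambda>x. f x * exp (- v x)) / integral (?I n) (\<lambda>x. exp (- v x))))
     \<longlonglongrightarrow> (\<integral>x. f x * ln (f x) * exp (- v x) \<partial>lborel) - F * ln (F / P)"
    unfolding F_def P_def
    by (intro tendsto_intros integral_Icc_tendsto_lborel iF iE iv)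
      (use \<open>P > 0\<close> \<open>F > 0\<close> in \<open>simp_all add: P_def[symmetric] F_def[symmetric]\<close>)
  have lD: "(\<lambda>n. 1 / (2 * K) * integral (?I n) (\<lambda>x. (f' x)\<^sup>2 / f x * exp (- v x)))
     \<longlonglongrightarrow> 1 / (2 * K) * (\<integral>x. (f' x)\<^sup>2 / f x * exp (- v x) \<partial>lborel)"
    by (intro tendsto_intros integral_Icc_tendsto_lborel iD)
  show ?thesis
    by (rule LIMSEQ_le[OF lE lD], intro exI allI impI, rule log_sobolev_interval)
      (use \<open>K > 0\<close> v conv f(1) f0 integral_Icc_tendsto_lborel(1)[OF iD] in auto)
qed

text \<open>
  Integration by parts gives \<open>\<integral> (x - c) v' e\<^sup>-\<^sup>v = \<integral> e\<^sup>-\<^sup>v\<close> up to boundary terms of the right sign, and convexity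
  gives \<open>(x - c) v' \<ge> K (x - c)\<^sup>2\<close> when \<open>c\<close> is the critical point.
\<close>

lemma second_moment_le:
  fixes v v' :: "real \<Rightarrow> real"
  assumes "K > 0"
    and v: "\<And>x. (v has_real_derivative v' x) (at x)"
    and conv: "\<And>x y. v y \<ge> v x + v' x * (y - x) + K / 2 * (y - x)\<^sup>2"
    and iv: "integrable lborel (\<lambda>x. exp (- v x))"
    and iv2: "integrable lborel (\<lambda>x. (x - c)\<^sup>2 * exp (- v x))"
    and c: "v' c = 0"
  shows "K * (\<integral>x. (x - c)\<^sup>2 * exp (- v x) \<partial>lborel) \<le> (\<integral>x. exp (- v x) \<partial>lborel)"
proof -
  let ?I = "\<lambda>n::nat. {- real (Suc n)..real (Suc n)}"
  let ?G = "\<lambda>x. - ((x - c) * exp (- v x))"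
  define G' where "G' x = (x - c) * v' x * exp (- v x) - exp (- v x)" for x
  have "K * integral (?I n) (\<lambda>x. (x - c)\<^sup>2 * exp (- v x)) \<le> integral (?I n) (\<lambda>x. exp (- v x))"
    if n: "\<bar>c\<bar> \<le> real (Suc n)" for n
  proof -
    let ?a = "- real (Suc n)" and ?b = "real (Suc n)"
    have G: "(G' has_integral (?G ?b - ?G ?a)) (?I n)"
    proof (rule fundamental_theorem_of_calculus)
      fix x
      have "(?G has_real_derivative G' x) (at x)"
        unfolding G'_def by (rule derivative_eq_intros v refl)+ (simp add: algebra_simps)
      then show "(?G has_vector_derivative G' x) (at x within ?I n)"
        by (simp add: has_real_derivative_iff_has_vector_derivative has_vector_derivative_at_within)
    qed simp
    have le: "?G ?b - ?G ?a \<le> 0"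
    proof -
      have "(?b - c) * exp (- v ?b) \<ge> 0" "(?a - c) * exp (- v ?a) \<le> 0"
        using n by (auto intro!: mult_nonneg_nonneg mult_nonpos_nonneg)
      then show ?thesis by linarith
    qed
    have "((\<lambda>x. K * ((x - c)\<^sup>2 * exp (- v x))) has_integral K * integral (?I n) (\<lambda>x. (x - c)\<^sup>2 * exp (- v x))) (?I n)"
      by (intro has_integral_mult_right integrable_integral integral_Icc_tendsto_lborel(1) iv2)
    moreover have "((\<lambda>x. G' x + exp (- v x)) has_integral ((?G ?b - ?G ?a) + integral (?I n) (\<lambda>x. exp (- v x)))) (?I n)"
      by (intro has_integral_add G integrable_integral integral_Icc_tendsto_lborel(1) iv)
    moreover have "K * ((x - c)\<^sup>2 * exp (- v x)) \<le> G' x + exp (- v x)" for x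
    proof -
      have "v x \<ge> v c + v' c * (x - c) + K / 2 * (x - c)\<^sup>2"
        "v c \<ge> v x + v' x * (c - x) + K / 2 * (c - x)\<^sup>2" by (rule conv)+
      then have "K * (x - c)\<^sup>2 \<le> (x - c) * v' x"
        using c by (simp add: power2_commute[of c x]) (simp add: algebra_simps)
      then have "K * (x - c)\<^sup>2 * exp (- v x) \<le> (x - c) * v' x * exp (- v x)"
        by (intro mult_right_mono) auto
      then show ?thesis by (simp add: G'_def mult.assoc)
    qed
    ultimately have "K * integral (?I n) (\<lambda>x. (x - c)\<^sup>2 * exp (- v x)) \<le> (?G ?b - ?G ?a) + integral (?I n) (\<lambda>x. exp (- v x))"
      by (rule has_integral_le)
    with le show ?thesis by linarith
  qed
  moreover obtain N :: nat where "\<bar>c\<bar> \<le> real N" using real_arch_simple by blast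
  ultimately have "\<exists>N. \<forall>n\<ge>N. K * integral (?I n) (\<lambda>x. (x - c)\<^sup>2 * exp (- v x)) \<le> integral (?I n) (\<lambda>x. exp (- v x))"
    by (intro exI[of _ N]) (auto simp: le_Suc_eq)
  then show ?thesis
    by (intro LIMSEQ_le[OF tendsto_mult_left[OF integral_Icc_tendsto_lborel(2)[OF iv2]]
          integral_Icc_tendsto_lborel(2)[OF iv]])
qed

section \<open>Single-site measures and bounded perturbations\<close>

text \<open>
  Quadratic terms arise when the interaction is bounded by its diagonal, linear terms from the external
  field; neither may destroy integrability.
\<close>

definition has_gaussian_tails :: "(real \<Rightarrow> real) \<Rightarrow> bool" where
  "has_gaussian_tails u \<longleftrightarrow> continuous_on UNIV u \<and>
     (\<forall>c h. integrable lborel (\<lambda>y. exp (c * y\<^sup>2 + h * y - u y)))"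

lemma has_gaussian_tails_integrable:
  assumes "has_gaussian_tails u"
  shows "integrable lborel (\<lambda>y. exp (h * y - u y))"
proof -
  have "integrable lborel (\<lambda>y. exp (0 * y\<^sup>2 + h * y - u y))"
    using assms unfolding has_gaussian_tails_def by blast
  then show ?thesis by simp
qed

lemma has_gaussian_tails_measurable [measurable_dest]:
  "has_gaussian_tails u \<Longrightarrow> u \<in> borel_measurable borel"
  by (simp add: has_gaussian_tails_def borel_measurable_continuous_onI)

lemma exp_abs_le: "exp (a * \<bar>y\<bar>) \<le> exp (a * y) + exp (- a * y)" for a y :: real
proof (cases "y \<ge> 0")
  case True
  then show ?thesis by simp
next
  case False
  then show ?thesis by simp
qed

lemma has_gaussian_tails_integrable_bound:
  fixes g :: "real \<Rightarrow> real" and C :: real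
  assumes u: "has_gaussian_tails u" and g: "g \<in> borel_measurable borel"
    and le: "\<And>y. \<bar>g y\<bar> \<le> C * exp (a * \<bar>y\<bar>) * exp (h * y - u y)" "C \<ge> 0"
  shows "integrable lborel g"
proof (rule Bochner_Integration.integrable_bound)
  show "integrable lborel (\<lambda>y. C * (exp ((h + a) * y - u y) + exp ((h - a) * y - u y)))"
    by (intro integrable_mult_right Bochner_Integration.integrable_add has_gaussian_tails_integrable u)
  show "g \<in> borel_measurable lborel" using g by simp
  show "AE y in lborel. norm (g y) \<le> norm (C * (exp ((h + a) * y - u y) + exp ((h - a) * y - u y)))"
  proof (rule AE_I2)
    fix y
    have "\<bar>g y\<bar> \<le> C * exp (a * \<bar>y\<bar>) * exp (h * y - u y)" by (rule le)
    also have "\<dots> \<le> C * (exp (a * y) + exp (- a * y)) * exp (h * y - u y)"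
      by (intro mult_left_mono mult_right_mono exp_abs_le le) auto
    also have "\<dots> = C * (exp ((h + a) * y - u y) + exp ((h - a) * y - u y))"
      by (simp add: algebra_simps flip: exp_add)
    finally show "norm (g y) \<le> norm (C * (exp ((h + a) * y - u y) + exp ((h - a) * y - u y)))"
      by simp
  qed
qed

lemma abs_power_le_exp: "\<bar>y\<bar> ^ k \<le> exp (real k * \<bar>y\<bar>)" for y :: real
proof -
  have "\<bar>y\<bar> \<le> exp \<bar>y\<bar>" using exp_ge_add_one_self[of "\<bar>y\<bar>"] by linarith
  then have "\<bar>y\<bar> ^ k \<le> exp \<bar>y\<bar> ^ k" by (rule power_mono) simp
  then show ?thesis by (simp add: exp_of_nat_mult)
qed

lemma has_gaussian_tails_integrable_power:
  assumes u: "has_gaussian_tails u"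
  shows "integrable lborel (\<lambda>y. y ^ k * exp (h * y - u y))"
proof (rule has_gaussian_tails_integrable_bound[OF u, of _ 1 "real k" h])
  have [measurable]: "u \<in> borel_measurable borel" by (rule has_gaussian_tails_measurable[OF u])
  show "(\<lambda>y. y ^ k * exp (h * y - u y)) \<in> borel_measurable borel" by measurable
  show "\<bar>y ^ k * exp (h * y - u y)\<bar> \<le> 1 * exp (real k * \<bar>y\<bar>) * exp (h * y - u y)" for y
    using mult_right_mono[OF abs_power_le_exp[of y k], of "exp (h * y - u y)"]
    by (simp add: abs_mult power_abs)
qed simp

definition site_measure :: "(real \<Rightarrow> real) \<Rightarrow> real \<Rightarrow> real measure" where
  "site_measure u h = density lborel
     (\<lambda>y. ennreal (exp (h * y - u y) / (\<integral>z. exp (h * z - u z) \<partial>lborel)))"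

lemma site_partition_pos: "has_gaussian_tails u \<Longrightarrow> (\<integral>z. exp (h * z - u z) \<partial>lborel) > 0"
  by (rule integral_lborel_pos[OF has_gaussian_tails_integrable]) simp_all

lemma sets_site_measure [simp, measurable_cong]: "sets (site_measure u h) = sets borel"
  by (simp add: site_measure_def)

lemma space_site_measure [simp]: "space (site_measure u h) = UNIV"
  by (simp add: site_measure_def)

lemma prob_space_site_measure:
  assumes u: "has_gaussian_tails u"
  shows "prob_space (site_measure u h)"
proof
  have [measurable]: "u \<in> borel_measurable borel" by (rule has_gaussian_tails_measurable[OF u])
  let ?Z = "\<integral>z. exp (h * z - u z) \<partial>lborel"
  have i: "integrable lborel (\<lambda>y. exp (h * y - u y) / ?Z)"
    using has_gaussian_tails_integrable[OF u] by simp
  have "emeasure (site_measure u h) (space (site_measure u h))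
      = (\<integral>\<^sup>+y. ennreal (exp (h * y - u y) / ?Z) \<partial>lborel)"
    unfolding site_measure_def by (subst emeasure_density) auto
  also have "\<dots> = ennreal (\<integral>y. exp (h * y - u y) / ?Z \<partial>lborel)"
    by (rule nn_integral_eq_integral[OF i]) (use site_partition_pos[OF u, of h] in auto)
  also have "(\<integral>y. exp (h * y - u y) / ?Z \<partial>lborel) = 1"
    using site_partition_pos[OF u, of h] by simp
  finally show "emeasure (site_measure u h) (space (site_measure u h)) = 1" by simp
qed

lemma integral_site_measure:
  assumes u: "has_gaussian_tails u" and [measurable]: "g \<in> borel_measurable borel"
  shows "(\<integral>y. g y \<partial>site_measure u h)
    = (\<integral>y. g y * exp (h * y - u y) \<partial>lborel) / (\<integral>y. exp (h * y - u y) \<partial>lborel)"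
    and "integrable (site_measure u h) g \<longleftrightarrow> integrable lborel (\<lambda>y. g y * exp (h * y - u y))"
proof -
  have [measurable]: "u \<in> borel_measurable borel" by (rule has_gaussian_tails_measurable[OF u])
  let ?Z = "\<integral>z. exp (h * z - u z) \<partial>lborel"
  have Z: "?Z > 0" by (rule site_partition_pos[OF u])
  have "(\<integral>y. g y \<partial>site_measure u h) = (\<integral>y. (exp (h * y - u y) / ?Z) *\<^sub>R g y \<partial>lborel)"
    unfolding site_measure_def by (rule integral_density) (use Z in auto)
  also have "\<dots> = (\<integral>y. g y * exp (h * y - u y) / ?Z \<partial>lborel)"
    by (simp add: mult.commute)
  finally show "(\<integral>y. g y \<partial>site_measure u h)
    = (\<integral>y. g y * exp (h * y - u y) \<partial>lborel) / (\<integral>y. exp (h * y - u y) \<partial>lborel)" by simp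
  have "integrable (site_measure u h) g \<longleftrightarrow> integrable lborel (\<lambda>y. (exp (h * y - u y) / ?Z) *\<^sub>R g y)"
    unfolding site_measure_def by (rule integrable_density) (use Z in auto)
  also have "\<dots> \<longleftrightarrow> integrable lborel (\<lambda>y. (1 / ?Z) * (g y * exp (h * y - u y)))"
    by (simp add: mult.commute)
  also have "\<dots> \<longleftrightarrow> integrable lborel (\<lambda>y. g y * exp (h * y - u y))"
    using Z by (subst integrable_mult_left_iff) auto
  finally show "integrable (site_measure u h) g \<longleftrightarrow> integrable lborel (\<lambda>y. g y * exp (h * y - u y))" .
qed

lemma integrable_bounded_site_measure:
  fixes g :: "real \<Rightarrow> real"
  assumes u: "has_gaussian_tails u" and "g \<in> borel_measurable borel" "\<And>y. \<bar>g y\<bar> \<le> C"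
  shows "integrable (site_measure u h) g"
proof -
  interpret prob_space "site_measure u h" by (rule prob_space_site_measure[OF u])
  show ?thesis
  proof (rule integrable_const_bound[of _ C])
    show "AE y in site_measure u h. norm (g y) \<le> C" using assms(3) by simp
    show "g \<in> borel_measurable (site_measure u h)"
      using assms(2) measurable_cong_sets[OF sets_site_measure refl] by blast
  qed
qed

text \<open>
  Holley-Stroock: for both measures the unnormalised entropy is an infimum over constants \<open>c\<close> of the integral of
  the nonnegative function \<open>f ln (f / c) - f + c\<close>. With the constant that is optimal for \<open>e\<^sup>-\<^sup>v\<close>, passing from \<open>u\<close> to \<open>v\<close>
  only increases the left-hand side, and passing back costs the factor \<open>e\<^sup>\<delta>\<close> on the right-hand side.
\<close>

lemma site_log_sobolev_perturbation:
  fixes u v w v' f f' :: "real \<Rightarrow> real" and M B :: real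
  assumes "K > 0" and u: "has_gaussian_tails u"
    and uvw: "\<And>y. u y = v y + w y" and w: "\<And>y. 0 \<le> w y" "\<And>y. w y \<le> \<delta>"
    and v: "\<And>x. (v has_real_derivative v' x) (at x)"
    and conv: "\<And>x y. v y \<ge> v x + v' x * (y - x) + K / 2 * (y - x)\<^sup>2"
    and f: "\<And>x. (f has_real_derivative f' x) (at x)" "\<And>x. \<epsilon> \<le> f x" "\<And>x. f x \<le> M" "\<epsilon> > 0"
    and f': "\<And>x. \<bar>f' x\<bar> \<le> B"
  shows "Ent (site_measure u h) f \<le> 1 / (2 * (K * exp (- \<delta>))) * (\<integral>y. (f' y)\<^sup>2 / f y \<partial>site_measure u h)"
proof -
  have [measurable]: "u \<in> borel_measurable borel" by (rule has_gaussian_tails_measurable[OF u])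
  have "continuous_on UNIV v"
    using v by (meson DERIV_continuous_on has_field_derivative_at_within)
  then have [measurable]: "v \<in> borel_measurable borel"
    by (rule borel_measurable_continuous_onI)
  have "continuous_on UNIV f"
    using f by (meson DERIV_continuous_on has_field_derivative_at_within)
  then have mF[measurable]: "f \<in> borel_measurable borel"
    by (rule borel_measurable_continuous_onI)
  have [measurable]: "f' \<in> borel_measurable borel"
    using borel_measurable_derivative[OF f(1)] .
  have f0: "f x > 0" for x using f(2)[of x] f(4) by linarith
  define V where "V y = v y - h * y" for y
  define V' where "V' y = v' y - h" for y
  have V: "(V has_real_derivative V' x) (at x)" for x
    unfolding V_def V'_def by (rule derivative_eq_intros v refl)+ simp
  have Vconv: "V y \<ge> V x + V' x * (y - x) + K / 2 * (y - x)\<^sup>2" for x y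
    using conv[of x y] by (simp add: V_def V'_def algebra_simps)
  let ?U = "\<lambda>y. exp (h * y - u y)" and ?V = "\<lambda>y. exp (- V y)"
  have UV: "?U y \<le> ?V y" "?V y \<le> exp \<delta> * ?U y" for y
    using w[of y] by (auto simp: V_def uvw simp flip: exp_add)
  have iU: "integrable lborel ?U" by (rule has_gaussian_tails_integrable[OF u])
  have iV: "integrable lborel ?V"
    by (rule Bochner_Integration.integrable_bound[of _ "\<lambda>y. exp \<delta> * ?U y"])
      (use iU UV(2) in \<open>auto simp: V_def\<close>)
  have bU: "integrable lborel (\<lambda>x. g x * ?U x)" and bV: "integrable lborel (\<lambda>x. g x * ?V x)"
    if [measurable]: "g \<in> borel_measurable borel" and "\<And>x. \<bar>g x\<bar> \<le> C" for g C
  proof -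
    have "C \<ge> 0" using that(2)[of 0] by linarith
    then have *: "norm (g x * ?V x) \<le> norm (C * ?V x)" "norm (g x * ?U x) \<le> norm (C * ?U x)" for x
      using that(2) by (auto simp: abs_mult intro!: mult_right_mono)
    show "integrable lborel (\<lambda>x. g x * ?V x)"
      by (rule Bochner_Integration.integrable_bound[of _ "\<lambda>y. C * ?V y"])
        (use iV *(1) in \<open>auto simp: V_def\<close>)
    show "integrable lborel (\<lambda>x. g x * ?U x)"
      by (rule Bochner_Integration.integrable_bound[of _ "\<lambda>y. C * ?U y"])
        (use iU *(2) in auto)
  qed
  have fb: "\<bar>f x\<bar> \<le> M" for x using f0[of x] f(3)[of x] by auto
  have lb: "\<bar>f x * ln (f x)\<bar> \<le> M * (\<bar>ln \<epsilon>\<bar> + \<bar>ln M\<bar>)" for x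
    by (rule abs_mult_ln_le[OF f(4) f(2) f(3)])
  have db: "\<bar>(f' x)\<^sup>2 / f x\<bar> \<le> B\<^sup>2 / \<epsilon>" for x
  proof -
    have "(f' x)\<^sup>2 \<le> B\<^sup>2" using f'[of x] by (metis abs_ge_zero power2_abs power_mono)
    then show ?thesis
      using f(2)[of x] f0[of x] f(4) by (simp add: frac_le)
  qed
  have mD: "(\<lambda>x. (f' x)\<^sup>2 / f x) \<in> borel_measurable borel" 
   and mE: "(\<lambda>x. f x * ln (f x)) \<in> borel_measurable borel" by measurable
  note ints = bU[OF mF fb] bV[OF mF fb] bU[OF mE lb] bV[OF mE lb] bU[OF mD db] bV[OF mD db] iU iV
  define ZU where "ZU = (\<integral>y. ?U y \<partial>lborel)"
  define ZV where "ZV = (\<integral>y. ?V y \<partial>lborel)"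
  define FU where "FU = (\<integral>y. f y * ?U y \<partial>lborel)"
  define FV where "FV = (\<integral>y. f y * ?V y \<partial>lborel)"
  have pos: "ZU > 0" "ZV > 0" "FU > 0" "FV > 0"
    unfolding ZU_def ZV_def FU_def FV_def by (rule integral_lborel_pos; use ints f0 in simp)+
  \<comment> \<open>The optimal constant for the convex part, not for \<open>u\<close>.\<close>
  define c where "c = FV / ZV"
  have c: "c > 0" unfolding c_def using pos by simp
  have point: "0 \<le> f x * ln (f x) - f x * ln c - f x + c" for x
  proof -
    have "ln (c / f x) \<le> c / f x - 1" using c f0[of x] by (intro ln_le_minus_one) auto
    then have "f x * (ln c - ln (f x)) \<le> f x * (c / f x - 1)"
      using f0[of x] c by (intro mult_left_mono) (auto simp: ln_divide_pos)
    then show ?thesis using f0[of x] by (simp add: algebra_simps)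
  qed
  have dec: "(\<integral>x. (f x * ln (f x) - f x * ln c - f x + c) * ?U x \<partial>lborel)
      = (\<integral>x. f x * ln (f x) * ?U x \<partial>lborel) - ln c * FU - FU + c * ZU"
    "(\<integral>x. (f x * ln (f x) - f x * ln c - f x + c) * ?V x \<partial>lborel)
      = (\<integral>x. f x * ln (f x) * ?V x \<partial>lborel) - ln c * FV - FV + c * ZV"
    and di: "integrable lborel (\<lambda>x. (f x * ln (f x) - f x * ln c - f x + c) * ?U x)"
    "integrable lborel (\<lambda>x. (f x * ln (f x) - f x * ln c - f x + c) * ?V x)"
  proof -
    have eq: "(f x * ln (f x) - f x * ln c - f x + c) * a =
       f x * ln (f x) * a - ln c * (f x * a) - f x * a + c * a" for a x
      by (simp add: algebra_simps)
    show "(\<integral>x. (f x * ln (f x) - f x * ln c - f x + c) * ?U x \<partial>lborel)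
      = (\<integral>x. f x * ln (f x) * ?U x \<partial>lborel) - ln c * FU - FU + c * ZU"
      unfolding eq ZU_def FU_def using ints by simp
    show "(\<integral>x. (f x * ln (f x) - f x * ln c - f x + c) * ?V x \<partial>lborel)
      = (\<integral>x. f x * ln (f x) * ?V x \<partial>lborel) - ln c * FV - FV + c * ZV"
      unfolding eq ZV_def FV_def using ints by simp
    show "integrable lborel (\<lambda>x. (f x * ln (f x) - f x * ln c - f x + c) * ?U x)"
    "integrable lborel (\<lambda>x. (f x * ln (f x) - f x * ln c - f x + c) * ?V x)"
      unfolding eq using ints by auto
  qed
  have "(\<integral>x. f x * ln (f x) * ?U x \<partial>lborel) - FU * ln (FU / ZU)
      \<le> (\<integral>x. f x * ln (f x) * ?U x \<partial>lborel) - ln c * FU - FU + c * ZU"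
  proof -
    have "ln (c * ZU / FU) \<le> c * ZU / FU - 1" using c pos by (intro ln_le_minus_one) auto
    then have "FU * (ln c - ln (FU / ZU)) \<le> FU * (c * ZU / FU - 1)"
      using pos c by (intro mult_left_mono) (auto simp: ln_divide_pos ln_mult_pos)
    then show ?thesis using pos by (simp add: algebra_simps)
  qed
  also have "\<dots> \<le> (\<integral>x. f x * ln (f x) * ?V x \<partial>lborel) - ln c * FV - FV + c * ZV"
    unfolding dec[symmetric] using di point UV by (intro integral_mono mult_left_mono) auto
  also have "\<dots> = (\<integral>x. f x * ln (f x) * ?V x \<partial>lborel) - FV * ln (FV / ZV)"
    using pos by (simp add: c_def)
  also have "\<dots> \<le> 1 / (2 * K) * (\<integral>x. (f' x)\<^sup>2 / f x * ?V x \<partial>lborel)"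
    unfolding FV_def ZV_def by (rule log_sobolev_line[OF \<open>K > 0\<close> V Vconv iV f f'])
  also have "\<dots> \<le> 1 / (2 * K) * (\<integral>x. exp \<delta> * ((f' x)\<^sup>2 / f x * ?U x) \<partial>lborel)"
  proof (rule mult_left_mono, rule integral_mono)
    fix x
    have "(f' x)\<^sup>2 / f x * ?V x \<le> (f' x)\<^sup>2 / f x * (exp \<delta> * ?U x)"
      using f0[of x] UV by (intro mult_left_mono) auto
    then show "(f' x)\<^sup>2 / f x * ?V x \<le> exp \<delta> * ((f' x)\<^sup>2 / f x * ?U x)" by (simp add: algebra_simps)
  next
    show "integrable lborel (\<lambda>x. (f' x)\<^sup>2 / f x * ?V x)" by (rule bV[OF mD db])
    show "integrable lborel (\<lambda>x. exp \<delta> * ((f' x)\<^sup>2 / f x * ?U x))"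
      by (rule integrable_mult_right, rule bU[OF mD db])
  qed (use \<open>K > 0\<close> in simp)
  also have "\<dots> = 1 / (2 * (K * exp (- \<delta>))) * (\<integral>x. (f' x)\<^sup>2 / f x * ?U x \<partial>lborel)"
    unfolding integral_mult_right_zero by (simp add: exp_minus divide_simps)
  finally have main: "(\<integral>x. f x * ln (f x) * ?U x \<partial>lborel) - FU * ln (FU / ZU)
     \<le> 1 / (2 * (K * exp (- \<delta>))) * (\<integral>x. (f' x)\<^sup>2 / f x * ?U x \<partial>lborel)" .
  have "Ent (site_measure u h) f = ((\<integral>x. f x * ln (f x) * ?U x \<partial>lborel) - FU * ln (FU / ZU)) / ZU"
    unfolding Ent_def integral_site_measure(1)[OF u mE] integral_site_measure(1)[OF u mF]
      FU_def ZU_def by (simp add: diff_divide_distrib)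
  also have "\<dots> \<le> (1 / (2 * (K * exp (- \<delta>))) * (\<integral>x. (f' x)\<^sup>2 / f x * ?U x \<partial>lborel)) / ZU"
    using pos main by (intro divide_right_mono) auto
  also have "\<dots> = 1 / (2 * (K * exp (- \<delta>))) * (\<integral>y. (f' y)\<^sup>2 / f y \<partial>site_measure u h)"
    unfolding ZU_def integral_site_measure(1)[OF u mD] by simp
  finally show ?thesis .
qed

text \<open>
  The same comparison for the variance, which is an infimum over centres. The linear field shifts the
  critical point, hence the hypothesis on \<open>c\<close>.
\<close>

lemma site_variance_perturbation:
  fixes u v w v' :: "real \<Rightarrow> real"
  assumes "K > 0" and u: "has_gaussian_tails u"
    and uvw: "\<And>y. u y = v y + w y" and w: "\<And>y. 0 \<le> w y" "\<And>y. w y \<le> \<delta>"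
    and v: "\<And>x. (v has_real_derivative v' x) (at x)"
    and conv: "\<And>x y. v y \<ge> v x + v' x * (y - x) + K / 2 * (y - x)\<^sup>2"
    and c: "v' c = h"
  shows "Var (site_measure u h) (\<lambda>y. y) \<le> 1 / (K * exp (- \<delta>))"
proof -
  have [measurable]: "u \<in> borel_measurable borel" by (rule has_gaussian_tails_measurable[OF u])
  have "continuous_on UNIV v"
    using v by (meson DERIV_continuous_on has_field_derivative_at_within)
  then have [measurable]: "v \<in> borel_measurable borel"
    by (rule borel_measurable_continuous_onI)
  define V where "V y = v y - h * y" for y
  define V' where "V' y = v' y - h" for y
  have V: "(V has_real_derivative V' x) (at x)" for x
    unfolding V_def V'_def by (rule derivative_eq_intros v refl)+ simp
  have Vconv: "V y \<ge> V x + V' x * (y - x) + K / 2 * (y - x)\<^sup>2" for x y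
    using conv[of x y] by (simp add: V_def V'_def algebra_simps)
  let ?U = "\<lambda>y. exp (h * y - u y)" and ?V = "\<lambda>y. exp (- V y)"
  have UV: "?U y \<le> ?V y" "?V y \<le> exp \<delta> * ?U y" for y
    using w[of y] by (auto simp: V_def uvw simp flip: exp_add)
  have iU: "integrable lborel ?U" by (rule has_gaussian_tails_integrable[OF u])
  have iV: "integrable lborel ?V"
    by (rule Bochner_Integration.integrable_bound[of _ "\<lambda>y. exp \<delta> * ?U y"])
      (use iU UV(2) in \<open>auto simp: V_def\<close>)
  have i1U: "integrable lborel (\<lambda>y. y * ?U y)" 
    using has_gaussian_tails_integrable_power[OF u, of 1 h] by simp
  have i2: "integrable lborel (\<lambda>y. (y - a)\<^sup>2 * ?U y)" for a
  proof -
    have "(y - a)\<^sup>2 * ?U y = y ^ 2 * ?U y - 2 * a * (y * ?U y) + a\<^sup>2 * ?U y" for y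
      by (simp add: power2_eq_square algebra_simps)
    then show ?thesis
      using has_gaussian_tails_integrable_power[OF u, of 2 h] i1U iU by simp
  qed
  have i2V: "integrable lborel (\<lambda>y. (y - c)\<^sup>2 * ?V y)"
  proof (rule Bochner_Integration.integrable_bound[of _ "\<lambda>y. exp \<delta> * ((y - c)\<^sup>2 * ?U y)"])
    show "AE y in lborel. norm ((y - c)\<^sup>2 * ?V y) \<le> norm (exp \<delta> * ((y - c)\<^sup>2 * ?U y))"
      using mult_left_mono[OF UV(2), of "(y - c)\<^sup>2" for y] 
      by (auto intro!: AE_I2 simp: abs_mult mult.left_commute)
  qed (use i2 in \<open>auto simp: V_def\<close>)
  define ZU where "ZU = (\<integral>y. ?U y \<partial>lborel)"
  have Z: "ZU > 0" unfolding ZU_def by (rule site_partition_pos[OF u])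
  interpret prob_space "site_measure u h" by (rule prob_space_site_measure[OF u])
  let ?m = "\<integral>y. y \<partial>site_measure u h"
  have s: "integrable (site_measure u h) (\<lambda>y. (y - a)\<^sup>2)" for a
    by (subst integral_site_measure(2)[OF u]) (use i2 in auto)
  have s1: "integrable (site_measure u h) (\<lambda>y. y)"
    by (subst integral_site_measure(2)[OF u]) (use i1U in auto)
  have "Var (site_measure u h) (\<lambda>y. y) + (?m - c)\<^sup>2 = (\<integral>y. (y - c)\<^sup>2 \<partial>site_measure u h)"
  proof -
    have "(y - c)\<^sup>2 = (y - ?m)\<^sup>2 + (2 * (?m - c)) * y + (c\<^sup>2 - ?m\<^sup>2)" for y
      by (simp add: power2_eq_square algebra_simps)
    then have "(\<integral>y. (y - c)\<^sup>2 \<partial>site_measure u h)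
       = (\<integral>y. (y - ?m)\<^sup>2 \<partial>site_measure u h) + (2 * (?m - c)) * ?m + (c\<^sup>2 - ?m\<^sup>2)"
      using s s1 by (simp add: prob_space[unfolded space_site_measure])
    then show ?thesis by (simp add: Var_def power2_eq_square algebra_simps)
  qed
  then have "Var (site_measure u h) (\<lambda>y. y) \<le> (\<integral>y. (y - c)\<^sup>2 \<partial>site_measure u h)"
    by (smt (verit) zero_le_power2)
  also have "\<dots> = (\<integral>y. (y - c)\<^sup>2 * ?U y \<partial>lborel) / ZU"
    unfolding ZU_def by (rule integral_site_measure(1)[OF u]) simp
  also have "\<dots> \<le> (\<integral>y. (y - c)\<^sup>2 * ?V y \<partial>lborel) / ZU"
    by (intro divide_right_mono integral_mono mult_left_mono i2 i2V UV) (use Z in auto)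
  also have "\<dots> \<le> ((\<integral>y. ?V y \<partial>lborel) / K) / ZU"
    using second_moment_le[OF \<open>K > 0\<close> V Vconv iV i2V] c Z \<open>K > 0\<close>
    by (intro divide_right_mono) (auto simp: V'_def field_simps)
  also have "\<dots> \<le> ((\<integral>y. exp \<delta> * ?U y \<partial>lborel) / K) / ZU"
    using Z \<open>K > 0\<close> by (intro divide_right_mono integral_mono UV iV integrable_mult_right iU) auto
  also have "\<dots> = 1 / (K * exp (- \<delta>))"
    using Z \<open>K > 0\<close> unfolding ZU_def by (simp add: exp_minus field_simps)
  finally show ?thesis .
qed

section \<open>Dependence of a single site on its field\<close>

text \<open>
  What the many-site argument needs to know about a single site, uniformly in the external field.
\<close>

locale single_site =
  fixes u :: "real \<Rightarrow> real" and \<sigma> :: real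
  assumes tails: "has_gaussian_tails u" and \<sigma>_pos: "\<sigma> > 0"
    and log_sobolev: "\<lbrakk>\<And>x. (f has_real_derivative f' x) (at x); \<And>x. \<epsilon> \<le> f x; \<And>x. f x \<le> M; \<epsilon> > 0;
        \<And>x. \<bar>f' x\<bar> \<le> B\<rbrakk> \<Longrightarrow>
      Ent (site_measure u h) f \<le> 1 / (2 * \<sigma>) * (\<integral>y. (f' y)\<^sup>2 / f y \<partial>site_measure u h)"
    and variance_le: "Var (site_measure u h) (\<lambda>y. y) \<le> 1 / \<sigma>"

context single_site
begin

definition site_partition :: "real \<Rightarrow> real" where
  "site_partition h = (\<integral>y. exp (h * y - u y) \<partial>lborel)"

definition site_mean :: "real \<Rightarrow> real" where
  "site_mean h = (\<integral>y. y \<partial>site_measure u h)"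

lemma u_measurable [measurable]: "u \<in> borel_measurable borel"
  by (rule has_gaussian_tails_measurable[OF tails])

lemma has_real_derivative_exponential_moment:
  "((\<lambda>h. \<integral>y. y ^ k * exp (h * y - u y) \<partial>lborel) has_real_derivative
     (\<integral>y. y ^ Suc k * exp (h * y - u y) \<partial>lborel)) (at h)"
proof (rule has_real_derivative_integral(1)[where \<delta>=1 and W="\<lambda>y. \<bar>y\<bar> ^ Suc k * exp \<bar>y\<bar> * exp (h * y - u y)"])
  show "integrable lborel (\<lambda>y. y ^ k * exp (t * y - u y))" for t
    by (rule has_gaussian_tails_integrable_power[OF tails])
  show "((\<lambda>t. y ^ k * exp (t * y - u y)) has_real_derivative y ^ Suc k * exp (t * y - u y)) (at t)" for t y
    by (auto intro!: derivative_eq_intros)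
  show "\<bar>y ^ Suc k * exp (t * y - u y)\<bar> \<le> \<bar>y\<bar> ^ Suc k * exp \<bar>y\<bar> * exp (h * y - u y)"
    if "\<bar>t - h\<bar> < 1" for t y
  proof -
    have "(t - h) * y \<le> \<bar>t - h\<bar> * \<bar>y\<bar>" by (metis abs_ge_self abs_mult)
    also have "\<dots> \<le> 1 * \<bar>y\<bar>" using that by (intro mult_right_mono) auto
    finally have "t * y - u y \<le> \<bar>y\<bar> + (h * y - u y)" by (simp add: algebra_simps)
    then have "exp (t * y - u y) \<le> exp \<bar>y\<bar> * exp (h * y - u y)" by (simp flip: exp_add)
    then have "\<bar>y\<bar> ^ Suc k * exp (t * y - u y) \<le> \<bar>y\<bar> ^ Suc k * (exp \<bar>y\<bar> * exp (h * y - u y))"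
      by (rule mult_left_mono) simp
    then show ?thesis by (simp add: abs_mult power_abs mult.assoc)
  qed
  show "integrable lborel (\<lambda>y. \<bar>y\<bar> ^ Suc k * exp \<bar>y\<bar> * exp (h * y - u y))"
  proof (rule has_gaussian_tails_integrable_bound[OF tails, of _ 1 "real (Suc k) + 1" h])
    fix y
    have "\<bar>y\<bar> ^ Suc k * exp \<bar>y\<bar> \<le> exp (real (Suc k) * \<bar>y\<bar>) * exp \<bar>y\<bar>"
      by (rule mult_right_mono[OF abs_power_le_exp]) simp
    also have "\<dots> = exp ((real (Suc k) + 1) * \<bar>y\<bar>)"
      by (simp add: algebra_simps flip: exp_add)
    finally have "\<bar>y\<bar> ^ Suc k * exp \<bar>y\<bar> * exp (h * y - u y) \<le> exp ((real (Suc k) + 1) * \<bar>y\<bar>) * exp (h * y - u y)"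
      by (rule mult_right_mono) simp
    then show "\<bar>\<bar>y\<bar> ^ Suc k * exp \<bar>y\<bar> * exp (h * y - u y)\<bar> \<le> 1 * exp ((real (Suc k) + 1) * \<bar>y\<bar>) * exp (h * y - u y)"
      by (simp only: abs_mult abs_exp_cancel power_abs abs_abs mult_1_left abs_idempotent)
    show "(\<lambda>y. \<bar>y\<bar> ^ Suc k * exp \<bar>y\<bar> * exp (h * y - u y)) \<in> borel_measurable borel"
      by measurable
  qed simp
qed simp

lemma site_partition_pos': "site_partition h > 0"
  unfolding site_partition_def by (rule site_partition_pos[OF tails])

lemma site_mean_eq: "site_mean h = (\<integral>y. y * exp (h * y - u y) \<partial>lborel) / site_partition h"
  unfolding site_mean_def site_partition_def by (rule integral_site_measure(1)[OF tails]) simp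

lemma has_real_derivative_site_partition:
  "(site_partition has_real_derivative site_mean h * site_partition h) (at h)"
proof -
  have "site_mean h * site_partition h = (\<integral>y. y ^ Suc 0 * exp (h * y - u y) \<partial>lborel)"
    using site_partition_pos'[of h] by (simp add: site_mean_eq)
  then show ?thesis
    using has_real_derivative_exponential_moment[of 0 h] by (simp add: site_partition_def[abs_def])
qed

lemma integrable_site_power: "integrable (site_measure u h) (\<lambda>y. y ^ k)"
  by (subst integral_site_measure(2)[OF tails]) (auto intro: has_gaussian_tails_integrable_power[OF tails])

text \<open>
  The variance is the second derivative of the logarithm of the partition function.
\<close>

lemma has_real_derivative_site_mean:
  "(site_mean has_real_derivative Var (site_measure u h) (\<lambda>y. y)) (at h)"
proof -
  interpret prob_space "site_measure u h" by (rule prob_space_site_measure[OF tails])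
  let ?Z = "site_partition"
  let ?Z1 = "\<lambda>h. \<integral>y. y ^ 1 * exp (h * y - u y) \<partial>lborel"
  let ?Z2 = "\<lambda>h. \<integral>y. y ^ 2 * exp (h * y - u y) \<partial>lborel"
  have "((\<lambda>h. ?Z1 h / ?Z h) has_real_derivative
      (?Z2 h * ?Z h - ?Z1 h * (site_mean h * ?Z h)) / (?Z h * ?Z h)) (at h)"
    using has_real_derivative_exponential_moment[of 1 h] site_partition_pos'[of h]
    by (intro DERIV_divide has_real_derivative_site_partition) (auto simp: numeral_2_eq_2)
  moreover have "(\<lambda>h. ?Z1 h / ?Z h) = site_mean" by (simp add: fun_eq_iff site_mean_eq)
  moreover have "(?Z2 h * ?Z h - ?Z1 h * (site_mean h * ?Z h)) / (?Z h * ?Z h) = ?Z2 h / ?Z h - (site_mean h)\<^sup>2"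
  proof -
    have "?Z1 h = site_mean h * ?Z h" using site_partition_pos'[of h] by (simp add: site_mean_eq)
    then show ?thesis
      using site_partition_pos'[of h] by (simp only:) (simp add: diff_divide_distrib power2_eq_square)
  qed
  moreover have "?Z2 h / ?Z h = (\<integral>y. y\<^sup>2 \<partial>site_measure u h)"
    unfolding site_partition_def by (rule integral_site_measure(1)[OF tails, symmetric]) simp
  moreover have "Var (site_measure u h) (\<lambda>y. y) = (\<integral>y. y\<^sup>2 \<partial>site_measure u h) - (site_mean h)\<^sup>2"
    unfolding Var_def site_mean_def using integrable_site_power[of h 1] integrable_site_power[of h 2]
    by (intro variance_eq) auto
  ultimately show ?thesis by simp
qed

text \<open>
  The logarithm of the partition function has second derivative at most \<open>1 / \<sigma>\<close> everywhere.
\<close>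

lemma log_site_partition_le:
  "ln (site_partition (h + t)) \<le> ln (site_partition h) + site_mean h * t + t\<^sup>2 / (2 * \<sigma>)"
proof -
  define F where "F s = s\<^sup>2 / (2 * \<sigma>) - ln (site_partition s)" for s
  have F': "(F has_real_derivative s / \<sigma> - site_mean s) (at s)" for s
    unfolding F_def using site_partition_pos'[of s] \<sigma>_pos
    by (auto intro!: derivative_eq_intros has_real_derivative_site_partition)
  have F'': "((\<lambda>s. s / \<sigma> - site_mean s) has_real_derivative
     1 / \<sigma> - Var (site_measure u s) (\<lambda>y. y)) (at s)" for s
    using \<sigma>_pos by (auto intro!: derivative_eq_intros has_real_derivative_site_mean)
  have "(h / \<sigma> - site_mean h) * ((h + t) - h) \<le> F (h + t) - F h"
    by (rule f''_imp_f'[of UNIV F _ _ h "h + t", OF _ F' F'']) (use variance_le in auto)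
  moreover have "(h + t)\<^sup>2 / (2 * \<sigma>) - h\<^sup>2 / (2 * \<sigma>) = h / \<sigma> * t + t\<^sup>2 / (2 * \<sigma>)"
    using \<sigma>_pos by (simp add: power2_eq_square field_simps)
  ultimately show ?thesis
    unfolding F_def by (simp add: algebra_simps)
qed

lemma site_exponential_moment:
  "integrable (site_measure u h) (\<lambda>y. exp (t * y))"
  "(\<integral>y. exp (t * y) \<partial>site_measure u h) \<le> exp (t * site_mean h + t\<^sup>2 / (2 * \<sigma>))"
proof -
  have eq: "exp (t * y) * exp (h * y - u y) = exp ((h + t) * y - u y)" for y
    by (simp add: algebra_simps flip: exp_add)
  show "integrable (site_measure u h) (\<lambda>y. exp (t * y))"
    by (subst integral_site_measure(2)[OF tails]) (simp_all add: eq has_gaussian_tails_integrable[OF tails])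
  have "(\<integral>y. exp (t * y) \<partial>site_measure u h) = site_partition (h + t) / site_partition h"
    by (subst integral_site_measure(1)[OF tails]) (simp_all add: eq site_partition_def)
  also have "\<dots> = exp (ln (site_partition (h + t)) - ln (site_partition h))"
    using site_partition_pos' by (simp add: exp_diff)
  also have "\<dots> \<le> exp (t * site_mean h + t\<^sup>2 / (2 * \<sigma>))"
    using log_site_partition_le[of h t] by (simp add: mult.commute)
  finally show "(\<integral>y. exp (t * y) \<partial>site_measure u h) \<le> exp (t * site_mean h + t\<^sup>2 / (2 * \<sigma>))" .
qed

text \<open>
  By the entropy inequality and the Gaussian bound on exponential moments, \<open>t\<close> times the covariance is at most
  \<open>G t\<^sup>2 / (2 \<sigma>) + Ent g\<close>, where \<open>G\<close> is the mean of \<open>g\<close>. The logarithmic Sobolev inequality bounds the entropy, and \<open>t\<close> is then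
  optimised. The Poincare inequality would not do: the bound must involve \<open>sqrt (\<integral> g)\<close> rather than the variance
  of \<open>g\<close> to be compatible with entropies.
\<close>

lemma site_covariance_le:
  fixes g g' :: "real \<Rightarrow> real" and h :: real
  assumes g: "\<And>x. (g has_real_derivative g' x) (at x)" "\<And>x. \<epsilon> \<le> g x" "\<And>x. g x \<le> M" "\<epsilon> > 0"
    and g': "\<And>x. \<bar>g' x\<bar> \<le> B"
  defines \<mu>_def: "\<mu> \<equiv> site_measure u h"
  shows "\<bar>(\<integral>y. g y * y \<partial>\<mu>) - (\<integral>y. g y \<partial>\<mu>) * site_mean h\<bar>
    \<le> 1 / \<sigma> * sqrt (\<integral>y. g y \<partial>\<mu>) * sqrt (\<integral>y. (g' y)\<^sup>2 / g y \<partial>\<mu>)"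
proof -
  interpret prob_space \<mu> unfolding \<mu>_def by (rule prob_space_site_measure[OF tails])
  have "continuous_on UNIV g"
    using g by (meson DERIV_continuous_on has_field_derivative_at_within)
  then have mg[measurable]: "g \<in> borel_measurable borel"
    by (rule borel_measurable_continuous_onI)
  have [measurable]: "g' \<in> borel_measurable borel"
    using borel_measurable_derivative[OF g(1)] .
  have g0: "g x > 0" for x using g(2)[of x] g(4) by linarith
  have gb: "\<bar>g x\<bar> \<le> M" for x using g0[of x] g(3)[of x] by auto
  have lb: "\<bar>g x * ln (g x)\<bar> \<le> M * (\<bar>ln \<epsilon>\<bar> + \<bar>ln M\<bar>)" for x
    by (rule abs_mult_ln_le[OF g(4) g(2) g(3)])
  have ig: "integrable \<mu> g" unfolding \<mu>_def by (rule integrable_bounded_site_measure[OF tails mg gb])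
  have il: "integrable \<mu> (\<lambda>y. g y * ln (g y))"
    unfolding \<mu>_def by (rule integrable_bounded_site_measure[OF tails _ lb]) measurable
  have igy: "integrable \<mu> (\<lambda>y. g y * y)"
  proof (rule Bochner_Integration.integrable_bound)
    show "integrable \<mu> (\<lambda>y. M * y)"
      using integrable_site_power[of h 1] by (simp add: \<mu>_def)
    show "(\<lambda>y. g y * y) \<in> borel_measurable \<mu>" unfolding \<mu>_def by measurable
    show "AE y in \<mu>. norm (g y * y) \<le> norm (M * y)"
      using gb by (auto intro!: AE_I2 simp: abs_mult mult_right_mono order_trans[OF _ abs_ge_self])
  qed
  define G where "G = (\<integral>y. g y \<partial>\<mu>)"
  define I where "I = (\<integral>y. (g' y)\<^sup>2 / g y \<partial>\<mu>)"
  define C where "C = (\<integral>y. g y * y \<partial>\<mu>) - G * site_mean h"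
  have "G \<ge> (\<integral>y. \<epsilon> \<partial>\<mu>)" unfolding G_def using g(2) by (intro integral_mono ig) auto
  then have G: "G > 0" using g(4) by (simp add: prob_space)
  have key: "t * C \<le> G * t\<^sup>2 / (2 * \<sigma>) + I / (2 * \<sigma>)" for t
  proof -
    \<comment> \<open>\<open>exp l\<close> is chosen so that the exponential moment below integrates to at most \<open>G\<close>.\<close>
    define l where "l = t * site_mean h + t\<^sup>2 / (2 * \<sigma>) - ln G"
    have "(\<integral>y. t * (g y * y) - l * g y \<partial>\<mu>)
        \<le> (\<integral>y. g y * ln (g y) - g y + exp (- l) * exp (t * y) \<partial>\<mu>)"
    proof (rule integral_mono)
      show "t * (g y * y) - l * g y \<le> g y * ln (g y) - g y + exp (- l) * exp (t * y)" for y
      proof -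
        \<comment> \<open>Duality between \<open>s ln s - s\<close> and the exponential function.\<close>
        have "1 + (t * y - l - ln (g y)) \<le> exp (t * y - l - ln (g y))" by (rule exp_ge_add_one_self)
        also have "\<dots> = exp (- l) * exp (t * y) / g y"
          using g0[of y] by (simp add: exp_diff exp_minus divide_inverse mult_ac)
        finally have "g y * (1 + (t * y - l - ln (g y))) \<le> g y * (exp (- l) * exp (t * y) / g y)"
          using g0[of y] by (intro mult_left_mono) auto
        then show ?thesis using g0[of y] by (simp add: algebra_simps)
      qed
    qed (use igy ig il site_exponential_moment(1)[of h t, folded \<mu>_def] in auto)
    also have "\<dots> = (\<integral>y. g y * ln (g y) \<partial>\<mu>) - G + exp (- l) * (\<integral>y. exp (t * y) \<partial>\<mu>)"
      unfolding G_def using ig il site_exponential_moment(1)[of h t, folded \<mu>_def] by simp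
    also have "\<dots> \<le> (\<integral>y. g y * ln (g y) \<partial>\<mu>) - G + exp (- l) * exp (t * site_mean h + t\<^sup>2 / (2 * \<sigma>))"
      unfolding \<mu>_def by (intro add_left_mono mult_left_mono site_exponential_moment(2)) auto
    also have "exp (- l) * exp (t * site_mean h + t\<^sup>2 / (2 * \<sigma>)) = exp (ln G)"
      by (simp add: l_def flip: exp_add)
    also have "exp (ln G) = G" using G by simp
    finally have "t * (\<integral>y. g y * y \<partial>\<mu>) - l * G \<le> (\<integral>y. g y * ln (g y) \<partial>\<mu>)"
      using igy ig by (simp add: G_def)
    then have "t * C - G * t\<^sup>2 / (2 * \<sigma>) \<le> (\<integral>y. g y * ln (g y) \<partial>\<mu>) - G * ln G"
      by (simp add: C_def l_def algebra_simps)
    also have "\<dots> = Ent (site_measure u h) g" by (simp add: Ent_def G_def \<mu>_def)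
    also have "\<dots> \<le> I / (2 * \<sigma>)"
      using log_sobolev[OF g g', of h] by (simp add: I_def \<mu>_def)
    finally show ?thesis by simp
  qed
  have "\<sigma> * C\<^sup>2 / G \<le> (\<sigma> * C\<^sup>2 / G) / 2 + I / (2 * \<sigma>)"
    using key[of "\<sigma> * C / G"] G \<sigma>_pos by (simp add: power2_eq_square field_simps)
  then have "C\<^sup>2 \<le> (1 / \<sigma>)\<^sup>2 * (G * I)"
    using G \<sigma>_pos by (simp add: power2_eq_square field_simps)
  then have "\<bar>C\<bar> \<le> sqrt ((1 / \<sigma>)\<^sup>2 * (G * I))"
    using real_le_rsqrt[of "\<bar>C\<bar>"] by simp
  then show ?thesis
    using \<sigma>_pos by (simp add: real_sqrt_mult real_sqrt_divide C_def G_def I_def)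
qed

text \<open>
  The field and the integrand both depend on the parameter; the dependence of the field contributes a
  covariance with the spin.
\<close>

lemma has_real_derivative_site_integral:
  fixes G D :: "real \<Rightarrow> real \<Rightarrow> real" and a k t0 :: real
  assumes G: "\<And>t. G t \<in> borel_measurable borel" "\<And>t y. \<bar>G t y\<bar> \<le> M"
    and D: "\<And>t. D t \<in> borel_measurable borel" "\<And>t y. ((\<lambda>t. G t y) has_real_derivative D t y) (at t)"
    "\<And>t y. \<bar>D t y\<bar> \<le> B"
  defines \<mu>_def: "\<mu> \<equiv> site_measure u (a + k * t0)"
  shows "((\<lambda>t. \<integral>y. G t y \<partial>site_measure u (a + k * t)) has_real_derivative
     (\<integral>y. D t0 y \<partial>\<mu>) + k * ((\<integral>y. G t0 y * y \<partial>\<mu>) - (\<integral>y. G t0 y \<partial>\<mu>) * site_mean (a + k * t0))) (at t0)"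
proof -
  have [measurable]: "G t \<in> borel_measurable borel" "D t \<in> borel_measurable borel" for t using G D by auto
  have "M \<ge> 0" using G(2)[of 0 0] by linarith
  have "B \<ge> 0" using D(3)[of 0 0] by linarith
  define h0 where "h0 = a + k * t0"
  define W where "W y = (B + M * \<bar>k\<bar> * \<bar>y\<bar>) * exp (\<bar>k\<bar> * \<bar>y\<bar>) * exp (h0 * y - u y)" for y
  let ?N = "\<lambda>t. \<integral>y. G t y * exp ((a + k * t) * y - u y) \<partial>lborel"
  let ?D = "\<lambda>t y. D t y * exp ((a + k * t) * y - u y) + G t y * (k * y) * exp ((a + k * t) * y - u y)"
  have iG: "integrable lborel (\<lambda>y. g y * exp (h * y - u y))"
    if [measurable]: "g \<in> borel_measurable borel" and "\<And>y. \<bar>g y\<bar> \<le> C" for g :: "real \<Rightarrow> real" and h C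
    using integrable_bounded_site_measure[OF tails that] integral_site_measure(2)[OF tails that(1)] by blast
  have iGy: "integrable lborel (\<lambda>y. G t y * y * exp (h * y - u y))" for t h
  proof (rule Bochner_Integration.integrable_bound)
    show "integrable lborel (\<lambda>y. M * (y ^ 1 * exp (h * y - u y)))"
      by (intro integrable_mult_right has_gaussian_tails_integrable_power[OF tails])
    show "AE y in lborel. norm (G t y * y * exp (h * y - u y)) \<le> norm (M * (y ^ 1 * exp (h * y - u y)))"
      using G(2) \<open>M \<ge> 0\<close> by (auto intro!: AE_I2 mult_right_mono simp: abs_mult mult.assoc)
  qed measurable
  have N': "(?N has_real_derivative (\<integral>y. ?D t0 y \<partial>lborel)) (at t0)"
  proof (rule has_real_derivative_integral(1)[where \<delta>=1 and W=W])
    show "integrable lborel (\<lambda>y. G t y * exp ((a + k * t) * y - u y))" for t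
      by (rule iG) (use G in auto)
    show "((\<lambda>t. G t y * exp ((a + k * t) * y - u y)) has_real_derivative ?D t y) (at t)" for t y
      by (auto intro!: derivative_eq_intros D(2) simp: algebra_simps)
    show "\<bar>?D t y\<bar> \<le> W y" if "\<bar>t - t0\<bar> < 1" for t y
    proof -
      have "(k * (t - t0)) * y \<le> \<bar>k * (t - t0)\<bar> * \<bar>y\<bar>" by (metis abs_ge_self abs_mult)
      also have "\<dots> \<le> (\<bar>k\<bar> * 1) * \<bar>y\<bar>"
        unfolding abs_mult using that by (intro mult_right_mono mult_left_mono) auto
      finally have "(a + k * t) * y - u y \<le> \<bar>k\<bar> * \<bar>y\<bar> + (h0 * y - u y)" by (simp add: h0_def algebra_simps)
      then have e: "exp ((a + k * t) * y - u y) \<le> exp (\<bar>k\<bar> * \<bar>y\<bar>) * exp (h0 * y - u y)" by (simp flip: exp_add)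
      have "\<bar>G t y * (k * y)\<bar> \<le> M * \<bar>k\<bar> * \<bar>y\<bar>"
        using mult_right_mono[OF G(2)[of t y], of "\<bar>k * y\<bar>"] by (simp add: abs_mult mult.assoc)
      then have "\<bar>D t y + G t y * (k * y)\<bar> \<le> B + M * \<bar>k\<bar> * \<bar>y\<bar>" using D(3)[of t y] by linarith
      then have "\<bar>D t y + G t y * (k * y)\<bar> * exp ((a + k * t) * y - u y)
          \<le> (B + M * \<bar>k\<bar> * \<bar>y\<bar>) * (exp (\<bar>k\<bar> * \<bar>y\<bar>) * exp (h0 * y - u y))"
        using e \<open>M \<ge> 0\<close> \<open>B \<ge> 0\<close> by (intro mult_mono) auto
      moreover have "?D t y = (D t y + G t y * (k * y)) * exp ((a + k * t) * y - u y)"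
        by (simp add: algebra_simps)
      ultimately show ?thesis by (simp add: W_def abs_mult mult.assoc)
    qed
    show "integrable lborel W"
    proof (rule has_gaussian_tails_integrable_bound[OF tails, of _ "B + M * \<bar>k\<bar>" "1 + \<bar>k\<bar>" h0])
      show "W \<in> borel_measurable borel" unfolding W_def by measurable
      show "\<bar>W y\<bar> \<le> (B + M * \<bar>k\<bar>) * exp ((1 + \<bar>k\<bar>) * \<bar>y\<bar>) * exp (h0 * y - u y)" for y
      proof -
        have "B * 1 + (M * \<bar>k\<bar>) * \<bar>y\<bar> \<le> B * exp \<bar>y\<bar> + (M * \<bar>k\<bar>) * exp \<bar>y\<bar>"
          using \<open>M \<ge> 0\<close> \<open>B \<ge> 0\<close> abs_power_le_exp[of y 1]
          by (intro add_mono mult_left_mono) auto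
        then have "(B + M * \<bar>k\<bar> * \<bar>y\<bar>) * exp (\<bar>k\<bar> * \<bar>y\<bar>) \<le> ((B + M * \<bar>k\<bar>) * exp \<bar>y\<bar>) * exp (\<bar>k\<bar> * \<bar>y\<bar>)"
          by (intro mult_right_mono) (auto simp: algebra_simps)
        also have "\<dots> = (B + M * \<bar>k\<bar>) * exp ((1 + \<bar>k\<bar>) * \<bar>y\<bar>)"
          by (simp add: distrib_right exp_add)
        finally have "W y \<le> (B + M * \<bar>k\<bar>) * exp ((1 + \<bar>k\<bar>) * \<bar>y\<bar>) * exp (h0 * y - u y)"
          unfolding W_def by (rule mult_right_mono) simp
        moreover have "W y \<ge> 0" unfolding W_def using \<open>M \<ge> 0\<close> \<open>B \<ge> 0\<close> by simp
        ultimately show ?thesis by simp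
      qed
      show "0 \<le> B + M * \<bar>k\<bar>" using \<open>M \<ge> 0\<close> \<open>B \<ge> 0\<close> by simp
    qed
  qed simp
  have Z': "((\<lambda>t. site_partition (a + k * t)) has_real_derivative site_mean h0 * site_partition h0 * k) (at t0)"
    unfolding h0_def
    by (rule DERIV_chain2[OF has_real_derivative_site_partition]) (auto intro!: derivative_eq_intros)
  have Z: "site_partition h0 > 0" by (rule site_partition_pos')
  have eqI: "(\<integral>y. g y \<partial>site_measure u h) = (\<integral>y. g y * exp (h * y - u y) \<partial>lborel) / site_partition h"
    if "g \<in> borel_measurable borel" for g h
    unfolding site_partition_def by (rule integral_site_measure(1)[OF tails that])
  have quot: "((\<lambda>t. ?N t / site_partition (a + k * t)) has_real_derivative
     ((\<integral>y. ?D t0 y \<partial>lborel) * site_partition h0 - ?N t0 * (site_mean h0 * site_partition h0 * k)) / (site_partition h0 * site_partition h0)) (at t0)"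
    unfolding h0_def by (rule DERIV_divide[OF N' Z'[unfolded h0_def]]) (use Z h0_def in auto)
  have "(\<integral>y. ?D t0 y \<partial>lborel) = (\<integral>y. D t0 y * exp (h0 * y - u y) \<partial>lborel) + k * (\<integral>y. G t0 y * y * exp (h0 * y - u y) \<partial>lborel)"
  proof -
    have "?D t0 y = D t0 y * exp (h0 * y - u y) + k * (G t0 y * y * exp (h0 * y - u y))" for y
      by (simp add: h0_def algebra_simps)
    then have "(\<integral>y. ?D t0 y \<partial>lborel) = (\<integral>y. D t0 y * exp (h0 * y - u y) + k * (G t0 y * y * exp (h0 * y - u y)) \<partial>lborel)"
      by simp
    also have "\<dots> = (\<integral>y. D t0 y * exp (h0 * y - u y) \<partial>lborel) + (\<integral>y. k * (G t0 y * y * exp (h0 * y - u y)) \<partial>lborel)"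
      by (intro Bochner_Integration.integral_add integrable_mult_right iGy iG[OF D(1) D(3)])
    finally show ?thesis by simp
  qed
  also have "\<dots> = ((\<integral>y. D t0 y \<partial>site_measure u h0) + k * (\<integral>y. G t0 y * y \<partial>site_measure u h0)) * site_partition h0"
    using Z by (simp add: eqI distrib_right)
  finally have DI: "(\<integral>y. ?D t0 y \<partial>lborel) = ((\<integral>y. D t0 y \<partial>site_measure u h0) + k * (\<integral>y. G t0 y * y \<partial>site_measure u h0)) * site_partition h0" .
  have NI: "?N t0 = (\<integral>y. G t0 y \<partial>site_measure u h0) * site_partition h0"
    using Z by (simp add: eqI h0_def)
  have alg: "((A + k * C) * z * z - E * z * (m * z * k)) / (z * z) = A + k * (C - E * m)" if "z > 0" for A C E m z :: real
    using that by (simp add: field_simps)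
  have fin: "((\<integral>y. ?D t0 y \<partial>lborel) * site_partition h0 - ?N t0 * (site_mean h0 * site_partition h0 * k)) / (site_partition h0 * site_partition h0)
      = (\<integral>y. D t0 y \<partial>site_measure u h0) + k * ((\<integral>y. G t0 y * y \<partial>site_measure u h0) - (\<integral>y. G t0 y \<partial>site_measure u h0) * site_mean h0)"
    unfolding DI NI by (rule alg[OF Z])
  have "(\<lambda>t. ?N t / site_partition (a + k * t)) = (\<lambda>t. \<integral>y. G t y \<partial>site_measure u (a + k * t))"
    using G(1) by (simp add: eqI fun_eq_iff)
  then show ?thesis
    using quot unfolding fin by (simp add: \<mu>_def h0_def)
qed

end

section \<open>The quartic single-site potential\<close>

text \<open>
  The positive part itself is not differentiable at \<open>0\<close>, but its square is.
\<close>

lemma has_real_derivative_pos_part_square: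
  "((\<lambda>s::real. (max 0 s)\<^sup>2) has_real_derivative 2 * max 0 s) (at s)"
proof (cases s "0::real" rule: linorder_cases)
  case less
  have "((\<lambda>s::real. 0) has_real_derivative 2 * max 0 s) (at s)" using less by simp
  then show ?thesis
    by (rule has_field_derivative_transform_within_open[where S="{..<0}"]) (use less in auto)
next
  case greater
  have "((\<lambda>s::real. s\<^sup>2) has_real_derivative 2 * max 0 s) (at s)"
    using greater by (auto intro!: derivative_eq_intros)
  then show ?thesis
    by (rule has_field_derivative_transform_within_open[where S="{0<..}"]) (use greater in auto)
next
  case equal
  have "((\<lambda>h::real. (max 0 h)\<^sup>2 / h) \<longlongrightarrow> 0) (at 0)"
  proof (rule Lim_null_comparison)
    show "((\<lambda>h::real. \<bar>h\<bar>) \<longlongrightarrow> 0) (at 0)" by (rule tendsto_rabs_zero) (rule tendsto_ident_at)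
    show "\<forall>\<^sub>F h in at (0::real). norm ((max 0 h)\<^sup>2 / h) \<le> \<bar>h\<bar>"
      by (rule always_eventually) (auto simp: max_def power2_eq_square)
  qed
  then show ?thesis using equal by (simp add: DERIV_def)
qed

lemma has_gaussian_tails_quartic: "has_gaussian_tails (single_site_potential \<beta>)"
  unfolding has_gaussian_tails_def
proof (intro conjI allI)
  show "continuous_on UNIV (single_site_potential \<beta>)"
    unfolding single_site_potential_def by (intro continuous_intros)
  fix c h :: real
  define C where "C = h\<^sup>2 / 2 + (c + \<beta> + 1)\<^sup>2 / 4"
  show "integrable lborel (\<lambda>y. exp (c * y\<^sup>2 + h * y - single_site_potential \<beta> y))"
  proof (rule Bochner_Integration.integrable_bound)
    show "integrable lborel (\<lambda>y. (exp C * sqrt (2 * pi)) * std_normal_density y)" 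
      using integrable_std_normal_moment[of 0] by simp
    have "c * y\<^sup>2 + h * y - single_site_potential \<beta> y \<le> C + - y\<^sup>2 / 2" for y
    proof -
      have "0 \<le> (h - y)\<^sup>2 / 2" "0 \<le> (y\<^sup>2 - (c + \<beta> + 1) / 2)\<^sup>2" by simp_all
      moreover have "(h - y)\<^sup>2 / 2 = h\<^sup>2 / 2 + y\<^sup>2 / 2 - h * y" by (simp add: power2_eq_square field_simps)
      moreover have "(y\<^sup>2 - (c + \<beta> + 1) / 2)\<^sup>2 = y ^ 4 - (c + \<beta> + 1) * y\<^sup>2 + (c + \<beta> + 1)\<^sup>2 / 4"
        by (simp add: power2_eq_square power4_eq_xxxx field_simps)
      moreover have "(c + \<beta> + 1) * y\<^sup>2 = c * y\<^sup>2 + \<beta> * y\<^sup>2 + y\<^sup>2" by (simp add: algebra_simps)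
      ultimately show ?thesis unfolding C_def single_site_potential_def by linarith
    qed
    then have "exp (c * y\<^sup>2 + h * y - single_site_potential \<beta> y) \<le> exp C * exp (- y\<^sup>2 / 2)" for y
      by (simp flip: exp_add)
    then show "AE y in lborel. norm (exp (c * y\<^sup>2 + h * y - single_site_potential \<beta> y))
        \<le> norm ((exp C * sqrt (2 * pi)) * std_normal_density y)"
      by (intro AE_I2) (simp add: std_normal_density_def)
    show "(\<lambda>y. exp (c * y\<^sup>2 + h * y - single_site_potential \<beta> y)) \<in> borel_measurable lborel"
      unfolding single_site_potential_def by measurable
  qed
qed

text \<open>
  The right-hand side is the form in which the constant is usually written, the left-hand side the form \<open>K e\<^sup>-\<^sup>\<delta>\<close> in
  which the perturbation argument produces it.
\<close>

lemma quartic_constant: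
  fixes \<beta> :: real
  shows "(sqrt (\<beta>\<^sup>2 + 8) - \<beta>) * exp (- ((sqrt (\<beta>\<^sup>2 + 8) + \<beta>) / 4)\<^sup>2)
    = (sqrt (\<beta>\<^sup>2 + 8) - \<beta>) / sqrt (exp 1) * exp (- (1 / 8) * \<beta> * (\<beta> + sqrt (\<beta>\<^sup>2 + 8)))"
proof -
  let ?s = "sqrt (\<beta>\<^sup>2 + 8)"
  have "?s\<^sup>2 = \<beta>\<^sup>2 + 8" by simp
  then have "- ((?s + \<beta>) / 4)\<^sup>2 = - (1 / 2) + - (1 / 8) * \<beta> * (\<beta> + ?s)"
    by (simp add: power2_eq_square field_simps)
  moreover have "sqrt (exp 1) = exp (1 / 2 :: real)"
    by (rule real_sqrt_unique) (simp_all flip: exp_of_nat_mult)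
  moreover have "k * exp (- (1 / 2) + b) = k / exp (1 / 2) * exp b" for k b :: real
    unfolding exp_add exp_minus divide_inverse by (rule mult.assoc[symmetric])
  ultimately show ?thesis by (simp only:)
qed

text \<open>
  Inside \<open>[- sqrt \<rho>, sqrt \<rho>]\<close> the potential is replaced by the parabola with second derivative \<open>K\<close> that matches its
  slope at the end points, which means \<open>4 \<rho> = K + 2 \<beta>\<close>. The oscillation of the difference is \<open>\<rho>\<^sup>2\<close>, and the stated
  value of \<open>K\<close> is the one that maximises \<open>K exp (- ((K + 2 \<beta>) / 4)\<^sup>2)\<close>.
\<close>

lemma single_site_quartic:
  "single_site (single_site_potential \<beta>)
     ((sqrt (\<beta>\<^sup>2 + 8) - \<beta>) / sqrt (exp 1) * exp (- (1 / 8) * \<beta> * (\<beta> + sqrt (\<beta>\<^sup>2 + 8))))"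
  unfolding quartic_constant[symmetric]
proof -
  define \<rho> where "\<rho> = (sqrt (\<beta>\<^sup>2 + 8) + \<beta>) / 4"
  define K where "K = sqrt (\<beta>\<^sup>2 + 8) - \<beta>"
  let ?u = "single_site_potential \<beta>"
  have "\<bar>\<beta>\<bar> < sqrt (\<beta>\<^sup>2 + 8)"
    by (rule real_less_rsqrt) simp
  then have "\<beta> < sqrt (\<beta>\<^sup>2 + 8)" "0 < sqrt (\<beta>\<^sup>2 + 8) + \<beta>" by linarith+
  then have K: "K > 0" and \<rho>: "\<rho> > 0" unfolding K_def \<rho>_def by simp_all
  have \<beta>: "\<beta> = 2 * \<rho> - K / 2" unfolding K_def \<rho>_def by (simp add: field_simps)
  define w where "w y = (max 0 (\<rho> - y\<^sup>2))\<^sup>2" for y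
  define v where "v y = K / 2 * y\<^sup>2 + (max 0 (y\<^sup>2 - \<rho>))\<^sup>2 - \<rho>\<^sup>2" for y
  define v' where "v' y = K * y + 4 * y * max 0 (y\<^sup>2 - \<rho>)" for y
  have uvw: "?u y = v y + w y" for y
  proof -
    have "(max 0 (y\<^sup>2 - \<rho>))\<^sup>2 + (max 0 (\<rho> - y\<^sup>2))\<^sup>2 = (y\<^sup>2 - \<rho>)\<^sup>2"
      by (cases "y\<^sup>2 \<le> \<rho>") (simp_all add: power2_commute)
    then have "v y + w y = K / 2 * y\<^sup>2 + (y\<^sup>2 - \<rho>)\<^sup>2 - \<rho>\<^sup>2" unfolding v_def w_def by simp
    also have "\<dots> = ?u y" 
      unfolding single_site_potential_def \<beta>
      by (simp add: power2_eq_square power4_eq_xxxx field_simps)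
    finally show ?thesis ..
  qed
  have w: "0 \<le> w y" "w y \<le> \<rho>\<^sup>2" for y
    unfolding w_def using \<rho> by (auto intro!: power_mono)
  have v: "(v has_real_derivative v' x) (at x)" for x
  proof -
    have "((\<lambda>x. x\<^sup>2 - \<rho>) has_real_derivative 2 * x) (at x)"
      by (auto intro!: derivative_eq_intros)
    note chain = DERIV_chain2[OF has_real_derivative_pos_part_square this]
    have "(v has_real_derivative K / 2 * (2 * x) + 2 * max 0 (x\<^sup>2 - \<rho>) * (2 * x) - 0) (at x)"
      unfolding v_def
      by (intro DERIV_diff DERIV_add chain DERIV_const DERIV_cmult) (auto intro!: derivative_eq_intros)
    then show ?thesis unfolding v'_def by (simp add: mult_ac)
  qed
  have conv: "v y \<ge> v x + v' x * (y - x) + K / 2 * (y - x)\<^sup>2" for x y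
  proof -
    \<comment> \<open>\<open>s \<mapsto> (max 0 (s - \<rho>))\<^sup>2\<close> is convex and increasing, and \<open>y\<^sup>2\<close> lies above its tangents.\<close>
    let ?a = "max 0 (x\<^sup>2 - \<rho>)" and ?b = "max 0 (y\<^sup>2 - \<rho>)"
    have "?b\<^sup>2 \<ge> ?a\<^sup>2 + 2 * ?a * (?b - ?a)"
      using zero_le_power2[of "?b - ?a"] by (simp add: power2_eq_square algebra_simps)
    moreover have "?a * (?b - ?a) \<ge> ?a * (y\<^sup>2 - x\<^sup>2)"
    proof (cases "x\<^sup>2 \<le> \<rho>")
      case False
      then have "?a = x\<^sup>2 - \<rho>" by simp
      then show ?thesis by (intro mult_left_mono) linarith+
    qed simp
    moreover have "?a * (y\<^sup>2 - x\<^sup>2) \<ge> ?a * (2 * x * (y - x))"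
      using zero_le_power2[of "y - x"]
      by (intro mult_left_mono) (simp_all add: power2_eq_square algebra_simps)
    ultimately have "?b\<^sup>2 \<ge> ?a\<^sup>2 + 4 * x * ?a * (y - x)" by (simp add: algebra_simps)
    then show ?thesis unfolding v_def v'_def by (simp add: power2_eq_square algebra_simps)
  qed
  have crit: "\<exists>c. v' c = h" for h
  proof -
    \<comment> \<open>The derivative of the convex part grows at least like \<open>K y\<close>, so it takes the value \<open>h\<close>.\<close>
    let ?a = "\<bar>h\<bar> / K"
    have "v' (- ?a) \<le> h" "h \<le> v' ?a"
    proof -
      have nn: "4 * ?a * max 0 (?a\<^sup>2 - \<rho>) \<ge> 0" using K by (intro mult_nonneg_nonneg) auto
      have "v' ?a = \<bar>h\<bar> + 4 * ?a * max 0 (?a\<^sup>2 - \<rho>)" 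
        "v' (- ?a) = - (\<bar>h\<bar> + 4 * ?a * max 0 (?a\<^sup>2 - \<rho>))"
        unfolding v'_def using K by simp_all
      moreover have "- \<bar>h\<bar> \<le> h" "h \<le> \<bar>h\<bar>" by simp_all
      ultimately show "v' (- ?a) \<le> h" "h \<le> v' ?a" using nn by simp_all
    qed
    moreover have "continuous_on {- ?a..?a} v'"
      unfolding v'_def by (intro continuous_intros)
    moreover have "- ?a \<le> ?a" using K by simp
    ultimately show ?thesis using IVT'[of v' "- ?a" h ?a] by auto
  qed
  show "single_site ?u ((sqrt (\<beta>\<^sup>2 + 8) - \<beta>) * exp (- ((sqrt (\<beta>\<^sup>2 + 8) + \<beta>) / 4)\<^sup>2))"
    unfolding K_def[symmetric] \<rho>_def[symmetric]
  proof (unfold_locales, goal_cases)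
    case 1
    show ?case by (rule has_gaussian_tails_quartic)
  next
    case 2
    show ?case using K by simp
  next
    case (3 f f' \<epsilon> M B h)
    show ?case
      by (rule site_log_sobolev_perturbation[OF K has_gaussian_tails_quartic uvw w v conv 3])
  next
    case (4 h)
    obtain c where "v' c = h" using crit by blast
    then show ?case
      by (rule site_variance_perturbation[OF K has_gaussian_tails_quartic uvw w v conv])
  qed
qed

section \<open>Gauss-Seidel relaxation\<close>

lemma quadratic_form_shift:
  fixes \<kappa> :: "'i \<Rightarrow> 'i \<Rightarrow> real"
  assumes fin: "finite \<Lambda>" and sym: "\<And>i j. \<kappa> i j = \<kappa> j i" and diag: "\<And>i. \<kappa> i i = 0" and i: "i \<in> \<Lambda>"
  shows "(\<Sum>k\<in>\<Lambda>. \<Sum>j\<in>\<Lambda>. \<kappa> k j * (y k + (if k = i then a else 0)) * (y j + (if j = i then a else 0)))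
    = (\<Sum>k\<in>\<Lambda>. \<Sum>j\<in>\<Lambda>. \<kappa> k j * y k * y j) + 2 * (a * (\<Sum>j\<in>\<Lambda>. \<kappa> i j * y j))"
proof -
  define z where "z j = y j + (if j = i then a else 0)" for j
  define S where "S = (\<Sum>j\<in>\<Lambda>. \<kappa> i j * y j)"
  have in4: "(\<Sum>j\<in>\<Lambda>. \<kappa> k j * z k * z j) = (\<Sum>j\<in>\<Lambda>. \<kappa> k j * y k * y j) + a * (\<kappa> i k * y k)
      + (if k = i then a * S else 0)" if "k \<in> \<Lambda>" for k
  proof -
    have "(\<Sum>j\<in>\<Lambda>. \<kappa> k j * z k * z j) = (\<Sum>j\<in>\<Lambda>. \<kappa> k j * y k * y j + (if j = i then a * (\<kappa> i k * y k) else 0)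
        + (if k = i then a * (\<kappa> i j * y j) else 0))"
      by (rule sum.cong) (auto simp: z_def diag sym[of k i] algebra_simps)
    also have "\<dots> = (\<Sum>j\<in>\<Lambda>. \<kappa> k j * y k * y j) + a * (\<kappa> i k * y k) + (\<Sum>j\<in>\<Lambda>. if k = i then a * (\<kappa> i j * y j) else 0)"
      using fin i by (simp add: sum.distrib)
    also have "(\<Sum>j\<in>\<Lambda>. if k = i then a * (\<kappa> i j * y j) else 0) = (if k = i then a * S else 0)"
      by (simp add: S_def sum_distrib_left)
    finally show ?thesis .
  qed
  have "(\<Sum>k\<in>\<Lambda>. \<Sum>j\<in>\<Lambda>. \<kappa> k j * z k * z j) = (\<Sum>k\<in>\<Lambda>. (\<Sum>j\<in>\<Lambda>. \<kappa> k j * y k * y j) + a * (\<kappa> i k * y k)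
      + (if k = i then a * S else 0))"
    using in4 by (rule sum.cong[OF refl])
  also have "\<dots> = (\<Sum>k\<in>\<Lambda>. \<Sum>j\<in>\<Lambda>. \<kappa> k j * y k * y j) + a * S + a * S"
    using fin i by (simp add: sum.distrib S_def sum_distrib_left)
  finally show ?thesis by (simp only: z_def S_def[symmetric] mult_2 add.assoc)
qed

locale quadratic_form =
  fixes \<Lambda> :: "'i set" and \<kappa> :: "'i \<Rightarrow> 'i \<Rightarrow> real" and c :: real
  assumes finite_sites: "finite \<Lambda>"
    and \<kappa>_sym: "\<kappa> i j = \<kappa> j i" and \<kappa>_diag: "\<kappa> i i = 0"
    and quadratic_le: "(\<Sum>i\<in>\<Lambda>. \<Sum>j\<in>\<Lambda>. \<kappa> i j * y i * y j) \<le> c * (\<Sum>i\<in>\<Lambda>. (y i)\<^sup>2)"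

text \<open>
  One Gauss-Seidel step at \<open>i\<close> for the matrix \<open>\<sigma> - \<kappa>\<close>, seen on the residual.
\<close>

definition relax :: "('i \<Rightarrow> 'i \<Rightarrow> real) \<Rightarrow> real \<Rightarrow> 'i \<Rightarrow> ('i \<Rightarrow> real) \<Rightarrow> 'i \<Rightarrow> real" where
  "relax \<kappa> \<sigma> i r j = (if j = i then 0 else r j + \<kappa> i j / \<sigma> * r i)"

fun relax_energy :: "('i \<Rightarrow> 'i \<Rightarrow> real) \<Rightarrow> real \<Rightarrow> 'i list \<Rightarrow> ('i \<Rightarrow> real) \<Rightarrow> real" where
  "relax_energy \<kappa> \<sigma> [] r = 0"
| "relax_energy \<kappa> \<sigma> (i # is) r = (r i)\<^sup>2 / \<sigma> + relax_energy \<kappa> \<sigma> is (relax \<kappa> \<sigma> i r)"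

locale coupling = quadratic_form \<Lambda> \<kappa> c
  for \<Lambda> :: "'i set" and \<kappa> :: "'i \<Rightarrow> 'i \<Rightarrow> real" and c :: real +
  fixes \<sigma> :: real
  assumes \<kappa>_nonneg: "\<kappa> i j \<ge> 0" and \<sigma>_positive: "\<sigma> > 0" and c_less: "c < \<sigma>"
begin

definition \<gamma> :: real where "\<gamma> = \<sigma> - c"

lemma \<gamma>_positive: "\<gamma> > 0"
  using c_less by (simp add: \<gamma>_def)

text \<open>
  \<open>y\<close> is the approximate solution that the iteration produces: a step at \<open>i\<close> adds \<open>r\<^sub>i / \<sigma>\<close> to \<open>y\<^sub>i\<close> and minimises the
  quadratic energy in this coordinate, which changes it by \<open>r\<^sub>i\<^sup>2 / \<sigma>\<close>.
\<close>

lemma relax_energy_eq_quadratic: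
  assumes "set is \<subseteq> \<Lambda>"
  shows "\<exists>y. relax_energy \<kappa> \<sigma> is r =
    2 * (\<Sum>i\<in>\<Lambda>. r i * y i) - \<sigma> * (\<Sum>i\<in>\<Lambda>. (y i)\<^sup>2) + (\<Sum>i\<in>\<Lambda>. \<Sum>j\<in>\<Lambda>. \<kappa> i j * y i * y j)"
  using \<open>set is \<subseteq> \<Lambda>\<close>
proof (induction "is" arbitrary: r)
  case Nil
  show ?case by (intro exI[of _ "\<lambda>_. 0"]) simp
next
  case (Cons i "is")
  let ?r = "relax \<kappa> \<sigma> i r"
  have i: "i \<in> \<Lambda>" using Cons.prems by simp
  obtain y where y: "relax_energy \<kappa> \<sigma> is ?r =
    2 * (\<Sum>i\<in>\<Lambda>. ?r i * y i) - \<sigma> * (\<Sum>i\<in>\<Lambda>. (y i)\<^sup>2) + (\<Sum>i\<in>\<Lambda>. \<Sum>j\<in>\<Lambda>. \<kappa> i j * y i * y j)"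
    using Cons.IH[of ?r] Cons.prems by auto
  \<comment> \<open>The increment of the approximate solution at \<open>i\<close>.\<close>
  define a where "a = r i / \<sigma>"
  have a: "\<sigma> * a = r i" using \<sigma>_positive by (simp add: a_def)
  define z where "z j = y j + (if j = i then a else 0)" for j
  define S where "S = (\<Sum>j\<in>\<Lambda>. \<kappa> i j * y j)"
  have "(\<Sum>j\<in>\<Lambda>. ?r j * y j) = (\<Sum>j\<in>\<Lambda>. r j * y j - (if j = i then r i * y i else 0) + a * (\<kappa> i j * y j))"
    by (rule sum.cong) (auto simp: relax_def \<kappa>_diag a_def algebra_simps)
  also have "\<dots> = (\<Sum>j\<in>\<Lambda>. r j * y j) - r i * y i + a * S"
    using finite_sites i by (simp add: sum.distrib sum_subtractf S_def sum_distrib_left)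
  finally have 1: "(\<Sum>j\<in>\<Lambda>. ?r j * y j) = (\<Sum>j\<in>\<Lambda>. r j * y j) - r i * y i + a * S" .
  have "(\<Sum>j\<in>\<Lambda>. r j * z j) = (\<Sum>j\<in>\<Lambda>. r j * y j + (if j = i then r i * a else 0))"
    by (rule sum.cong) (auto simp: z_def algebra_simps)
  then have 2: "(\<Sum>j\<in>\<Lambda>. r j * z j) = (\<Sum>j\<in>\<Lambda>. r j * y j) + r i * a"
    using finite_sites i by (simp add: sum.distrib)
  have "(\<Sum>j\<in>\<Lambda>. (z j)\<^sup>2) = (\<Sum>j\<in>\<Lambda>. (y j)\<^sup>2 + (if j = i then 2 * a * y i + a\<^sup>2 else 0))"
    by (rule sum.cong) (auto simp: z_def power2_eq_square algebra_simps)
  then have 3: "(\<Sum>j\<in>\<Lambda>. (z j)\<^sup>2) = (\<Sum>j\<in>\<Lambda>. (y j)\<^sup>2) + 2 * a * y i + a\<^sup>2"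
    using finite_sites i by (simp add: sum.distrib)
  have 4: "(\<Sum>k\<in>\<Lambda>. \<Sum>j\<in>\<Lambda>. \<kappa> k j * z k * z j) = (\<Sum>k\<in>\<Lambda>. \<Sum>j\<in>\<Lambda>. \<kappa> k j * y k * y j) + 2 * (a * S)"
    unfolding z_def S_def by (rule quadratic_form_shift[OF finite_sites \<kappa>_sym \<kappa>_diag i])
  have 5: "(r i)\<^sup>2 / \<sigma> = r i * a" by (simp add: a_def power2_eq_square)
  have 6: "\<sigma> * ((\<Sum>j\<in>\<Lambda>. (y j)\<^sup>2) + 2 * a * y i + a\<^sup>2) = \<sigma> * (\<Sum>j\<in>\<Lambda>. (y j)\<^sup>2) + 2 * (r i * y i) + r i * a"
    unfolding a[symmetric] by (simp add: power2_eq_square algebra_simps)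
  show ?case
    by (rule exI[of _ z]) (simp only: relax_energy.simps y 1 2 3 4 5 6, simp add: algebra_simps)
qed

text \<open>
  The quadratic function \<open>2 \<langle>r, y\<rangle> - \<gamma> |y|\<^sup>2\<close> is at most \<open>|r|\<^sup>2 / \<gamma>\<close>; this gives the sharp constant without inverting
  the matrix.
\<close>

lemma relax_energy_le:
  assumes "set is \<subseteq> \<Lambda>"
  shows "relax_energy \<kappa> \<sigma> is r \<le> (\<Sum>i\<in>\<Lambda>. (r i)\<^sup>2) / \<gamma>"
proof -
  obtain y where y: "relax_energy \<kappa> \<sigma> is r =
    2 * (\<Sum>i\<in>\<Lambda>. r i * y i) - \<sigma> * (\<Sum>i\<in>\<Lambda>. (y i)\<^sup>2) + (\<Sum>i\<in>\<Lambda>. \<Sum>j\<in>\<Lambda>. \<kappa> i j * y i * y j)"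
    using relax_energy_eq_quadratic[OF \<open>set is \<subseteq> \<Lambda>\<close>] by blast
  also have "\<dots> \<le> 2 * (\<Sum>i\<in>\<Lambda>. r i * y i) - \<gamma> * (\<Sum>i\<in>\<Lambda>. (y i)\<^sup>2)"
    using quadratic_le[of y] by (simp add: \<gamma>_def left_diff_distrib)
  also have "\<dots> = (\<Sum>i\<in>\<Lambda>. 2 * (r i * y i) - \<gamma> * (y i)\<^sup>2)"
    by (simp add: sum_subtractf sum_distrib_left)
  also have "\<dots> \<le> (\<Sum>i\<in>\<Lambda>. (r i)\<^sup>2 / \<gamma>)"
  proof (rule sum_mono)
    fix i
    have "0 \<le> (r i - \<gamma> * y i)\<^sup>2 / \<gamma>" using \<gamma>_positive by simp
    also have "\<dots> = (r i)\<^sup>2 / \<gamma> - (2 * (r i * y i) - \<gamma> * (y i)\<^sup>2)"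
      using \<gamma>_positive by (simp add: power2_eq_square field_simps)
    finally show "2 * (r i * y i) - \<gamma> * (y i)\<^sup>2 \<le> (r i)\<^sup>2 / \<gamma>" by simp
  qed
  finally show ?thesis by (simp add: sum_divide_distrib)
qed

text \<open>
  Always relax at a site where the residual exceeds \<open>\<delta>\<close>. Each such step releases at least \<open>\<delta>\<^sup>2 / \<sigma>\<close>, and the total is
  bounded.
\<close>

lemma relax_exhausts:
  assumes "\<delta> > 0"
  obtains "is" where "set is \<subseteq> \<Lambda>" "\<And>j. j \<in> \<Lambda> \<Longrightarrow> fold (relax \<kappa> \<sigma>) is r j \<le> \<delta>"
proof -
  have step: "(\<exists>is. set is \<subseteq> \<Lambda> \<and> (\<forall>j\<in>\<Lambda>. fold (relax \<kappa> \<sigma>) is r j \<le> \<delta>)) \<or>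
    (\<exists>is. set is \<subseteq> \<Lambda> \<and> real n * (\<delta>\<^sup>2 / \<sigma>) \<le> relax_energy \<kappa> \<sigma> is r)" for n
  proof (induction n arbitrary: r)
    case 0
    show ?case by (intro disjI2 exI[of _ "[]"]) simp
  next
    case (Suc n)
    show ?case
    proof (cases "\<forall>j\<in>\<Lambda>. r j \<le> \<delta>")
      case True
      then show ?thesis by (intro disjI1 exI[of _ "[]"]) simp
    next
      case False
      then obtain i where i: "i \<in> \<Lambda>" "r i > \<delta>" by force
      have gain: "\<delta>\<^sup>2 / \<sigma> \<le> (r i)\<^sup>2 / \<sigma>"
        using i \<open>\<delta> > 0\<close> \<sigma>_positive by (intro divide_right_mono power_mono) auto
      show ?thesis using Suc.IH[of "relax \<kappa> \<sigma> i r"]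
      proof (elim disjE exE conjE)
        fix "is" assume "set is \<subseteq> \<Lambda>" "\<forall>j\<in>\<Lambda>. fold (relax \<kappa> \<sigma>) is (relax \<kappa> \<sigma> i r) j \<le> \<delta>"
        then show ?thesis using i by (intro disjI1 exI[of _ "i # is"]) simp
      next
        fix "is" assume "set is \<subseteq> \<Lambda>" "real n * (\<delta>\<^sup>2 / \<sigma>) \<le> relax_energy \<kappa> \<sigma> is (relax \<kappa> \<sigma> i r)"
        then show ?thesis using i gain by (intro disjI2 exI[of _ "i # is"]) (simp add: distrib_right add_divide_distrib)
      qed
    qed
  qed
  let ?b = "(\<Sum>i\<in>\<Lambda>. (r i)\<^sup>2) / \<gamma>"
  have "\<delta>\<^sup>2 / \<sigma> > 0" using \<open>\<delta> > 0\<close> \<sigma>_positive by simp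
  then obtain n :: nat where n: "?b < real n * (\<delta>\<^sup>2 / \<sigma>)"
    using ex_less_of_nat_mult by blast
  have "relax_energy \<kappa> \<sigma> is r < real n * (\<delta>\<^sup>2 / \<sigma>)" if "set is \<subseteq> \<Lambda>" for "is"
    using relax_energy_le[OF that, of r] n by simp
  then have "\<exists>is. set is \<subseteq> \<Lambda> \<and> (\<forall>j\<in>\<Lambda>. fold (relax \<kappa> \<sigma>) is r j \<le> \<delta>)"
    using step[of n] by (meson not_less)
  then show thesis using that by blast
qed

end

section \<open>Functions of a configuration\<close>

lemma obtain_config:
  obtains x :: "'i \<Rightarrow> real" where "x \<in> configs \<Lambda>"
proof (rule that)
  show "(\<lambda>i. if i \<in> \<Lambda> then 0 else undefined) \<in> configs \<Lambda>" by (auto simp: PiE_def extensional_def)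
qed

text \<open>
  The topology on functions is that of the product over the whole type, so configurations are
  regarded as having a one-point factor at every index outside the region.
\<close>

lemma PiE_eq_PiE_UNIV: "Pi\<^sub>E \<Lambda> S = Pi\<^sub>E UNIV (\<lambda>i. if i \<in> \<Lambda> then S i else {undefined})"
  by (auto simp: PiE_iff extensional_def split: if_splits)

lemma closed_PiE_real: 
  fixes S :: "'i \<Rightarrow> real set"
  assumes "\<And>i. closed (S i)"
  shows "closed (Pi\<^sub>E \<Lambda> S)"
proof -
  have "closed (if i \<in> \<Lambda> then S i else {undefined})" for i
    using assms by simp
  then have "closedin (product_topology (\<lambda>_. euclidean) UNIV) (Pi\<^sub>E \<Lambda> S)"
    unfolding PiE_eq_PiE_UNIV[of \<Lambda> S] closedin_product_topology closed_closedin by blast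
  then show ?thesis
    by (simp only: euclidean_product_topology closed_closedin)
qed

lemma compact_PiE_real: 
  fixes S :: "'i \<Rightarrow> real set"
  assumes "\<And>i. compact (S i)"
  shows "compact (Pi\<^sub>E \<Lambda> S)"
proof -
  have "compact (if i \<in> \<Lambda> then S i else {undefined})" for i
    using assms by simp
  then have "compactin (product_topology (\<lambda>_. euclidean) UNIV) (Pi\<^sub>E \<Lambda> S)"
    unfolding PiE_eq_PiE_UNIV[of \<Lambda> S] compactin_PiE compactin_euclidean_iff by blast
  then show ?thesis
    by (simp only: euclidean_product_topology compactin_euclidean_iff)
qed

lemma tendsto_configs:
  fixes X :: "nat \<Rightarrow> 'i \<Rightarrow> real"
  assumes "\<And>i. (\<lambda>n. X n i) \<longlonglongrightarrow> x i"
  shows "X \<longlonglongrightarrow> x"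
  using assms limitin_componentwise[of "\<lambda>_. euclidean" UNIV X x sequentially]
  by (simp add: euclidean_product_topology)

lemma config_update_continuous: "continuous_on UNIV (\<lambda>t::real. x(i := t))"
proof (rule continuous_on_coordinatewise_then_product)
  show "continuous_on UNIV (\<lambda>t. (x(i := t)) j)" for j
    by (cases "j = i") (auto intro: continuous_intros)
qed

lemma config_update_mem: "x \<in> configs \<Lambda> \<Longrightarrow> i \<in> \<Lambda> \<Longrightarrow> x(i := t) \<in> configs \<Lambda>"
  by (auto simp: PiE_def extensional_def)

text \<open>
  The index type need not be countable, so the Borel sets of the function type are of no use. Instead, the function is
  the limit of its values on the grids with mesh \<open>1 / (n + 1)\<close>, each of which is countable.
\<close>

lemma continuous_on_configs_measurable:
  fixes f :: "('i \<Rightarrow> real) \<Rightarrow> real"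
  assumes fin: "finite \<Lambda>" and f: "continuous_on (configs \<Lambda>) f"
  shows "f \<in> borel_measurable (\<Pi>\<^sub>M i\<in>\<Lambda>. lborel)"
proof (rule borel_measurable_LIMSEQ_real)
  define k where "k n x = (\<lambda>i\<in>\<Lambda>. \<lfloor>real (Suc n) * x i\<rfloor>)" for n :: nat and x :: "'i \<Rightarrow> real"
  define r where "r n a = (\<lambda>i\<in>\<Lambda>. real_of_int (a i) / real (Suc n))" for n :: nat and a :: "'i \<Rightarrow> int"
  have k: "k n \<in> measurable (\<Pi>\<^sub>M i\<in>\<Lambda>. lborel) (count_space (\<Lambda> \<rightarrow>\<^sub>E UNIV))" for n
  proof (subst measurable_count_space_eq_countable)
    show "countable (\<Lambda> \<rightarrow>\<^sub>E (UNIV :: int set))" using fin by (intro countable_PiE) auto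
    show "k n \<in> space (\<Pi>\<^sub>M i\<in>\<Lambda>. lborel) \<rightarrow> \<Lambda> \<rightarrow>\<^sub>E UNIV \<and>
      (\<forall>a\<in>\<Lambda> \<rightarrow>\<^sub>E UNIV. k n -` {a} \<inter> space (\<Pi>\<^sub>M i\<in>\<Lambda>. lborel) \<in> sets (\<Pi>\<^sub>M i\<in>\<Lambda>. lborel))"
    proof (intro conjI ballI)
      show "k n \<in> space (\<Pi>\<^sub>M i\<in>\<Lambda>. lborel) \<rightarrow> \<Lambda> \<rightarrow>\<^sub>E UNIV" by (auto simp: k_def)
      fix a :: "'i \<Rightarrow> int" assume a: "a \<in> \<Lambda> \<rightarrow>\<^sub>E UNIV"
      have "k n -` {a} \<inter> space (\<Pi>\<^sub>M i\<in>\<Lambda>. lborel)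
         = {x \<in> space (\<Pi>\<^sub>M i\<in>\<Lambda>. lborel). \<forall>i\<in>\<Lambda>. \<lfloor>real (Suc n) * x i\<rfloor> = a i}"
        using a by (auto simp: k_def fun_eq_iff restrict_def PiE_def extensional_def)
      moreover have "{x \<in> space (\<Pi>\<^sub>M i\<in>\<Lambda>. lborel). \<forall>i\<in>\<Lambda>. \<lfloor>real (Suc n) * x i\<rfloor> = a i} \<in> sets (\<Pi>\<^sub>M i\<in>\<Lambda>. lborel)"
        using fin by measurable
      ultimately show "k n -` {a} \<inter> space (\<Pi>\<^sub>M i\<in>\<Lambda>. lborel) \<in> sets (\<Pi>\<^sub>M i\<in>\<Lambda>. lborel)" by simp
    qed
  qed
  show "(\<lambda>x. f (r n (k n x))) \<in> borel_measurable (\<Pi>\<^sub>M i\<in>\<Lambda>. lborel)" for n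
    using measurable_compose[OF k, of "\<lambda>a. f (r n a)" borel n] by simp
  show "(\<lambda>n. f (r n (k n x))) \<longlonglongrightarrow> f x" if "x \<in> space (\<Pi>\<^sub>M i\<in>\<Lambda>. lborel)" for x
  proof (rule continuous_on_tendsto_compose[OF f])
    have x: "x \<in> configs \<Lambda>" using that by (simp add: space_PiM)
    then show "x \<in> configs \<Lambda>" .
    show "\<forall>\<^sub>F n in sequentially. r n (k n x) \<in> configs \<Lambda>" by (auto simp: r_def)
    show "(\<lambda>n. r n (k n x)) \<longlonglongrightarrow> x"
    proof (rule tendsto_configs)
      fix i
      show "(\<lambda>n. r n (k n x) i) \<longlonglongrightarrow> x i"
      proof (cases "i \<in> \<Lambda>")
        case True
        have "(\<lambda>n. real_of_int \<lfloor>real (Suc n) * x i\<rfloor> / real (Suc n)) \<longlonglongrightarrow> x i"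
        proof (rule tendsto_sandwich)
          show "\<forall>\<^sub>F n in sequentially. x i - inverse (real (Suc n)) \<le> real_of_int \<lfloor>real (Suc n) * x i\<rfloor> / real (Suc n)"
          proof (rule always_eventually, rule allI)
            fix n
            have "real (Suc n) * x i - 1 \<le> real_of_int \<lfloor>real (Suc n) * x i\<rfloor>" by linarith
            then have "(real (Suc n) * x i - 1) / real (Suc n) \<le> real_of_int \<lfloor>real (Suc n) * x i\<rfloor> / real (Suc n)"
              by (rule divide_right_mono) simp
            moreover have "(real (Suc n) * x i - 1) / real (Suc n) = x i - inverse (real (Suc n))"
              by (simp add: diff_divide_distrib inverse_eq_divide del: of_nat_Suc)
            ultimately show "x i - inverse (real (Suc n)) \<le> real_of_int \<lfloor>real (Suc n) * x i\<rfloor> / real (Suc n)" by simp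
          qed
          show "\<forall>\<^sub>F n in sequentially. real_of_int \<lfloor>real (Suc n) * x i\<rfloor> / real (Suc n) \<le> x i"
          proof (rule always_eventually, rule allI)
            fix n
            have "real_of_int \<lfloor>real (Suc n) * x i\<rfloor> \<le> x i * real (Suc n)" by (simp add: mult.commute)
            then show "real_of_int \<lfloor>real (Suc n) * x i\<rfloor> / real (Suc n) \<le> x i"
              by (subst divide_le_eq) (simp del: of_nat_Suc)
          qed
          show "(\<lambda>n. x i - inverse (real (Suc n))) \<longlonglongrightarrow> x i"
            using tendsto_diff[OF tendsto_const LIMSEQ_inverse_real_of_nat, of "x i"] by simp
        qed simp
        then show ?thesis using True by (simp add: r_def k_def)
      next
        case False
        then show ?thesis using x by (simp add: r_def PiE_def extensional_def)
      qed
    qed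
  qed
qed

lemma config_update_measurable:
  assumes "i \<in> \<Lambda>"
  shows "(\<lambda>(x, y). x(i := y)) \<in> measurable ((\<Pi>\<^sub>M i\<in>\<Lambda>. lborel :: real measure) \<Otimes>\<^sub>M (lborel :: real measure)) (\<Pi>\<^sub>M i\<in>\<Lambda>. lborel)"
proof (rule measurable_PiM_single')
  show "(\<lambda>p. (case p of (x, y) \<Rightarrow> x(i := y)) j) \<in> measurable ((\<Pi>\<^sub>M i\<in>\<Lambda>. lborel :: real measure) \<Otimes>\<^sub>M (lborel :: real measure)) lborel" if "j \<in> \<Lambda>" for j
  proof (cases "j = i")
    case True
    then show ?thesis by (simp add: split_beta')
  next
    case False
    then have "(\<lambda>p. (case p of (x, y) \<Rightarrow> x(i := y)) j) = (\<lambda>p :: ('a \<Rightarrow> real) \<times> real. (fst p) j)" by (auto simp: fun_eq_iff)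
    moreover have "(\<lambda>p. (fst p) j) \<in> measurable ((\<Pi>\<^sub>M i\<in>\<Lambda>. lborel) \<Otimes>\<^sub>M (lborel :: real measure)) lborel"
      using that by measurable
    ultimately show ?thesis by (simp only:)
  qed
  show "(\<lambda>p. case p of (x, y) \<Rightarrow> x(i := y)) \<in> space ((\<Pi>\<^sub>M i\<in>\<Lambda>. lborel :: real measure) \<Otimes>\<^sub>M (lborel :: real measure)) \<rightarrow> \<Lambda> \<rightarrow>\<^sub>E space lborel"
    using assms by (auto simp: space_pair_measure space_PiM PiE_def extensional_def)
qed

lemma partial_deriv_measurable:
  assumes i: "i \<in> \<Lambda>" and g: "g \<in> borel_measurable (\<Pi>\<^sub>M i\<in>\<Lambda>. lborel)"
    and d: "\<And>x. x \<in> configs \<Lambda> \<Longrightarrow> ((\<lambda>t. g (x(i := t))) has_real_derivative partial_deriv i g x) (at (x i))"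
  shows "partial_deriv i g \<in> borel_measurable (\<Pi>\<^sub>M i\<in>\<Lambda>. lborel)"
proof (rule borel_measurable_LIMSEQ_real)
  let ?\<nu> = "\<Pi>\<^sub>M i\<in>\<Lambda>. (lborel :: real measure)"
  have [measurable]: "(\<lambda>x. g (x(i := x i + h))) \<in> borel_measurable ?\<nu>" for h
  proof -
    have "(\<lambda>x. (x, x i + h)) \<in> measurable ?\<nu> (?\<nu> \<Otimes>\<^sub>M lborel)" using i by measurable
    from measurable_compose[OF this measurable_compose[OF config_update_measurable[OF i] g]]
    show ?thesis by simp
  qed
  have [measurable]: "g \<in> borel_measurable ?\<nu>" by (rule g)
  show "(\<lambda>x. (g (x(i := x i + inverse (real (Suc n)))) - g x) / inverse (real (Suc n))) \<in> borel_measurable ?\<nu>" for n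
    by measurable
  show "(\<lambda>n. (g (x(i := x i + inverse (real (Suc n)))) - g x) / inverse (real (Suc n))) \<longlonglongrightarrow> partial_deriv i g x"
    if "x \<in> space ?\<nu>" for x
  proof -
    have "((\<lambda>h. (g (x(i := x i + h)) - g (x(i := x i))) / h) \<longlongrightarrow> partial_deriv i g x) (at 0)"
      using d[of x] that by (simp add: DERIV_def space_PiM)
    moreover have "(\<lambda>n. inverse (real (Suc n))) \<longlonglongrightarrow> 0"
      by (rule LIMSEQ_inverse_real_of_nat)
    ultimately show ?thesis
      by (auto simp: tendsto_at_iff_sequentially comp_def)
  qed
qed

section \<open>Gibbs measures with pair interaction\<close>

text \<open>
  Here \<open>c\<close> may be large: the comparison of the two constants needs the Gibbs measure to be a probability
  measure also when the interaction is too strong for the sweep argument.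
\<close>

locale pair_interaction = quadratic_form \<Lambda> \<kappa> c
  for \<Lambda> :: "'i set" and \<kappa> :: "'i \<Rightarrow> 'i \<Rightarrow> real" and c :: real +
  fixes u :: "real \<Rightarrow> real" and b :: "'i \<Rightarrow> real"
  assumes gaussian_tails: "has_gaussian_tails u"
begin

lemma single_potential_measurable [measurable]: "u \<in> borel_measurable borel"
  by (rule has_gaussian_tails_measurable[OF gaussian_tails])

abbreviation \<nu> :: "('i \<Rightarrow> real) measure" where "\<nu> \<equiv> \<Pi>\<^sub>M i\<in>\<Lambda>. lborel"

definition potential :: "('i \<Rightarrow> real) \<Rightarrow> real" where
  "potential x = (\<Sum>i\<in>\<Lambda>. u (x i)) - (\<Sum>i\<in>\<Lambda>. \<Sum>j\<in>\<Lambda>. \<kappa> i j * x i * x j) / 2 - (\<Sum>i\<in>\<Lambda>. b i * x i)"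

definition local_field :: "'i \<Rightarrow> ('i \<Rightarrow> real) \<Rightarrow> real" where
  "local_field i x = (\<Sum>j\<in>\<Lambda>. \<kappa> i j * x j) + b i"

abbreviation \<mu> :: "('i \<Rightarrow> real) measure" where "\<mu> \<equiv> gibbs_measure \<Lambda> potential"

abbreviation Z :: real where "Z \<equiv> partition_function \<Lambda> potential"

lemma space_\<nu>: "space \<nu> = configs \<Lambda>" by (simp add: space_PiM)

lemma local_field_measurable [measurable]: "local_field i \<in> borel_measurable \<nu>"
  unfolding local_field_def[abs_def] by measurable

lemma potential_measurable [measurable]: "potential \<in> borel_measurable \<nu>"
  unfolding potential_def[abs_def] by measurable

lemma local_field_update:
  assumes "j \<in> \<Lambda>"
  shows "local_field i (x(j := t)) = local_field i x + \<kappa> i j * (t - x j)"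
proof -
  have "(\<Sum>k\<in>\<Lambda>. \<kappa> i k * (x(j := t)) k) = (\<Sum>k\<in>\<Lambda>. \<kappa> i k * x k + (if k = j then \<kappa> i j * (t - x j) else 0))"
    by (rule sum.cong) (auto simp: algebra_simps)
  then show ?thesis
    using assms finite_sites by (simp add: local_field_def sum.distrib)
qed

lemma local_field_update_self [simp]: "i \<in> \<Lambda> \<Longrightarrow> local_field i (x(i := t)) = local_field i x"
  by (simp add: local_field_update \<kappa>_diag)

text \<open>
  As a function of one spin, the potential is the single-site potential in the local field; this uses that
  the interaction has no diagonal.
\<close>

lemma potential_update:
  assumes i: "i \<in> \<Lambda>"
  shows "potential (x(i := y)) = potential (x(i := 0)) - u 0 + u y - y * local_field i x"
proof -
  let ?x = "x(i := 0)"
  let ?z = "\<lambda>j. ?x j + (if j = i then y else 0)"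
  have z: "x(i := y) = ?z" by (auto simp: fun_eq_iff)
  have 1: "(\<Sum>j\<in>\<Lambda>. u (?z j)) = (\<Sum>j\<in>\<Lambda>. u (?x j)) - u 0 + u y"
  proof -
    have "(\<Sum>j\<in>\<Lambda>. u (?z j)) = (\<Sum>j\<in>\<Lambda>. u (?x j) + (if j = i then u y - u 0 else 0))"
      by (rule sum.cong) auto
    then show ?thesis using i finite_sites by (simp add: sum.distrib)
  qed
  have 2: "(\<Sum>j\<in>\<Lambda>. b j * ?z j) = (\<Sum>j\<in>\<Lambda>. b j * ?x j) + b i * y"
  proof -
    have "(\<Sum>j\<in>\<Lambda>. b j * ?z j) = (\<Sum>j\<in>\<Lambda>. b j * ?x j + (if j = i then b i * y else 0))"
      by (rule sum.cong) auto
    then show ?thesis using i finite_sites by (simp add: sum.distrib)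
  qed
  have 3: "(\<Sum>k\<in>\<Lambda>. \<Sum>j\<in>\<Lambda>. \<kappa> k j * ?z k * ?z j)
     = (\<Sum>k\<in>\<Lambda>. \<Sum>j\<in>\<Lambda>. \<kappa> k j * ?x k * ?x j) + 2 * (y * (\<Sum>j\<in>\<Lambda>. \<kappa> i j * ?x j))"
    by (rule quadratic_form_shift[OF finite_sites \<kappa>_sym \<kappa>_diag i])
  have 4: "(\<Sum>j\<in>\<Lambda>. \<kappa> i j * ?x j) = local_field i x - b i"
    using local_field_update_self[OF i, of x 0] by (simp add: local_field_def)
  show ?thesis
    unfolding potential_def z 1 2 3 4 by (simp add: field_simps)
qed

sublocale P: product_sigma_finite "\<lambda>_::'i. lborel :: real measure" ..

lemma integrable_exp_square_potential:
  "integrable \<nu> (\<lambda>x. exp (a * (\<Sum>i\<in>\<Lambda>. (x i)\<^sup>2) - potential x))"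
proof (rule Bochner_Integration.integrable_bound)
  let ?c = "a + c / 2"
  show "integrable \<nu> (\<lambda>x. \<Prod>i\<in>\<Lambda>. exp (?c * (x i)\<^sup>2 + b i * x i - u (x i)))"
    by (rule P.product_integrable_prod[OF finite_sites])
      (use gaussian_tails in \<open>auto simp: has_gaussian_tails_def\<close>)
  show "AE x in \<nu>. norm (exp (a * (\<Sum>i\<in>\<Lambda>. (x i)\<^sup>2) - potential x))
      \<le> norm (\<Prod>i\<in>\<Lambda>. exp (?c * (x i)\<^sup>2 + b i * x i - u (x i)))"
  proof (rule AE_I2)
    fix x
    have "a * (\<Sum>i\<in>\<Lambda>. (x i)\<^sup>2) - potential x \<le> ?c * (\<Sum>i\<in>\<Lambda>. (x i)\<^sup>2) + (\<Sum>i\<in>\<Lambda>. b i * x i) - (\<Sum>i\<in>\<Lambda>. u (x i))"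
      using quadratic_le[of x] by (simp add: potential_def algebra_simps)
    also have "\<dots> = (\<Sum>i\<in>\<Lambda>. ?c * (x i)\<^sup>2 + b i * x i - u (x i))"
      by (simp add: sum.distrib sum_subtractf sum_distrib_left)
    finally show "norm (exp (a * (\<Sum>i\<in>\<Lambda>. (x i)\<^sup>2) - potential x))
      \<le> norm (\<Prod>i\<in>\<Lambda>. exp (?c * (x i)\<^sup>2 + b i * x i - u (x i)))"
      using finite_sites by (simp add: prod_nonneg flip: exp_sum)
  qed
qed measurable

lemma integrable_exp_potential: "integrable \<nu> (\<lambda>x. exp (- potential x))"
  using integrable_exp_square_potential[of 0] by simp

text \<open>
  The weight is positive everywhere and the reference measure does not vanish, as the unit cube shows.
\<close>

lemma Z_pos: "Z > 0"
proof -
  have "Z \<noteq> 0"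
  proof
    assume "Z = 0"
    then have "AE x in \<nu>. exp (- potential x) = 0"
      unfolding partition_function_def
      by (subst (asm) integral_nonneg_eq_0_iff_AE[OF integrable_exp_potential]) auto
    then have null: "emeasure \<nu> (space \<nu>) = 0"
      by (simp add: AE_iff_null null_sets_def)
    have "emeasure \<nu> (Pi\<^sub>E \<Lambda> (\<lambda>_. {0..1})) = (\<Prod>i\<in>\<Lambda>. emeasure lborel {0..1::real})"
      by (rule P.emeasure_PiM[OF finite_sites]) simp
    then have "emeasure \<nu> (Pi\<^sub>E \<Lambda> (\<lambda>_. {0..1})) = 1" by simp
    moreover have "emeasure \<nu> (Pi\<^sub>E \<Lambda> (\<lambda>_. {0..1})) \<le> emeasure \<nu> (space \<nu>)"
      by (rule emeasure_space)
    ultimately show False using null by simp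
  qed
  moreover have "Z \<ge> 0" unfolding partition_function_def by simp
  ultimately show ?thesis by simp
qed

lemma sets_\<mu> [simp, measurable_cong]: "sets \<mu> = sets \<nu>"
  by (simp add: gibbs_measure_def)

lemma space_\<mu>: "space \<mu> = configs \<Lambda>"
  by (simp add: gibbs_measure_def space_\<nu>)

lemma integral_\<mu>:
  fixes g :: "('i \<Rightarrow> real) \<Rightarrow> real"
  assumes [measurable]: "g \<in> borel_measurable \<nu>"
  shows "(\<integral>x. g x \<partial>\<mu>) = (\<integral>x. g x * exp (- potential x) \<partial>\<nu>) / Z"
    and "integrable \<mu> g \<longleftrightarrow> integrable \<nu> (\<lambda>x. g x * exp (- potential x))"
proof -
  have "(\<integral>x. g x \<partial>\<mu>) = (\<integral>x. (exp (- potential x) / Z) *\<^sub>R g x \<partial>\<nu>)"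
    unfolding gibbs_measure_def by (rule integral_density) (use Z_pos in auto)
  also have "\<dots> = (\<integral>x. g x * exp (- potential x) / Z \<partial>\<nu>)"
    by (simp add: mult.commute)
  finally show "(\<integral>x. g x \<partial>\<mu>) = (\<integral>x. g x * exp (- potential x) \<partial>\<nu>) / Z" by simp
  have "integrable \<mu> g \<longleftrightarrow> integrable \<nu> (\<lambda>x. (exp (- potential x) / Z) *\<^sub>R g x)"
    unfolding gibbs_measure_def by (rule integrable_density) (use Z_pos in auto)
  also have "\<dots> \<longleftrightarrow> integrable \<nu> (\<lambda>x. (1 / Z) * (g x * exp (- potential x)))"
    by (simp add: mult.commute)
  also have "\<dots> \<longleftrightarrow> integrable \<nu> (\<lambda>x. g x * exp (- potential x))"
    using Z_pos by (subst integrable_mult_left_iff) auto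
  finally show "integrable \<mu> g \<longleftrightarrow> integrable \<nu> (\<lambda>x. g x * exp (- potential x))" .
qed

sublocale \<mu>: prob_space \<mu>
proof
  have i: "integrable \<nu> (\<lambda>x. exp (- potential x) / Z)"
    using integrable_exp_potential by simp
  have "emeasure \<mu> (space \<mu>) = (\<integral>\<^sup>+x. ennreal (exp (- potential x) / Z) \<partial>\<nu>)"
    unfolding gibbs_measure_def by (subst emeasure_density) (auto intro!: nn_integral_cong)
  also have "\<dots> = ennreal (\<integral>x. exp (- potential x) / Z \<partial>\<nu>)"
    by (rule nn_integral_eq_integral[OF i]) (use Z_pos in auto)
  also have "(\<integral>x. exp (- potential x) / Z \<partial>\<nu>) = 1"
    using Z_pos by (simp add: partition_function_def)
  finally show "emeasure \<mu> (space \<mu>) = 1" by simp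
qed

lemma integrable_bounded_\<mu>:
  fixes g :: "('i \<Rightarrow> real) \<Rightarrow> real"
  assumes "g \<in> borel_measurable \<nu>" "\<And>x. x \<in> configs \<Lambda> \<Longrightarrow> \<bar>g x\<bar> \<le> C"
  shows "integrable \<mu> g"
proof (rule \<mu>.integrable_const_bound[of _ C])
  show "AE x in \<mu>. norm (g x) \<le> C" by (rule AE_I2) (use assms in \<open>auto simp: space_\<mu>\<close>)
  show "g \<in> borel_measurable \<mu>" using assms(1) measurable_cong_sets[OF sets_\<mu> refl] by blast
qed

lemma integrable_moment_\<mu>: "integrable \<mu> (\<lambda>x. (\<Sum>i\<in>\<Lambda>. \<bar>x i\<bar>)\<^sup>2)"
proof -
  have "integrable \<nu> (\<lambda>x. (\<Sum>i\<in>\<Lambda>. \<bar>x i\<bar>)\<^sup>2 * exp (- potential x))"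
  proof (rule Bochner_Integration.integrable_bound)
    show "integrable \<nu> (\<lambda>x. real (card \<Lambda>) * exp (1 * (\<Sum>i\<in>\<Lambda>. (x i)\<^sup>2) - potential x))"
      by (intro integrable_mult_right integrable_exp_square_potential)
    show "AE x in \<nu>. norm ((\<Sum>i\<in>\<Lambda>. \<bar>x i\<bar>)\<^sup>2 * exp (- potential x))
       \<le> norm (real (card \<Lambda>) * exp (1 * (\<Sum>i\<in>\<Lambda>. (x i)\<^sup>2) - potential x))"
    proof (rule AE_I2)
      fix x :: "'i \<Rightarrow> real"
      let ?s = "\<Sum>i\<in>\<Lambda>. (x i)\<^sup>2"
      \<comment> \<open>The moment is absorbed into a quadratic exponential, which the tails can bear.\<close>
      have "(\<Sum>i\<in>\<Lambda>. 1 * \<bar>x i\<bar>)\<^sup>2 \<le> (\<Sum>i\<in>\<Lambda>. 1\<^sup>2) * (\<Sum>i\<in>\<Lambda>. \<bar>x i\<bar>\<^sup>2)"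
        by (rule Cauchy_Schwarz_ineq_sum)
      then have "(\<Sum>i\<in>\<Lambda>. \<bar>x i\<bar>)\<^sup>2 \<le> real (card \<Lambda>) * ?s" by simp
      also have "\<dots> \<le> real (card \<Lambda>) * exp ?s"
        using exp_ge_add_one_self[of ?s] by (intro mult_left_mono) linarith+
      finally have "(\<Sum>i\<in>\<Lambda>. \<bar>x i\<bar>)\<^sup>2 * exp (- potential x) \<le> real (card \<Lambda>) * exp ?s * exp (- potential x)"
        by (rule mult_right_mono) simp
      also have "\<dots> = real (card \<Lambda>) * exp (1 * ?s - potential x)"
        by (simp add: exp_diff exp_minus divide_inverse)
      finally show "norm ((\<Sum>i\<in>\<Lambda>. \<bar>x i\<bar>)\<^sup>2 * exp (- potential x)) \<le> norm (real (card \<Lambda>) * exp (1 * ?s - potential x))"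
        by simp
    qed
  qed measurable
  then show ?thesis by (subst integral_\<mu>(2)) simp_all
qed

lemma measurable_section:
  fixes g :: "('i \<Rightarrow> real) \<Rightarrow> real"
  assumes "i \<in> \<Lambda>" "x \<in> configs \<Lambda>" "g \<in> borel_measurable \<nu>"
  shows "(\<lambda>y. g (x(i := y))) \<in> borel_measurable borel"
proof -
  have "(\<lambda>y. (x, y)) \<in> measurable lborel (\<nu> \<Otimes>\<^sub>M lborel)"
    using assms(2) by (intro measurable_Pair1') (simp add: space_\<nu>)
  from measurable_compose[OF this measurable_compose[OF config_update_measurable[OF assms(1)] assms(3)]]
  show ?thesis by simp
qed

text \<open>
  The conditional expectation of \<open>g\<close> given all spins but the one at \<open>i\<close>.
\<close>

definition cond :: "'i \<Rightarrow> (('i \<Rightarrow> real) \<Rightarrow> real) \<Rightarrow> ('i \<Rightarrow> real) \<Rightarrow> real" where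
  "cond i g x = (\<integral>y. g (x(i := y)) \<partial>site_measure u (local_field i x))"

lemma cond_eq:
  assumes "i \<in> \<Lambda>" "x \<in> configs \<Lambda>" "g \<in> borel_measurable \<nu>"
  shows "cond i g x = (\<integral>y. g (x(i := y)) * exp (local_field i x * y - u y) \<partial>lborel)
    / (\<integral>y. exp (local_field i x * y - u y) \<partial>lborel)"
  unfolding cond_def by (rule integral_site_measure(1)[OF gaussian_tails measurable_section[OF assms]])

lemma cond_measurable:
  assumes i: "i \<in> \<Lambda>" and g[measurable]: "g \<in> borel_measurable \<nu>"
  shows "cond i g \<in> borel_measurable \<nu>"
proof -
  have [measurable]: "(\<lambda>(x, y). g (x(i := y))) \<in> borel_measurable (\<nu> \<Otimes>\<^sub>M lborel)"
    using measurable_compose[OF config_update_measurable[OF i] g] by (simp add: split_beta')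
  have "(\<lambda>x. (\<integral>y. g (x(i := y)) * exp (local_field i x * y - u y) \<partial>lborel)
    / (\<integral>y. exp (local_field i x * y - u y) \<partial>lborel)) \<in> borel_measurable \<nu>"
    by measurable
  then show ?thesis
    by (rule measurable_cong[THEN iffD2, rotated]) (simp add: cond_eq[OF i _ g] space_\<nu>)
qed

lemma cond_integrable_section:
  fixes g :: "('i \<Rightarrow> real) \<Rightarrow> real"
  assumes i: "i \<in> \<Lambda>" and x: "x \<in> configs \<Lambda>" and g: "g \<in> borel_measurable \<nu>"
    and b: "\<And>x. x \<in> configs \<Lambda> \<Longrightarrow> \<bar>g x\<bar> \<le> C"
  shows "integrable (site_measure u h) (\<lambda>y. g (x(i := y)))"
  by (rule integrable_bounded_site_measure[OF gaussian_tails measurable_section[OF i x g]])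
    (rule b[OF config_update_mem[OF x i]])

lemma cond_bounds:
  assumes i: "i \<in> \<Lambda>" and x: "x \<in> configs \<Lambda>" and g: "g \<in> borel_measurable \<nu>"
    and b: "\<And>x. x \<in> configs \<Lambda> \<Longrightarrow> l \<le> g x" "\<And>x. x \<in> configs \<Lambda> \<Longrightarrow> g x \<le> m"
  shows "l \<le> cond i g x" "cond i g x \<le> m"
proof -
  interpret S: prob_space "site_measure u h" for h by (rule prob_space_site_measure[OF gaussian_tails])
  have "\<bar>g x\<bar> \<le> \<bar>l\<bar> + \<bar>m\<bar>" if "x \<in> configs \<Lambda>" for x using b[OF that] by linarith
  note int = cond_integrable_section[OF i x g this]
  have "(\<integral>y. l \<partial>site_measure u (local_field i x)) \<le> cond i g x"
    unfolding cond_def by (intro integral_mono int b(1) config_update_mem x i S.integrable_const)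
  then show "l \<le> cond i g x" using S.prob_space by simp
  have "cond i g x \<le> (\<integral>y. m \<partial>site_measure u (local_field i x))"
    unfolding cond_def by (intro integral_mono int b(2) config_update_mem x i S.integrable_const)
  then show "cond i g x \<le> m" using S.prob_space by simp
qed

lemma cond_update_self: "i \<in> \<Lambda> \<Longrightarrow> cond i g (x(i := t)) = cond i g x"
  by (simp add: cond_def)

text \<open>
  Fubini: on each line parallel to the axis \<open>i\<close> the Gibbs weight is a multiple of the single-site weight in
  the local field, which is constant along the line.
\<close>

lemma integral_cond:
  assumes i: "i \<in> \<Lambda>" and g[measurable]: "g \<in> borel_measurable \<nu>"
    and bd: "\<And>x. x \<in> configs \<Lambda> \<Longrightarrow> \<bar>g x\<bar> \<le> C"
  shows "(\<integral>x. cond i g x \<partial>\<mu>) = (\<integral>x. g x \<partial>\<mu>)"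
proof -
  let ?J = "\<Lambda> - {i}"
  have J: "finite ?J" "i \<notin> ?J" "insert i ?J = \<Lambda>" using finite_sites i by auto
  have cm[measurable]: "cond i g \<in> borel_measurable \<nu>" by (rule cond_measurable[OF i g])
  have cb: "\<bar>cond i g x\<bar> \<le> C" if "x \<in> configs \<Lambda>" for x
  proof -
    have "- C \<le> g x \<and> g x \<le> C" if "x \<in> configs \<Lambda>" for x using bd[OF that] by linarith
    then show ?thesis using cond_bounds[OF i that g, of "- C" C] by fastforce
  qed
  have ig: "integrable \<nu> (\<lambda>x. g x * exp (- potential x))"
    using integrable_bounded_\<mu>[OF g bd] integral_\<mu>(2)[OF g] by blast
  have ic: "integrable \<nu> (\<lambda>x. cond i g x * exp (- potential x))"
    using integrable_bounded_\<mu>[OF cm cb] integral_\<mu>(2)[OF cm] by blast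
  have inner: "(\<integral>y. cond i g (x(i := y)) * exp (- potential (x(i := y))) \<partial>lborel)
     = (\<integral>y. g (x(i := y)) * exp (- potential (x(i := y))) \<partial>lborel)"
    if x: "x \<in> space (Pi\<^sub>M ?J (\<lambda>_. lborel))" for x
  proof -
    define c where "c = exp (u 0 - potential (x(i := 0)))"
    have w: "exp (- potential (x(i := y))) = c * exp (local_field i x * y - u y)" for y
      unfolding c_def potential_update[OF i, of x y] by (simp add: algebra_simps flip: exp_add)
    have x0: "x(i := 0) \<in> configs \<Lambda>"
      using x i by (auto simp: space_PiM PiE_def extensional_def)
    have "(\<integral>y. cond i g (x(i := y)) * exp (- potential (x(i := y))) \<partial>lborel)
      = cond i g (x(i := 0)) * (c * (\<integral>y. exp (local_field i x * y - u y) \<partial>lborel))"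
      by (simp add: w cond_update_self[OF i])
    also have "\<dots> = c * (\<integral>y. g (x(i := y)) * exp (local_field i x * y - u y) \<partial>lborel)"
      using site_partition_pos[OF gaussian_tails, of "local_field i x"] i
      by (subst cond_eq[OF i x0 g]) simp
    also have "\<dots> = (\<integral>y. g (x(i := y)) * exp (- potential (x(i := y))) \<partial>lborel)"
      by (simp add: w mult.left_commute flip: integral_mult_right_zero)
    finally show ?thesis .
  qed
  have "(\<integral>x. cond i g x * exp (- potential x) \<partial>\<nu>) = (\<integral>x. g x * exp (- potential x) \<partial>\<nu>)"
    using P.product_integral_insert[OF J(1,2), of "\<lambda>x. cond i g x * exp (- potential x)"]
      P.product_integral_insert[OF J(1,2), of "\<lambda>x. g x * exp (- potential x)"] ig ic
    unfolding J(3) using inner by (simp cong: Bochner_Integration.integral_cong)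
  then show ?thesis by (simp add: integral_\<mu>(1))
qed

end

section \<open>Entropy along a sweep of conditional expectations\<close>

text \<open>
  Both \<open>single_site\<close> and \<open>coupling\<close> refer to the same \<open>\<sigma>\<close>: the interaction has to be small compared with the
  single-site constant.
\<close>

locale spin_system = single_site u \<sigma> + coupling \<Lambda> \<kappa> c \<sigma> + pair_interaction \<Lambda> \<kappa> c u b
  for u :: "real \<Rightarrow> real" and \<sigma> :: real and \<Lambda> :: "'i set" and \<kappa> :: "'i \<Rightarrow> 'i \<Rightarrow> real" and c :: real
    and b :: "'i \<Rightarrow> real"
begin

text \<open>
  A class of test functions that is stable under \<open>cond i\<close>: the bounds \<open>\<epsilon>\<close> and \<open>M\<close> are inherited, and only \<open>B\<close>
  changes. Positivity makes \<open>sqrt g\<close> differentiable.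
\<close>

definition admissible :: "real \<Rightarrow> real \<Rightarrow> real \<Rightarrow> (('i \<Rightarrow> real) \<Rightarrow> real) \<Rightarrow> bool" where
  "admissible \<epsilon> M B g \<longleftrightarrow> g \<in> borel_measurable \<nu> \<and> \<epsilon> > 0 \<and>
     (\<forall>x\<in>configs \<Lambda>. \<epsilon> \<le> g x \<and> g x \<le> M) \<and>
     (\<forall>x\<in>configs \<Lambda>. \<forall>i\<in>\<Lambda>. ((\<lambda>t. g (x(i := t))) has_real_derivative partial_deriv i g x) (at (x i)) \<and>
        \<bar>partial_deriv i g x\<bar> \<le> B)"

text \<open>
  With \<open>g = f\<^sup>2\<close> this is \<open>4 (\<partial>\<^sub>i f)\<^sup>2\<close>.
\<close>

definition fisher :: "'i \<Rightarrow> (('i \<Rightarrow> real) \<Rightarrow> real) \<Rightarrow> ('i \<Rightarrow> real) \<Rightarrow> real" where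
  "fisher i g x = (partial_deriv i g x)\<^sup>2 / g x"

lemma admissibleD:
  assumes "admissible \<epsilon> M B g"
  shows "g \<in> borel_measurable \<nu>" "\<epsilon> > 0"
    and "\<And>x. x \<in> configs \<Lambda> \<Longrightarrow> \<epsilon> \<le> g x" "\<And>x. x \<in> configs \<Lambda> \<Longrightarrow> g x \<le> M" "\<And>x. x \<in> configs \<Lambda> \<Longrightarrow> g x > 0"
    and "\<And>x. x \<in> configs \<Lambda> \<Longrightarrow> \<bar>g x\<bar> \<le> M"
    and "\<And>x i t. x \<in> configs \<Lambda> \<Longrightarrow> i \<in> \<Lambda> \<Longrightarrow>
      ((\<lambda>t. g (x(i := t))) has_real_derivative partial_deriv i g (x(i := t))) (at t)"
    and "\<And>x i. x \<in> configs \<Lambda> \<Longrightarrow> i \<in> \<Lambda> \<Longrightarrow> \<bar>partial_deriv i g x\<bar> \<le> B"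
proof -
  show m: "g \<in> borel_measurable \<nu>" "\<epsilon> > 0" using assms by (auto simp: admissible_def)
  show b: "\<epsilon> \<le> g x" "g x \<le> M" if "x \<in> configs \<Lambda>" for x using assms that by (auto simp: admissible_def)
  show "g x > 0" if "x \<in> configs \<Lambda>" for x using b(1)[OF that] m(2) by linarith
  show "\<bar>g x\<bar> \<le> M" if "x \<in> configs \<Lambda>" for x using b[OF that] m(2) by linarith
  show "((\<lambda>t. g (x(i := t))) has_real_derivative partial_deriv i g (x(i := t))) (at t)"
    if "x \<in> configs \<Lambda>" "i \<in> \<Lambda>" for x i t
  proof -
    have "((\<lambda>s. g ((x(i := t))(i := s))) has_real_derivative partial_deriv i g (x(i := t))) (at ((x(i := t)) i))"
      using assms config_update_mem[OF that] that(2) unfolding admissible_def by blast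
    then show ?thesis by simp
  qed
  show "\<bar>partial_deriv i g x\<bar> \<le> B" if "x \<in> configs \<Lambda>" "i \<in> \<Lambda>" for x i
    using assms that by (auto simp: admissible_def)
qed

lemma admissible_deriv_at:
  assumes "admissible \<epsilon> M B g" "x \<in> configs \<Lambda>" "i \<in> \<Lambda>"
  shows "((\<lambda>t. g (x(i := t))) has_real_derivative partial_deriv i g x) (at (x i))"
  using assms by (auto simp: admissible_def)

lemma admissible_partial_measurable:
  assumes "admissible \<epsilon> M B g" "i \<in> \<Lambda>"
  shows "partial_deriv i g \<in> borel_measurable \<nu>"
  using admissibleD(1)[OF assms(1)] admissible_deriv_at[OF assms(1)] assms(2)
  by (intro partial_deriv_measurable) auto

lemma fisher_props:
  assumes g: "admissible \<epsilon> M B g" and i: "i \<in> \<Lambda>"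
  shows "fisher i g \<in> borel_measurable \<nu>"
    and "\<And>x. x \<in> configs \<Lambda> \<Longrightarrow> 0 \<le> fisher i g x"
    and "\<And>x. x \<in> configs \<Lambda> \<Longrightarrow> fisher i g x \<le> B\<^sup>2 / \<epsilon>"
    and "\<And>x. x \<in> configs \<Lambda> \<Longrightarrow> \<bar>fisher i g x\<bar> \<le> B\<^sup>2 / \<epsilon>"
    and "integrable \<mu> (fisher i g)"
proof -
  note G = admissibleD[OF g]
  have [measurable]: "partial_deriv i g \<in> borel_measurable \<nu>" "g \<in> borel_measurable \<nu>"
    using admissible_partial_measurable[OF g i] G(1) by auto
  show m: "fisher i g \<in> borel_measurable \<nu>" unfolding fisher_def[abs_def] by measurable
  show p: "0 \<le> fisher i g x" if "x \<in> configs \<Lambda>" for x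
    using G(5)[OF that] by (simp add: fisher_def)
  show q: "fisher i g x \<le> B\<^sup>2 / \<epsilon>" if "x \<in> configs \<Lambda>" for x
  proof -
    have "(partial_deriv i g x)\<^sup>2 \<le> B\<^sup>2"
      using G(8)[OF that i] by (metis abs_ge_zero power2_abs power_mono)
    then show ?thesis
      using G(2) G(3)[OF that] G(5)[OF that] by (simp add: fisher_def frac_le)
  qed
  show r: "\<bar>fisher i g x\<bar> \<le> B\<^sup>2 / \<epsilon>" if "x \<in> configs \<Lambda>" for x
    using p[OF that] q[OF that] by simp
  show "integrable \<mu> (fisher i g)" by (rule integrable_bounded_\<mu>[OF m r])
qed

text \<open>
  The spin at \<open>j\<close> enters both through \<open>g\<close> and through the local field at \<open>i\<close>.
\<close>

lemma cond_deriv: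
  assumes g: "admissible \<epsilon> M B g" and i: "i \<in> \<Lambda>" and j: "j \<in> \<Lambda>" and "j \<noteq> i" and x: "x \<in> configs \<Lambda>"
  defines "S \<equiv> site_measure u (local_field i x)"
  shows "((\<lambda>t. cond i g (x(j := t))) has_real_derivative
     (cond i (partial_deriv j g) x + \<kappa> i j * ((\<integral>y. g (x(i := y)) * y \<partial>S) - cond i g x * site_mean (local_field i x)))) (at (x j))"
proof -
  note G = admissibleD[OF g]
  define a where "a = local_field i x - \<kappa> i j * x j"
  have a: "a + \<kappa> i j * t = local_field i (x(j := t))" for t
    by (simp add: a_def local_field_update[OF j] algebra_simps)
  have swap: "x(j := t, i := y) = x(i := y, j := t)" for t y
    using \<open>j \<noteq> i\<close> by (simp add: fun_upd_twist)
  have xt: "x(j := t) \<in> configs \<Lambda>" and xy: "x(i := y) \<in> configs \<Lambda>" for t y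
    using x i j by (auto intro!: config_update_mem)
  have "((\<lambda>t. \<integral>y. g (x(j := t, i := y)) \<partial>site_measure u (a + \<kappa> i j * t)) has_real_derivative
     (\<integral>y. partial_deriv j g (x(j := x j, i := y)) \<partial>site_measure u (a + \<kappa> i j * x j)) +
     \<kappa> i j * ((\<integral>y. g (x(j := x j, i := y)) * y \<partial>site_measure u (a + \<kappa> i j * x j))
       - (\<integral>y. g (x(j := x j, i := y)) \<partial>site_measure u (a + \<kappa> i j * x j)) * site_mean (a + \<kappa> i j * x j))) (at (x j))"
  proof (rule has_real_derivative_site_integral)
    show "(\<lambda>y. g (x(j := t, i := y))) \<in> borel_measurable borel" for t
      by (rule measurable_section[OF i xt G(1)])
    show "(\<lambda>y. partial_deriv j g (x(j := t, i := y))) \<in> borel_measurable borel" for t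
      by (rule measurable_section[OF i xt admissible_partial_measurable[OF g j]])
    show "\<bar>g (x(j := t, i := y))\<bar> \<le> M" for t y
      by (intro G(6) config_update_mem xt i)
    show "\<bar>partial_deriv j g (x(j := t, i := y))\<bar> \<le> B" for t y
      by (intro G(8) config_update_mem xt i j)
    show "((\<lambda>t. g (x(j := t, i := y))) has_real_derivative partial_deriv j g (x(j := t, i := y))) (at t)" for t y
      unfolding swap by (rule G(7)[OF xy j])
  qed
  then show ?thesis
    unfolding a by (simp add: cond_def S_def)
qed

text \<open>
  The two terms of the derivative are bounded by the weighted Cauchy-Schwarz inequality and by the
  covariance estimate. Both bounds carry the factor \<open>sqrt (cond i g x)\<close>, which cancels.
\<close>

lemma sqrt_fisher_cond_le:
  assumes g: "admissible \<epsilon> M B g" and i: "i \<in> \<Lambda>" and j: "j \<in> \<Lambda>" and "j \<noteq> i" and x: "x \<in> configs \<Lambda>"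
  shows "sqrt (fisher j (cond i g) x) \<le> sqrt (cond i (fisher j g) x) + \<kappa> i j / \<sigma> * sqrt (cond i (fisher i g) x)"
proof -
  note G = admissibleD[OF g]
  let ?S = "site_measure u (local_field i x)"
  have xy: "x(i := y) \<in> configs \<Lambda>" for y using x i by (auto intro!: config_update_mem)
  define c where "c = (\<integral>y. g (x(i := y)) * y \<partial>?S) - cond i g x * site_mean (local_field i x)"
  have D: "partial_deriv j (cond i g) x = cond i (partial_deriv j g) x + \<kappa> i j * c"
    unfolding partial_deriv_def c_def by (rule DERIV_imp_deriv[OF cond_deriv[OF g i j \<open>j \<noteq> i\<close> x, unfolded partial_deriv_def]])
  have cg: "cond i g x > 0" using cond_bounds(1)[OF i x G(1) G(3) G(4)] G(2) by simp
  have 1: "\<bar>cond i (partial_deriv j g) x\<bar> \<le> sqrt (cond i g x) * sqrt (cond i (fisher j g) x)"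
    unfolding cond_def fisher_def
  proof (rule integral_square_le_weighted)
    show "integrable ?S (\<lambda>y. partial_deriv j g (x(i := y)))"
      by (rule cond_integrable_section[OF i x admissible_partial_measurable[OF g j] G(8)[OF _ j]])
    show "integrable ?S (\<lambda>y. g (x(i := y)))"
      by (rule cond_integrable_section[OF i x G(1) G(6)])
    show "integrable ?S (\<lambda>y. (partial_deriv j g (x(i := y)))\<^sup>2 / g (x(i := y)))"
      using cond_integrable_section[OF i x fisher_props(1)[OF g j] fisher_props(4)[OF g j]] by (simp add: fisher_def)
  qed (rule G(5)[OF xy])
  have 2: "\<bar>c\<bar> \<le> 1 / \<sigma> * sqrt (cond i g x) * sqrt (cond i (fisher i g) x)"
    unfolding c_def cond_def fisher_def
    by (rule site_covariance_le[where \<epsilon>=\<epsilon> and M=M and B=B])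
      (use G(2) G(3)[OF xy] G(4)[OF xy] G(7)[OF x i] G(8)[OF xy i] in auto)
  have "\<bar>partial_deriv j (cond i g) x\<bar> \<le> \<bar>cond i (partial_deriv j g) x\<bar> + \<kappa> i j * \<bar>c\<bar>"
    unfolding D using abs_triangle_ineq[of "cond i (partial_deriv j g) x" "\<kappa> i j * c"] \<kappa>_nonneg[of i j]
    by (simp add: abs_mult)
  also have "\<dots> \<le> sqrt (cond i g x) * sqrt (cond i (fisher j g) x) + \<kappa> i j * (1 / \<sigma> * sqrt (cond i g x) * sqrt (cond i (fisher i g) x))"
    by (intro add_mono mult_left_mono 1 2 \<kappa>_nonneg)
  also have "\<dots> = sqrt (cond i g x) * (sqrt (cond i (fisher j g) x) + \<kappa> i j / \<sigma> * sqrt (cond i (fisher i g) x))"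
    by (simp add: algebra_simps)
  finally have "\<bar>partial_deriv j (cond i g) x\<bar> / sqrt (cond i g x) \<le> sqrt (cond i (fisher j g) x) + \<kappa> i j / \<sigma> * sqrt (cond i (fisher i g) x)"
    using cg by (simp add: divide_le_eq mult.commute)
  then show ?thesis by (simp add: fisher_def[of j "cond i g"] real_sqrt_divide)
qed

lemma partial_deriv_cond_self:
  assumes "i \<in> \<Lambda>"
  shows "((\<lambda>t. cond i g (x(i := t))) has_real_derivative 0) (at s)" "partial_deriv i (cond i g) x = 0"
  using assms by (simp_all add: cond_update_self partial_deriv_def)

lemma admissible_cond:
  assumes g: "admissible \<epsilon> M B g" and i: "i \<in> \<Lambda>"
  shows "\<exists>B'. admissible \<epsilon> M B' (cond i g)"
proof -
  note G = admissibleD[OF g]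
  have cb: "\<epsilon> \<le> cond i g x" "cond i g x \<le> M" if "x \<in> configs \<Lambda>" for x
    using cond_bounds[OF i that G(1) G(3) G(4)] by auto
  define L where "L = B\<^sup>2 / \<epsilon>"
  define B' where "B' = sqrt M * (sqrt L + (\<Sum>j\<in>\<Lambda>. \<kappa> i j) / \<sigma> * sqrt L)"
  have M0: "M \<ge> 0" and L0: "L \<ge> 0"
  proof -
    obtain x where x: "x \<in> configs \<Lambda>" by (rule obtain_config)
    show "M \<ge> 0" using G(6)[OF x] by linarith
    show "L \<ge> 0" using G(2) by (simp add: L_def)
  qed
  have K0: "(\<Sum>j\<in>\<Lambda>. \<kappa> i j) / \<sigma> \<ge> 0"
    using \<sigma>_pos \<kappa>_nonneg by (intro divide_nonneg_pos sum_nonneg)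
  have B'0: "B' \<ge> 0"
    unfolding B'_def using M0 L0 K0 by (intro mult_nonneg_nonneg add_nonneg_nonneg) auto
  have "((\<lambda>t. cond i g (x(j := t))) has_real_derivative partial_deriv j (cond i g) x) (at (x j)) \<and>
       \<bar>partial_deriv j (cond i g) x\<bar> \<le> B'" if x: "x \<in> configs \<Lambda>" and j: "j \<in> \<Lambda>" for x j
  proof (cases "j = i")
    case True
    then show ?thesis using partial_deriv_cond_self[OF i, of g x] B'0 by simp
  next
    case False
    have "((\<lambda>t. cond i g (x(j := t))) has_real_derivative partial_deriv j (cond i g) x) (at (x j))"
      using cond_deriv[OF g i j False x] DERIV_imp_deriv unfolding partial_deriv_def by fastforce
    moreover have "\<bar>partial_deriv j (cond i g) x\<bar> \<le> B'"
    proof -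
      have fb: "cond i (fisher k g) x \<le> L" if "k \<in> \<Lambda>" for k
        unfolding L_def by (rule cond_bounds(2)[OF i x fisher_props(1)[OF g that] fisher_props(2)[OF g that] fisher_props(3)[OF g that]])
      have kj: "\<kappa> i j / \<sigma> \<le> (\<Sum>j\<in>\<Lambda>. \<kappa> i j) / \<sigma>"
        using \<sigma>_pos \<kappa>_nonneg finite_sites j by (intro divide_right_mono member_le_sum) auto
      have "sqrt (fisher j (cond i g) x) \<le> sqrt L + (\<Sum>j\<in>\<Lambda>. \<kappa> i j) / \<sigma> * sqrt L"
      proof (rule order_trans[OF sqrt_fisher_cond_le[OF g i j False x]], intro add_mono mult_mono)
        show "0 \<le> sqrt (cond i (fisher i g) x)"
          using cond_bounds(1)[OF i x fisher_props(1)[OF g i] fisher_props(2)[OF g i] fisher_props(3)[OF g i]] by simp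
      qed (use kj K0 fb[OF i] fb[OF j] in auto)
      moreover have "\<bar>partial_deriv j (cond i g) x\<bar> = sqrt (cond i g x) * sqrt (fisher j (cond i g) x)"
        using cb[OF x] G(2) by (simp add: fisher_def real_sqrt_divide)
      moreover have "sqrt (cond i g x) \<le> sqrt M" using cb[OF x] by simp
      moreover have "sqrt (fisher j (cond i g) x) \<ge> 0" using cb[OF x] G(2) by (simp add: fisher_def)
      ultimately show ?thesis unfolding B'_def using M0 by (metis mult_mono real_sqrt_ge_zero)
    qed
    ultimately show ?thesis by simp
  qed
  then have "admissible \<epsilon> M B' (cond i g)"
    unfolding admissible_def using cond_measurable[OF i G(1)] G(2) cb by blast
  then show ?thesis by blast
qed

text \<open>
  The chain rule for the entropy, with the logarithmic Sobolev inequality applied on each line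
  parallel to the axis \<open>i\<close>.
\<close>

lemma Ent_cond_step:
  assumes g: "admissible \<epsilon> M B g" and i: "i \<in> \<Lambda>"
  shows "Ent \<mu> g \<le> (\<integral>x. fisher i g x \<partial>\<mu>) / (2 * \<sigma>) + Ent \<mu> (cond i g)"
proof -
  note G = admissibleD[OF g]
  obtain B' where g': "admissible \<epsilon> M B' (cond i g)" using admissible_cond[OF g i] by blast
  note G' = admissibleD[OF g']
  have [measurable]: "g \<in> borel_measurable \<nu>" "cond i g \<in> borel_measurable \<nu>" using G(1) G'(1) by auto
  let ?C = "M * (\<bar>ln \<epsilon>\<bar> + \<bar>ln M\<bar>)"
  have lb: "\<bar>h x * ln (h x)\<bar> \<le> ?C" if "\<epsilon> \<le> h x" "h x \<le> M" for h :: "('i \<Rightarrow> real) \<Rightarrow> real" and x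
    by (rule abs_mult_ln_le[OF G(2) that])
  have ml: "(\<lambda>x. g x * ln (g x)) \<in> borel_measurable \<nu>" by measurable
  have bl: "\<bar>g x * ln (g x)\<bar> \<le> ?C" if "x \<in> configs \<Lambda>" for x
    using lb G(3)[OF that] G(4)[OF that] by blast
  have mF: "fisher i g \<in> borel_measurable \<nu>" by (rule fisher_props(1)[OF g i])
  have bF: "\<bar>fisher i g x\<bar> \<le> B\<^sup>2 / \<epsilon>" if "x \<in> configs \<Lambda>" for x by (rule fisher_props(4)[OF g i that])
  have ic: "integrable \<mu> (cond i f)" if f: "f \<in> borel_measurable \<nu>" and b: "\<And>x. x \<in> configs \<Lambda> \<Longrightarrow> \<bar>f x\<bar> \<le> C" for f C
  proof (rule integrable_bounded_\<mu>[OF cond_measurable[OF i f]])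
    fix x assume x: "x \<in> configs \<Lambda>"
    have "- C \<le> f x \<and> f x \<le> C" if "x \<in> configs \<Lambda>" for x using b[OF that] by linarith
    then show "\<bar>cond i f x\<bar> \<le> C" using cond_bounds[OF i x f, of "- C" C] by fastforce
  qed
  have icl: "integrable \<mu> (\<lambda>x. cond i g x * ln (cond i g x))"
    by (rule integrable_bounded_\<mu>[of _ ?C]) (use lb G'(3,4) in auto)
  have "(\<integral>x. g x * ln (g x) \<partial>\<mu>) - (\<integral>x. cond i g x * ln (cond i g x) \<partial>\<mu>)
    = (\<integral>x. cond i (\<lambda>x. g x * ln (g x)) x - cond i g x * ln (cond i g x) \<partial>\<mu>)"
    using ic[OF ml bl] icl by (simp add: integral_cond[OF i ml bl])
  also have "\<dots> \<le> (\<integral>x. cond i (fisher i g) x / (2 * \<sigma>) \<partial>\<mu>)"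
  proof (rule integral_mono)
    fix x assume "x \<in> space \<mu>"
    then have x: "x \<in> configs \<Lambda>" by (simp add: space_\<mu>)
    have xy: "x(i := y) \<in> configs \<Lambda>" for y using x i by (auto intro!: config_update_mem)
    have "Ent (site_measure u (local_field i x)) (\<lambda>y. g (x(i := y)))
       \<le> 1 / (2 * \<sigma>) * (\<integral>y. (partial_deriv i g (x(i := y)))\<^sup>2 / g (x(i := y)) \<partial>site_measure u (local_field i x))"
      by (rule log_sobolev[where \<epsilon>=\<epsilon> and M=M and B=B])
        (use G(2) G(3)[OF xy] G(4)[OF xy] G(7)[OF x i] G(8)[OF xy i] in auto)
    then show "cond i (\<lambda>x. g x * ln (g x)) x - cond i g x * ln (cond i g x) \<le> cond i (fisher i g) x / (2 * \<sigma>)"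
      by (simp add: Ent_def cond_def fisher_def)
  qed (use ic[OF ml bl] icl ic[OF mF bF] in auto)
  also have "\<dots> = (\<integral>x. fisher i g x \<partial>\<mu>) / (2 * \<sigma>)"
    by (simp add: integral_cond[OF i mF bF])
  finally show ?thesis
    by (simp add: Ent_def integral_cond[OF i G(1) G(6)])
qed

lemma fisher_cond_self: "i \<in> \<Lambda> \<Longrightarrow> fisher i (cond i g) x = 0"
  by (simp add: fisher_def partial_deriv_cond_self)

lemma sqrt_integral_fisher_cond_le:
  assumes g: "admissible \<epsilon> M B g" and i: "i \<in> \<Lambda>" and j: "j \<in> \<Lambda>" and "j \<noteq> i"
  shows "sqrt (\<integral>x. fisher j (cond i g) x \<partial>\<mu>)
    \<le> sqrt (\<integral>x. fisher j g x \<partial>\<mu>) + \<kappa> i j / \<sigma> * sqrt (\<integral>x. fisher i g x \<partial>\<mu>)"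
proof -
  note G = admissibleD[OF g]
  obtain B' where g': "admissible \<epsilon> M B' (cond i g)" using admissible_cond[OF g i] by blast
  have c0: "\<kappa> i j / \<sigma> \<ge> 0" using \<kappa>_nonneg \<sigma>_pos by simp
  have cF: "0 \<le> cond i (fisher k g) x" "cond i (fisher k g) x \<le> B\<^sup>2 / \<epsilon>" if "x \<in> configs \<Lambda>" "k \<in> \<Lambda>" for x k
    using cond_bounds[OF i that(1) fisher_props(1)[OF g that(2)] fisher_props(2)[OF g that(2)] fisher_props(3)[OF g that(2)]] by auto
  have iF: "integrable \<mu> (cond i (fisher k g))" if "k \<in> \<Lambda>" for k
    by (rule integrable_bounded_\<mu>[OF cond_measurable[OF i fisher_props(1)[OF g that]], of "B\<^sup>2 / \<epsilon>"])
      (use cF that in auto)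
  have nn: "0 \<le> cond i (fisher k g) x" if "x \<in> space \<mu>" "k \<in> \<Lambda>" for x k
    using cF that by (simp add: space_\<mu>)
  note mink = integral_sqrt_add_square_le[OF iF[OF j] iF[OF i] nn[OF _ j] nn[OF _ i] c0]
  have "(\<integral>x. fisher j (cond i g) x \<partial>\<mu>)
      \<le> (\<integral>x. (sqrt (cond i (fisher j g) x) + \<kappa> i j / \<sigma> * sqrt (cond i (fisher i g) x))\<^sup>2 \<partial>\<mu>)"
  proof (rule integral_mono[OF fisher_props(5)[OF g' j] mink(1)])
    fix x assume "x \<in> space \<mu>"
    then have x: "x \<in> configs \<Lambda>" by (simp add: space_\<mu>)
    have "fisher j (cond i g) x = (sqrt (fisher j (cond i g) x))\<^sup>2"
      using fisher_props(2)[OF g' j x] by simp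
    also have "\<dots> \<le> (sqrt (cond i (fisher j g) x) + \<kappa> i j / \<sigma> * sqrt (cond i (fisher i g) x))\<^sup>2"
      using fisher_props(2)[OF g' j x] by (intro power_mono sqrt_fisher_cond_le[OF g i j \<open>j \<noteq> i\<close> x]) auto
    finally show "fisher j (cond i g) x \<le> (sqrt (cond i (fisher j g) x) + \<kappa> i j / \<sigma> * sqrt (cond i (fisher i g) x))\<^sup>2" .
  qed
  also have "\<dots> \<le> (sqrt (\<integral>x. cond i (fisher j g) x \<partial>\<mu>) + \<kappa> i j / \<sigma> * sqrt (\<integral>x. cond i (fisher i g) x \<partial>\<mu>))\<^sup>2"
    by (rule mink(2))
  also have "\<dots> = (sqrt (\<integral>x. fisher j g x \<partial>\<mu>) + \<kappa> i j / \<sigma> * sqrt (\<integral>x. fisher i g x \<partial>\<mu>))\<^sup>2"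
    using integral_cond[OF i fisher_props(1)[OF g j] fisher_props(4)[OF g j]]
      integral_cond[OF i fisher_props(1)[OF g i] fisher_props(4)[OF g i]] by simp
  finally have "sqrt (\<integral>x. fisher j (cond i g) x \<partial>\<mu>) \<le> sqrt ((sqrt (\<integral>x. fisher j g x \<partial>\<mu>) + \<kappa> i j / \<sigma> * sqrt (\<integral>x. fisher i g x \<partial>\<mu>))\<^sup>2)"
    by (rule real_sqrt_le_mono)
  moreover have "(\<integral>x. fisher k g x \<partial>\<mu>) \<ge> 0" if "k \<in> \<Lambda>" for k
    using fisher_props(2)[OF g that] by (auto intro!: integral_nonneg_AE AE_I2 simp: space_\<mu>)
  then have "0 \<le> sqrt (\<integral>x. fisher j g x \<partial>\<mu>) + \<kappa> i j / \<sigma> * sqrt (\<integral>x. fisher i g x \<partial>\<mu>)"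
    using c0 i j by (intro add_nonneg_nonneg mult_nonneg_nonneg) auto
  ultimately show ?thesis by (simp only: real_sqrt_abs abs_of_nonneg)
qed

text \<open>
  The vectors \<open>s\<close> and \<open>a\<close>, bounds on the supremum norms and on the \<open>L\<^sup>2\<close> norms, evolve by the same recursion. The second
  one pays for the entropy, the first one controls what is left at the end.
\<close>

lemma Ent_sweep:
  assumes "set is \<subseteq> \<Lambda>" "admissible \<epsilon> M B g"
    and "\<And>j x. j \<in> \<Lambda> \<Longrightarrow> x \<in> configs \<Lambda> \<Longrightarrow> sqrt (fisher j g x) \<le> s j"
    and "\<And>j. j \<in> \<Lambda> \<Longrightarrow> sqrt (\<integral>x. fisher j g x \<partial>\<mu>) \<le> a j"
  shows "\<exists>B' g'. admissible \<epsilon> M B' g' \<and>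
    (\<forall>j\<in>\<Lambda>. \<forall>x\<in>configs \<Lambda>. sqrt (fisher j g' x) \<le> fold (relax \<kappa> \<sigma>) is s j) \<and>
    Ent \<mu> g \<le> relax_energy \<kappa> \<sigma> is a / 2 + Ent \<mu> g'"
  using assms
proof (induction "is" arbitrary: B g s a)
  case Nil
  then show ?case by (intro exI[of _ B] exI[of _ g]) auto
next
  case (Cons i "is")
  have i: "i \<in> \<Lambda>" and "is": "set is \<subseteq> \<Lambda>" using Cons.prems(1) by auto
  note g = Cons.prems(2)
  note s = Cons.prems(3) and a = Cons.prems(4)
  obtain B' where g': "admissible \<epsilon> M B' (cond i g)" using admissible_cond[OF g i] by blast
  have s0: "s k \<ge> 0" if "k \<in> \<Lambda>" for k
  proof -
    obtain x where x: "x \<in> configs \<Lambda>" by (rule obtain_config)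
    show ?thesis using s[OF that x] fisher_props(2)[OF g that x] by (meson order_trans real_sqrt_ge_zero)
  qed
  have "sqrt (fisher j (cond i g) x) \<le> relax \<kappa> \<sigma> i s j" if j: "j \<in> \<Lambda>" and x: "x \<in> configs \<Lambda>" for j x
  proof (cases "j = i")
    case True
    then show ?thesis using i by (simp add: fisher_cond_self relax_def)
  next
    case False
    have F: "sqrt (cond i (fisher k g) x) \<le> s k" if k: "k \<in> \<Lambda>" for k
    proof -
      have "fisher k g x \<le> (s k)\<^sup>2" if "x \<in> configs \<Lambda>" for x
        using s[OF k that] by (rule sqrt_le_D)
      then have "cond i (fisher k g) x \<le> (s k)\<^sup>2"
        by (intro cond_bounds(2)[OF i x fisher_props(1)[OF g k] fisher_props(2)[OF g k]])
      then show ?thesis using s0[OF k] by (rule real_le_lsqrt[rotated 1])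
    qed
    have "sqrt (fisher j (cond i g) x) \<le> sqrt (cond i (fisher j g) x) + \<kappa> i j / \<sigma> * sqrt (cond i (fisher i g) x)"
      by (rule sqrt_fisher_cond_le[OF g i j False x])
    also have "\<dots> \<le> s j + \<kappa> i j / \<sigma> * s i"
      using \<kappa>_nonneg \<sigma>_pos by (intro add_mono mult_left_mono F i j) auto
    finally show ?thesis using False by (simp add: relax_def)
  qed
  moreover have "sqrt (\<integral>x. fisher j (cond i g) x \<partial>\<mu>) \<le> relax \<kappa> \<sigma> i a j" if j: "j \<in> \<Lambda>" for j
  proof (cases "j = i")
    case True
    then show ?thesis using i by (simp add: fisher_cond_self relax_def)
  next
    case False
    have "sqrt (\<integral>x. fisher j (cond i g) x \<partial>\<mu>) \<le> sqrt (\<integral>x. fisher j g x \<partial>\<mu>) + \<kappa> i j / \<sigma> * sqrt (\<integral>x. fisher i g x \<partial>\<mu>)"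
      by (rule sqrt_integral_fisher_cond_le[OF g i j False])
    also have "\<dots> \<le> a j + \<kappa> i j / \<sigma> * a i"
      using \<kappa>_nonneg \<sigma>_pos by (intro add_mono mult_left_mono a i j) auto
    finally show ?thesis using False by (simp add: relax_def)
  qed
  ultimately obtain B'' g'' where g'': "admissible \<epsilon> M B'' g''"
    "\<forall>j\<in>\<Lambda>. \<forall>x\<in>configs \<Lambda>. sqrt (fisher j g'' x) \<le> fold (relax \<kappa> \<sigma>) is (relax \<kappa> \<sigma> i s) j"
    "Ent \<mu> (cond i g) \<le> relax_energy \<kappa> \<sigma> is (relax \<kappa> \<sigma> i a) / 2 + Ent \<mu> g''"
    using Cons.IH[OF "is" g', of "relax \<kappa> \<sigma> i s" "relax \<kappa> \<sigma> i a"] by blast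
  have "(\<integral>x. fisher i g x \<partial>\<mu>) \<le> (a i)\<^sup>2" using a[OF i] by (rule sqrt_le_D)
  then have "(\<integral>x. fisher i g x \<partial>\<mu>) / (2 * \<sigma>) \<le> (a i)\<^sup>2 / (2 * \<sigma>)"
    using \<sigma>_pos by (intro divide_right_mono) auto
  then have "Ent \<mu> g \<le> relax_energy \<kappa> \<sigma> (i # is) a / 2 + Ent \<mu> g''"
    using Ent_cond_step[OF g i] g''(3) by (simp add: add_divide_distrib mult.commute)
  then show ?case using g'' by (intro exI[of _ B''] exI[of _ g'']) simp
qed

text \<open>
  The bound makes \<open>g\<close> Lipschitz with constant \<open>\<delta> sqrt M\<close> in every coordinate, so it deviates little from its value at
  the origin in the mean.
\<close>

lemma Ent_le_of_small_fisher:
  assumes g: "admissible \<epsilon> M B g" and "\<delta> \<ge> 0"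
    and small: "\<And>j x. j \<in> \<Lambda> \<Longrightarrow> x \<in> configs \<Lambda> \<Longrightarrow> sqrt (fisher j g x) \<le> \<delta>"
  shows "Ent \<mu> g \<le> \<delta>\<^sup>2 * (M / \<epsilon> * (\<integral>x. (\<Sum>i\<in>\<Lambda>. \<bar>x i\<bar>)\<^sup>2 \<partial>\<mu>))"
proof -
  note G = admissibleD[OF g]
  define x0 where "x0 = (\<lambda>i. if i \<in> \<Lambda> then 0 else undefined :: real)"
  have x0: "x0 \<in> configs \<Lambda>" by (auto simp: x0_def)
  have M0: "M \<ge> 0" using G(6)[OF x0] by linarith
  define L where "L = \<delta> * sqrt M"
  have pd: "\<bar>partial_deriv j g x\<bar> \<le> L" if "j \<in> \<Lambda>" "x \<in> configs \<Lambda>" for j x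
  proof -
    have "\<bar>partial_deriv j g x\<bar> = sqrt (fisher j g x) * sqrt (g x)"
      using G(5)[OF that(2)] by (simp add: fisher_def real_sqrt_divide)
    also have "\<dots> \<le> \<delta> * sqrt M"
      using small[OF that] G(4)[OF that(2)] G(5)[OF that(2)] \<open>\<delta> \<ge> 0\<close> by (intro mult_mono) auto
    finally show ?thesis by (simp add: L_def)
  qed
  \<comment> \<open>Spins are set to \<open>0\<close> one at a time.\<close>
  have lip: "\<bar>g (\<lambda>i. if i \<in> S then 0 else x i) - g x\<bar> \<le> L * (\<Sum>i\<in>S. \<bar>x i\<bar>)"
    if x: "x \<in> configs \<Lambda>" and "S \<subseteq> \<Lambda>" for x S
    using finite_subset[OF \<open>S \<subseteq> \<Lambda>\<close> finite_sites] \<open>S \<subseteq> \<Lambda>\<close>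
  proof (induction S rule: finite_induct)
    case empty
    then show ?case by simp
  next
    case (insert i S)
    let ?y = "\<lambda>k. if k \<in> S then 0 else x k"
    have i: "i \<in> \<Lambda>" using insert.prems by simp
    have y: "?y \<in> configs \<Lambda>" using x insert.prems by (auto simp: PiE_def extensional_def)
    have e0: "(\<lambda>k. if k \<in> insert i S then 0 else x k) = ?y(i := 0)" by (auto simp: fun_eq_iff)
    have e1: "?y = ?y(i := x i)" using insert.hyps(2) by (auto simp: fun_eq_iff)
    have "norm (g (?y(i := 0)) - g (?y(i := x i))) \<le> L * norm (0 - x i)"
    proof (rule field_differentiable_bound[where S=UNIV and f="\<lambda>t. g (?y(i := t))"
          and f'="\<lambda>t. partial_deriv i g (?y(i := t))"])
      show "((\<lambda>t. g (?y(i := t))) has_field_derivative partial_deriv i g (?y(i := t))) (at t within UNIV)" for t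
        by (rule G(7)[OF y i])
      show "norm (partial_deriv i g (?y(i := t))) \<le> L" for t
        unfolding real_norm_def by (rule pd[OF i config_update_mem[OF y i]])
    qed auto
    then have "\<bar>g (?y(i := 0)) - g ?y\<bar> \<le> L * \<bar>x i\<bar>" using e1 by simp
    moreover have "\<bar>g ?y - g x\<bar> \<le> L * (\<Sum>i\<in>S. \<bar>x i\<bar>)" using insert by simp
    ultimately have "\<bar>g (?y(i := 0)) - g x\<bar> \<le> L * \<bar>x i\<bar> + L * (\<Sum>i\<in>S. \<bar>x i\<bar>)" by linarith
    then show ?case unfolding e0 using insert.hyps by (simp add: distrib_left)
  qed
  have lip0: "\<bar>g x - g x0\<bar> \<le> L * (\<Sum>i\<in>\<Lambda>. \<bar>x i\<bar>)" if x: "x \<in> configs \<Lambda>" for x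
  proof -
    have "(\<lambda>i. if i \<in> \<Lambda> then 0 else x i) = x0" using x by (auto simp: fun_eq_iff x0_def)
    then show ?thesis using lip[OF x order_refl] by (simp add: abs_minus_commute)
  qed
  have "Ent \<mu> g \<le> (\<integral>x. (g x - g x0)\<^sup>2 \<partial>\<mu>) / g x0"
    by (rule \<mu>.Ent_le_square_deviation[where \<epsilon>=\<epsilon> and C=M])
      (use G(2) G(3) G(4) G(5)[OF x0] measurable_cong_sets[OF sets_\<mu> refl] G(1) in \<open>auto simp: space_\<mu>\<close>)
  also have "\<dots> \<le> (\<integral>x. L\<^sup>2 * (\<Sum>i\<in>\<Lambda>. \<bar>x i\<bar>)\<^sup>2 \<partial>\<mu>) / g x0"
  proof (intro divide_right_mono integral_mono)
    show "(g x - g x0)\<^sup>2 \<le> L\<^sup>2 * (\<Sum>i\<in>\<Lambda>. \<bar>x i\<bar>)\<^sup>2" if "x \<in> space \<mu>" for x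
    proof -
      have "\<bar>g x - g x0\<bar>\<^sup>2 \<le> (L * (\<Sum>i\<in>\<Lambda>. \<bar>x i\<bar>))\<^sup>2"
        using lip0 that by (intro power_mono) (auto simp: space_\<mu>)
      then show ?thesis by (simp add: power_mult_distrib)
    qed
    have [measurable]: "g \<in> borel_measurable \<nu>" by (rule G(1))
    show "integrable \<mu> (\<lambda>x. (g x - g x0)\<^sup>2)"
    proof (rule integrable_bounded_\<mu>)
      show "\<bar>(g x - g x0)\<^sup>2\<bar> \<le> (2 * M)\<^sup>2" if "x \<in> configs \<Lambda>" for x
        using G(6)[OF that] G(6)[OF x0] power_mono[of "\<bar>g x - g x0\<bar>" "2 * M" 2] by fastforce
    qed measurable
  qed (use integrable_moment_\<mu> G(5)[OF x0] in auto)
  also have "\<dots> \<le> (L\<^sup>2 * (\<integral>x. (\<Sum>i\<in>\<Lambda>. \<bar>x i\<bar>)\<^sup>2 \<partial>\<mu>)) / \<epsilon>"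
    using G(2) G(3)[OF x0] by (simp add: frac_le)
  also have "\<dots> = \<delta>\<^sup>2 * (M / \<epsilon> * (\<integral>x. (\<Sum>i\<in>\<Lambda>. \<bar>x i\<bar>)\<^sup>2 \<partial>\<mu>))"
    using M0 by (simp add: L_def power_mult_distrib)
  finally show ?thesis .
qed

text \<open>
  Sweeping until the remainder is smaller than a given \<open>e\<close>.
\<close>

lemma log_sobolev_admissible:
  assumes g: "admissible \<epsilon> M B g"
  shows "Ent \<mu> g \<le> (\<Sum>i\<in>\<Lambda>. \<integral>x. fisher i g x \<partial>\<mu>) / (2 * \<gamma>)"
proof (rule field_le_epsilon)
  fix e :: real assume e: "e > 0"
  note G = admissibleD[OF g]
  define C where "C = M / \<epsilon> * (\<integral>x. (\<Sum>i\<in>\<Lambda>. \<bar>x i\<bar>)\<^sup>2 \<partial>\<mu>)"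
  define \<delta> where "\<delta> = sqrt (e / (\<bar>C\<bar> + 1))"
  have \<delta>: "\<delta> > 0" using e by (simp add: \<delta>_def)
  have "\<delta>\<^sup>2 * C \<le> \<delta>\<^sup>2 * (\<bar>C\<bar> + 1)" by (intro mult_left_mono) auto
  also have "\<dots> = e" using e by (simp add: \<delta>_def)
  finally have \<delta>C: "\<delta>\<^sup>2 * C \<le> e" .
  \<comment> \<open>The sweep starts from the crude bound that the admissible class provides.\<close>
  define s where "s = (\<lambda>_::'i. sqrt (B\<^sup>2 / \<epsilon>))"
  define a where "a i = sqrt (\<integral>x. fisher i g x \<partial>\<mu>)" for i
  obtain "is" where "is": "set is \<subseteq> \<Lambda>" "\<And>j. j \<in> \<Lambda> \<Longrightarrow> fold (relax \<kappa> \<sigma>) is s j \<le> \<delta>"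
    using relax_exhausts[OF \<delta>, of s] by blast
  have "sqrt (fisher j g x) \<le> s j" if "j \<in> \<Lambda>" "x \<in> configs \<Lambda>" for j x
    unfolding s_def by (intro real_sqrt_le_mono fisher_props(3)[OF g that])
  from Ent_sweep[OF "is"(1) g this, of a] obtain B' g' where g': "admissible \<epsilon> M B' g'"
    "\<forall>j\<in>\<Lambda>. \<forall>x\<in>configs \<Lambda>. sqrt (fisher j g' x) \<le> fold (relax \<kappa> \<sigma>) is s j"
    "Ent \<mu> g \<le> relax_energy \<kappa> \<sigma> is a / 2 + Ent \<mu> g'"
    unfolding a_def by auto
  have "Ent \<mu> g' \<le> \<delta>\<^sup>2 * C" unfolding C_def
    using \<delta> g'(2) "is"(2) by (intro Ent_le_of_small_fisher[OF g'(1)]) (auto intro: order_trans)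
  moreover have "relax_energy \<kappa> \<sigma> is a \<le> (\<Sum>i\<in>\<Lambda>. (a i)\<^sup>2) / \<gamma>" by (rule relax_energy_le[OF "is"(1)])
  moreover have "(\<Sum>i\<in>\<Lambda>. (a i)\<^sup>2) = (\<Sum>i\<in>\<Lambda>. \<integral>x. fisher i g x \<partial>\<mu>)"
    using fisher_props(2)[OF g] unfolding a_def
    by (intro sum.cong refl real_sqrt_pow2 integral_nonneg_AE AE_I2) (auto simp: space_\<mu>)
  ultimately have "Ent \<mu> g \<le> (\<Sum>i\<in>\<Lambda>. \<integral>x. fisher i g x \<partial>\<mu>) / \<gamma> / 2 + e"
    using g'(3) \<delta>C by simp
  then show "Ent \<mu> g \<le> (\<Sum>i\<in>\<Lambda>. \<integral>x. fisher i g x \<partial>\<mu>) / (2 * \<gamma>) + e"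
    by (simp add: mult.commute)
qed

text \<open>
  The square of \<open>f\<close> may vanish, so the inequality is applied to \<open>f\<^sup>2 + 1 / (n + 1)\<close>. Since
  \<open>(\<partial>\<^sub>i (f\<^sup>2))\<^sup>2 / (f\<^sup>2 + 1 / (n + 1)) \<le> 4 (\<partial>\<^sub>i f)\<^sup>2\<close>, the Fisher information stays bounded.
\<close>

lemma log_sobolev_bounded:
  assumes f[measurable]: "f \<in> borel_measurable \<nu>" and fb: "\<And>x. x \<in> configs \<Lambda> \<Longrightarrow> \<bar>f x\<bar> \<le> F"
    and d: "\<And>x i. x \<in> configs \<Lambda> \<Longrightarrow> i \<in> \<Lambda> \<Longrightarrow>
      ((\<lambda>t. f (x(i := t))) has_real_derivative partial_deriv i f x) (at (x i))"
    and db: "\<And>x i. x \<in> configs \<Lambda> \<Longrightarrow> i \<in> \<Lambda> \<Longrightarrow> \<bar>partial_deriv i f x\<bar> \<le> B"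
  shows "\<gamma> * Ent \<mu> (\<lambda>x. (f x)\<^sup>2) \<le> 2 * dirichlet_form \<Lambda> potential f"
proof -
  define D where "D = dirichlet_form \<Lambda> potential f"
  have dm: "partial_deriv i f \<in> borel_measurable \<nu>" if "i \<in> \<Lambda>" for i
    by (rule partial_deriv_measurable[OF that f d[OF _ that]])
  have id: "integrable \<mu> (\<lambda>x. (partial_deriv i f x)\<^sup>2)" if i: "i \<in> \<Lambda>" for i
  proof (rule integrable_bounded_\<mu>)
    show "(\<lambda>x. (partial_deriv i f x)\<^sup>2) \<in> borel_measurable \<nu>" using dm[OF i] by measurable
    show "\<bar>(partial_deriv i f x)\<^sup>2\<bar> \<le> B\<^sup>2" if "x \<in> configs \<Lambda>" for x
      using power_mono[OF db[OF that i], of 2] by simp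
  qed
  have D: "D = (\<Sum>i\<in>\<Lambda>. \<integral>x. (partial_deriv i f x)\<^sup>2 \<partial>\<mu>)"
    unfolding D_def dirichlet_form_def using id by (intro Bochner_Integration.integral_sum) auto
  obtain z where z: "z \<in> configs \<Lambda>" by (rule obtain_config)
  have F0: "F \<ge> 0" using fb[OF z] by linarith
  have f2: "(f x)\<^sup>2 \<le> F\<^sup>2" if "x \<in> configs \<Lambda>" for x
    using power_mono[OF fb[OF that], of 2] by simp
  define g where "g n x = (f x)\<^sup>2 + 1 / (real n + 1)" for n :: nat and x
  have e: "1 / (real n + 1) > 0" "1 / (real n + 1) \<le> 1" for n :: nat by (auto simp: divide_simps)
  have g': "((\<lambda>t. g n (x(i := t))) has_real_derivative 2 * f x * partial_deriv i f x) (at (x i))"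
    if "x \<in> configs \<Lambda>" "i \<in> \<Lambda>" for n x i
    unfolding g_def using d[OF that] by (auto intro!: derivative_eq_intros)
  then have pg: "partial_deriv i (g n) x = 2 * f x * partial_deriv i f x"
    if "x \<in> configs \<Lambda>" "i \<in> \<Lambda>" for n x i
    using that by (auto simp: partial_deriv_def[of i "g n"] intro!: DERIV_imp_deriv)
  have adm: "admissible (1 / (real n + 1)) (F\<^sup>2 + 1) (2 * F * B) (g n)" for n
    unfolding admissible_def
  proof (intro conjI ballI)
    show "g n \<in> borel_measurable \<nu>" unfolding g_def[abs_def] by measurable
    show "\<bar>partial_deriv i (g n) x\<bar> \<le> 2 * F * B" if "x \<in> configs \<Lambda>" "i \<in> \<Lambda>" for x i
      unfolding pg[OF that] using fb[OF that(1)] db[OF that] F0 by (auto simp: abs_mult intro!: mult_mono)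
  qed (use e f2 g' pg in \<open>auto simp: g_def intro!: add_mono\<close>)
  have fish: "fisher i (g n) x \<le> 4 * (partial_deriv i f x)\<^sup>2" if "x \<in> configs \<Lambda>" "i \<in> \<Lambda>" for n x i
  proof -
    have "g n x > 0" using e[of n] by (simp add: g_def add_nonneg_pos)
    have "fisher i (g n) x = (f x)\<^sup>2 / g n x * (4 * (partial_deriv i f x)\<^sup>2)"
      by (simp add: fisher_def pg[OF that] power_mult_distrib)
    also have "\<dots> \<le> 1 * (4 * (partial_deriv i f x)\<^sup>2)"
      using \<open>g n x > 0\<close> e[of n] by (intro mult_right_mono) (auto simp: g_def)
    finally show ?thesis by simp
  qed
  have bound: "\<gamma> * Ent \<mu> (g n) \<le> 2 * D" for n
  proof -
    have "Ent \<mu> (g n) \<le> (\<Sum>i\<in>\<Lambda>. \<integral>x. fisher i (g n) x \<partial>\<mu>) / (2 * \<gamma>)"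
      by (rule log_sobolev_admissible[OF adm])
    also have "\<dots> \<le> (\<Sum>i\<in>\<Lambda>. \<integral>x. 4 * (partial_deriv i f x)\<^sup>2 \<partial>\<mu>) / (2 * \<gamma>)"
      using \<gamma>_positive fish id fisher_props(5)[OF adm]
      by (intro divide_right_mono sum_mono integral_mono) (auto simp: space_\<mu>)
    also have "\<dots> = 2 * D / \<gamma>" by (simp add: D flip: sum_distrib_left)
    finally show ?thesis using \<gamma>_positive by (simp add: field_simps)
  qed
  have "(\<lambda>n. Ent \<mu> (g n)) \<longlonglongrightarrow> Ent \<mu> (\<lambda>x. (f x)\<^sup>2)"
  proof (rule \<mu>.Ent_tendsto[where C="F\<^sup>2 + 1"])
    show "g n \<in> borel_measurable \<mu>" "(\<lambda>x. (f x)\<^sup>2) \<in> borel_measurable \<mu>" for n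
      unfolding g_def[abs_def] by measurable
    show "(\<lambda>n. g n x) \<longlonglongrightarrow> (f x)\<^sup>2" for x
    proof -
      have "(\<lambda>n. 1 / (real n + 1)) \<longlonglongrightarrow> 0" by real_asymp
      from tendsto_add[OF tendsto_const[of "(f x)\<^sup>2"] this] show ?thesis by (simp add: g_def)
    qed
    show "g n x \<le> F\<^sup>2 + 1" if "x \<in> space \<mu>" for n x
      using f2 e[of n] that by (auto simp: g_def space_\<mu> intro!: add_mono)
  qed (auto simp: g_def)
  from tendsto_mult_left[OF this, of \<gamma>] show ?thesis
    unfolding D_def[symmetric] by (rule LIMSEQ_le_const2) (use bound in auto)
qed

end

section \<open>Smooth functions with compact support\<close>

lemma partial_deriv_cong:
  assumes "\<And>x. x \<in> configs \<Lambda> \<Longrightarrow> f x = g x" "i \<in> \<Lambda>" "x \<in> configs \<Lambda>"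
  shows "partial_deriv i f x = partial_deriv i g x"
proof -
  have "(\<lambda>t. f (x(i := t))) = (\<lambda>t. g (x(i := t)))"
    using assms config_update_mem by metis
  then show ?thesis by (simp add: partial_deriv_def)
qed

lemma Ck_cong:
  "(\<And>x. x \<in> configs \<Lambda> \<Longrightarrow> f x = g x) \<Longrightarrow> Ck_on_configs k \<Lambda> f \<Longrightarrow> Ck_on_configs k \<Lambda> g"
proof (induction k arbitrary: f g)
  case 0
  then show ?case by (simp cong: continuous_on_cong)
next
  case (Suc k)
  show ?case unfolding Ck_on_configs.simps
  proof (intro conjI ballI)
    show "continuous_on (configs \<Lambda>) g" using Suc.prems by (simp cong: continuous_on_cong)
    fix i assume i: "i \<in> \<Lambda>"
    show "(\<lambda>t. g (x(i := t))) differentiable at (x i)" if "x \<in> configs \<Lambda>" for x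
    proof -
      have "(\<lambda>t. f (x(i := t))) = (\<lambda>t. g (x(i := t)))"
        using Suc.prems(1) config_update_mem[OF that i] by auto
      moreover have "(\<lambda>t. f (x(i := t))) differentiable at (x i)"
        using Suc.prems(2) i that unfolding Ck_on_configs.simps by blast
      ultimately show ?thesis by (simp only:)
    qed
    show "Ck_on_configs k \<Lambda> (partial_deriv i g)"
      using Suc.prems(2) i by (intro Suc.IH[OF partial_deriv_cong[OF Suc.prems(1) i]]) auto
  qed
qed

lemma Ck_Suc_imp: "Ck_on_configs (Suc k) \<Lambda> f \<Longrightarrow> Ck_on_configs k \<Lambda> f"
  by (induction k arbitrary: f) auto

lemma Ck_has_partial_deriv:
  assumes "Ck_on_configs (Suc k) \<Lambda> f" "x \<in> configs \<Lambda>" "i \<in> \<Lambda>"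
  shows "((\<lambda>t. f (x(i := t))) has_real_derivative partial_deriv i f x) (at (x i))"
proof -
  have "(\<lambda>t. f (x(i := t))) differentiable at (x i)"
    using assms unfolding Ck_on_configs.simps by blast
  then obtain D where "((\<lambda>t. f (x(i := t))) has_real_derivative D) (at (x i))"
    by (auto simp: real_differentiable_def)
  then show ?thesis using DERIV_imp_deriv[of _ D "x i"] unfolding partial_deriv_def by simp
qed

text \<open>
  A version in which the partial derivatives are given by a formula that holds on configurations only.
\<close>

lemma CkI:
  assumes "continuous_on (configs \<Lambda>) f"
    and d: "\<And>x i. x \<in> configs \<Lambda> \<Longrightarrow> i \<in> \<Lambda> \<Longrightarrow> ((\<lambda>t. f (x(i := t))) has_real_derivative f' i x) (at (x i))"
    and f': "\<And>i. i \<in> \<Lambda> \<Longrightarrow> Ck_on_configs k \<Lambda> (f' i)"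
  shows "Ck_on_configs (Suc k) \<Lambda> f"
  unfolding Ck_on_configs.simps
proof (intro conjI ballI)
  fix i assume i: "i \<in> \<Lambda>"
  show "(\<lambda>t. f (x(i := t))) differentiable at (x i)" if "x \<in> configs \<Lambda>" for x
    using d[OF that i] by (auto simp: real_differentiable_def)
  show "Ck_on_configs k \<Lambda> (partial_deriv i f)"
    using DERIV_imp_deriv[OF d[OF _ i]] by (intro Ck_cong[OF _ f'[OF i]]) (simp add: partial_deriv_def)
qed (rule assms)

lemma Ck_continuous: "Ck_on_configs k \<Lambda> f \<Longrightarrow> continuous_on (configs \<Lambda>) f"
  by (cases k) auto

lemma Ck_const: "Ck_on_configs k \<Lambda> (\<lambda>_. c)"
  by (induction k arbitrary: c) (auto intro!: CkI[where f'="\<lambda>_ _. 0"] continuous_intros simp del: Ck_on_configs.simps(2))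

lemma Ck_add: "Ck_on_configs k \<Lambda> f \<Longrightarrow> Ck_on_configs k \<Lambda> g \<Longrightarrow> Ck_on_configs k \<Lambda> (\<lambda>x. f x + g x)"
proof (induction k arbitrary: f g)
  case 0
  then show ?case by (simp add: continuous_on_add)
next
  case (Suc k)
  show ?case
  proof (rule CkI[where f'="\<lambda>i x. partial_deriv i f x + partial_deriv i g x"])
    show "continuous_on (configs \<Lambda>) (\<lambda>x. f x + g x)"
      using Suc.prems by (intro continuous_on_add Ck_continuous)
    show "((\<lambda>t. f (x(i := t)) + g (x(i := t))) has_real_derivative partial_deriv i f x + partial_deriv i g x) (at (x i))"
      if "x \<in> configs \<Lambda>" "i \<in> \<Lambda>" for x i
      by (rule DERIV_add[OF Ck_has_partial_deriv[OF Suc.prems(1) that] Ck_has_partial_deriv[OF Suc.prems(2) that]])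
  qed (use Suc in auto)
qed

lemma Ck_mult: "Ck_on_configs k \<Lambda> f \<Longrightarrow> Ck_on_configs k \<Lambda> g \<Longrightarrow> Ck_on_configs k \<Lambda> (\<lambda>x. f x * g x)"
proof (induction k arbitrary: f g)
  case 0
  then show ?case by (simp add: continuous_on_mult)
next
  case (Suc k)
  show ?case
  proof (rule CkI[where f'="\<lambda>i x. partial_deriv i f x * g x + partial_deriv i g x * f x"])
    show "continuous_on (configs \<Lambda>) (\<lambda>x. f x * g x)"
      using Suc.prems by (intro continuous_on_mult Ck_continuous)
    show "((\<lambda>t. f (x(i := t)) * g (x(i := t))) has_real_derivative partial_deriv i f x * g x + partial_deriv i g x * f x) (at (x i))"
      if "x \<in> configs \<Lambda>" "i \<in> \<Lambda>" for x i
      using DERIV_mult[OF Ck_has_partial_deriv[OF Suc.prems(1) that] Ck_has_partial_deriv[OF Suc.prems(2) that]]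
      by (simp only: fun_upd_triv)
    show "Ck_on_configs k \<Lambda> (\<lambda>x. partial_deriv i f x * g x + partial_deriv i g x * f x)" if "i \<in> \<Lambda>" for i
    proof -
      have "Ck_on_configs k \<Lambda> (partial_deriv i f)" "Ck_on_configs k \<Lambda> (partial_deriv i g)"
        using Suc.prems that unfolding Ck_on_configs.simps by blast+
      then show ?thesis
        by (intro Ck_add Suc.IH Ck_Suc_imp[OF Suc.prems(1)] Ck_Suc_imp[OF Suc.prems(2)])
    qed
  qed
qed

lemma Ck_prod: 
  assumes "finite I" "\<And>j. j \<in> I \<Longrightarrow> Ck_on_configs k \<Lambda> (f j)"
  shows "Ck_on_configs k \<Lambda> (\<lambda>x. \<Prod>j\<in>I. f j x)"
  using assms by (induction I rule: finite_induct) (auto intro!: Ck_const Ck_mult)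

text \<open>
  The family \<open>p (1 / s) e\<^bsup>- 1 / s\<^esup>\<close>, extended by \<open>0\<close>, contains the classical flat function and is closed under
  differentiation, so smoothness of all its members follows by one induction.
\<close>

definition flat :: "real poly \<Rightarrow> real \<Rightarrow> real" where
  "flat p s = (if s > 0 then poly p (1 / s) * exp (- 1 / s) else 0)"

definition flat_deriv :: "real poly \<Rightarrow> real poly" where
  "flat_deriv p = [:0, 0, 1:] * (p - pderiv p)"

lemma power_poly_div_exp_tendsto_0: "((\<lambda>x. x ^ k * poly p x / exp x) \<longlongrightarrow> (0::real)) at_top"
proof (induction p arbitrary: k)
  case 0
  show ?case by simp
next
  case (pCons a p)
  have "((\<lambda>x. a * (x ^ k / exp x) + x ^ Suc k * poly p x / exp x) \<longlongrightarrow> a * 0 + 0) at_top"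
    by (intro tendsto_intros tendsto_power_div_exp_0 pCons)
  then show ?case by (simp add: algebra_simps add_divide_distrib)
qed

lemma flat_tendsto_0: "(flat p \<longlongrightarrow> 0) (at 0)"
proof -
  have "((\<lambda>s::real. poly p (inverse s) / exp (inverse s)) \<longlongrightarrow> 0) (at_right 0)"
    using filterlim_compose[OF power_poly_div_exp_tendsto_0[of 0 p] filterlim_inverse_at_top_right] by simp
  then have "(flat p \<longlongrightarrow> 0) (at_right 0)"
    by (rule Lim_transform_eventually)
      (auto simp: flat_def eventually_at_right_less exp_minus divide_inverse intro!: eventually_mono[OF eventually_at_right_less])
  moreover have "(flat p \<longlongrightarrow> 0) (at_left 0)"
    by (rule tendsto_eventually) (auto simp: flat_def eventually_at_left_field intro: exI[of _ "-1"])
  ultimately show ?thesis by (simp add: filterlim_split_at)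
qed

lemma flat_has_derivative: "(flat p has_real_derivative flat (flat_deriv p) s) (at s)"
proof (cases s "0::real" rule: linorder_cases)
  case less
  have "((\<lambda>_. 0) has_real_derivative flat (flat_deriv p) s) (at s)" using less by (simp add: flat_def)
  then show ?thesis
    by (rule has_field_derivative_transform_within_open[where S="{..<0}"]) (use less in \<open>auto simp: flat_def\<close>)
next
  case greater
  have "((\<lambda>s. poly p (1 / s) * exp (- 1 / s)) has_real_derivative
     poly p (1 / s) * (exp (- 1 / s) * (1 / s\<^sup>2)) + poly (pderiv p) (1 / s) * (- 1 / s\<^sup>2) * exp (- 1 / s)) (at s)"
    using greater by (auto intro!: derivative_eq_intros simp: power2_eq_square)
  also have "poly p (1 / s) * (exp (- 1 / s) * (1 / s\<^sup>2)) + poly (pderiv p) (1 / s) * (- 1 / s\<^sup>2) * exp (- 1 / s)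
     = flat (flat_deriv p) s"
    using greater by (simp add: flat_def flat_deriv_def power2_eq_square field_simps)
  finally show ?thesis
    by (rule has_field_derivative_transform_within_open[where S="{0<..}"]) (use greater in \<open>auto simp: flat_def\<close>)
next
  case equal
  have "flat p h / h = flat (pCons 0 p) h" for h
    by (simp add: flat_def)
  then have "((\<lambda>h. flat p h / h) \<longlongrightarrow> 0) (at 0)"
    using flat_tendsto_0[of "pCons 0 p"] by simp
  then show ?thesis using equal by (simp add: DERIV_def flat_def)
qed

lemma flat_continuous: "continuous_on S (flat p)"
  using flat_has_derivative by (meson DERIV_continuous_on has_field_derivative_at_within)

lemma Ck_flat:
  "i \<in> \<Lambda> \<Longrightarrow> Ck_on_configs k \<Lambda> (\<lambda>x. flat p (a + b * x i))"
proof (induction k arbitrary: p)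
  case 0
  have "continuous_on UNIV (\<lambda>x::'a \<Rightarrow> real. a + b * x i)"
    by (intro continuous_intros continuous_on_product_coordinates)
  then show ?case
    by (auto intro!: continuous_on_compose2[OF flat_continuous[of UNIV]] elim: continuous_on_subset)
next
  case (Suc k)
  show ?case
  proof (rule CkI[where f'="\<lambda>j x. (if j = i then b else 0) * flat (flat_deriv p) (a + b * x i)"])
    have "continuous_on UNIV (\<lambda>x::'a \<Rightarrow> real. a + b * x i)"
      by (intro continuous_intros continuous_on_product_coordinates)
    then show "continuous_on (configs \<Lambda>) (\<lambda>x. flat p (a + b * x i))"
      by (auto intro!: continuous_on_compose2[OF flat_continuous[of UNIV]] elim: continuous_on_subset)
    show "((\<lambda>t. flat p (a + b * (x(j := t)) i)) has_real_derivative
       (if j = i then b else 0) * flat (flat_deriv p) (a + b * x i)) (at (x j))" for x j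
    proof (cases "j = i")
      case True
      have "((\<lambda>t. a + b * t) has_real_derivative b) (at (x i))" by (auto intro!: derivative_eq_intros)
      from DERIV_chain2[OF flat_has_derivative this] show ?thesis using True by (simp add: mult.commute)
    qed simp
    show "Ck_on_configs k \<Lambda> (\<lambda>x. (if j = i then b else 0) * flat (flat_deriv p) (a + b * x i))" for j
      by (intro Ck_mult Ck_const Suc)
  qed
qed

text \<open>
  A continuous function with compact support is bounded, and so are its partial derivatives, which
  vanish off the support because its complement is open.
\<close>

lemma smooth_compact_supportD:
  assumes fin: "finite \<Lambda>" and f: "f \<in> smooth_compact_support \<Lambda>"
  shows "f \<in> borel_measurable (\<Pi>\<^sub>M i\<in>\<Lambda>. lborel)"
    and "\<And>x i. x \<in> configs \<Lambda> \<Longrightarrow> i \<in> \<Lambda> \<Longrightarrow>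
      ((\<lambda>t. f (x(i := t))) has_real_derivative partial_deriv i f x) (at (x i))"
    and "\<exists>F. \<forall>x\<in>configs \<Lambda>. \<bar>f x\<bar> \<le> F \<and> (\<forall>i\<in>\<Lambda>. \<bar>partial_deriv i f x\<bar> \<le> F)"
proof -
  have Ck: "Ck_on_configs k \<Lambda> f" for k using f by (simp add: smooth_compact_support_def)
  define K where "K = closure {x \<in> configs \<Lambda>. f x \<noteq> 0}"
  have K: "compact K" using f by (simp add: smooth_compact_support_def K_def)
  have cf: "continuous_on (configs \<Lambda>) f" by (rule Ck_continuous[OF Ck])
  show "f \<in> borel_measurable (\<Pi>\<^sub>M i\<in>\<Lambda>. lborel)"
    by (rule continuous_on_configs_measurable[OF fin cf])
  show "((\<lambda>t. f (x(i := t))) has_real_derivative partial_deriv i f x) (at (x i))"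
    if "x \<in> configs \<Lambda>" "i \<in> \<Lambda>" for x i
    by (rule Ck_has_partial_deriv[OF Ck that])
  have KL: "K \<subseteq> configs \<Lambda>"
    unfolding K_def by (rule closure_minimal) (auto intro: closed_PiE_real)
  have out: "f x = 0" if "x \<in> configs \<Lambda>" "x \<notin> K" for x
    using that closure_subset[of "{x \<in> configs \<Lambda>. f x \<noteq> 0}"] by (auto simp: K_def)
  have outd: "partial_deriv i f x = 0" if x: "x \<in> configs \<Lambda>" "x \<notin> K" and i: "i \<in> \<Lambda>" for x i
  proof -
    have "open (- K)" by (simp add: K_def open_Compl)
    then have o: "open ((\<lambda>t. x(i := t)) -` (- K))"
      using config_update_continuous[of x i] by (rule open_vimage)
    have "((\<lambda>_. 0) has_real_derivative 0) (at (x i))" by simp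
    then have "((\<lambda>t. f (x(i := t))) has_real_derivative 0) (at (x i))"
    proof (rule has_field_derivative_transform_within_open[OF _ o])
      show "x i \<in> (\<lambda>t. x(i := t)) -` (- K)" using x by simp
      show "0 = f (x(i := t))" if "t \<in> (\<lambda>t. x(i := t)) -` (- K)" for t
        using out[of "x(i := t)"] that config_update_mem[OF x(1) i] by simp
    qed
    then show ?thesis unfolding partial_deriv_def by (rule DERIV_imp_deriv)
  qed
  have bd: "\<exists>C. \<forall>x\<in>K. \<bar>g x\<bar> \<le> C" if "continuous_on (configs \<Lambda>) g" for g :: "('a \<Rightarrow> real) \<Rightarrow> real"
  proof -
    have "compact (g ` K)" by (rule compact_continuous_image[OF continuous_on_subset[OF that KL] K])
    then show ?thesis using compact_imp_bounded bounded_iff by (metis imageI real_norm_def)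
  qed
  obtain C0 where C0: "\<And>x. x \<in> K \<Longrightarrow> \<bar>f x\<bar> \<le> C0" using bd[OF cf] by blast
  have "\<exists>C. \<forall>x\<in>K. \<bar>partial_deriv i f x\<bar> \<le> C" if "i \<in> \<Lambda>" for i
  proof (rule bd)
    have "Ck_on_configs 0 \<Lambda> (partial_deriv i f)" using Ck[of "Suc 0"] that unfolding Ck_on_configs.simps by blast
    then show "continuous_on (configs \<Lambda>) (partial_deriv i f)" by simp
  qed
  then obtain C where C: "\<And>i x. i \<in> \<Lambda> \<Longrightarrow> x \<in> K \<Longrightarrow> \<bar>partial_deriv i f x\<bar> \<le> C i" by metis
  define F where "F = \<bar>C0\<bar> + (\<Sum>i\<in>\<Lambda>. \<bar>C i\<bar>)"
  have s0: "(\<Sum>i\<in>\<Lambda>. \<bar>C i\<bar>) \<ge> 0" by (rule sum_nonneg) simp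
  show "\<exists>F. \<forall>x\<in>configs \<Lambda>. \<bar>f x\<bar> \<le> F \<and> (\<forall>i\<in>\<Lambda>. \<bar>partial_deriv i f x\<bar> \<le> F)"
  proof (intro exI[of _ F] ballI conjI)
    fix x assume x: "x \<in> configs \<Lambda>"
    show "\<bar>f x\<bar> \<le> F"
    proof (cases "x \<in> K")
      case True
      show ?thesis using C0[OF True] s0 unfolding F_def by linarith
    next
      case False
      show ?thesis using out[OF x False] s0 by (simp add: F_def)
    qed
    show "\<bar>partial_deriv i f x\<bar> \<le> F" if i: "i \<in> \<Lambda>" for i
    proof (cases "x \<in> K")
      case True
      have "\<bar>C i\<bar> \<le> (\<Sum>i\<in>\<Lambda>. \<bar>C i\<bar>)" using fin i by (intro member_le_sum) auto
      then show ?thesis using C[OF i True] by (simp add: F_def)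
    next
      case False
      then show ?thesis using outd[OF x False i] s0 by (simp add: F_def)
    qed
  qed
qed

text \<open>
  The factor \<open>exp 2\<close> normalises the value at \<open>0\<close> to \<open>1\<close>.
\<close>

definition bump :: "real \<Rightarrow> real" where
  "bump t = exp 2 * flat 1 (1 - t) * flat 1 (1 + t)"

definition bump_deriv :: "real \<Rightarrow> real" where
  "bump_deriv t = exp 2 * (flat 1 (1 - t) * flat (flat_deriv 1) (1 + t) - flat (flat_deriv 1) (1 - t) * flat 1 (1 + t))"

lemma bump_0: "bump 0 = 1"
  by (simp add: bump_def flat_def flip: exp_add)

lemma bump_outside: "\<bar>t\<bar> \<ge> 1 \<Longrightarrow> bump t = 0" "\<bar>t\<bar> \<ge> 1 \<Longrightarrow> bump_deriv t = 0"
  by (auto simp: bump_def bump_deriv_def flat_def abs_if split: if_splits)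

lemma bump_has_derivative: "(bump has_real_derivative bump_deriv t) (at t)"
proof -
  have 1: "((\<lambda>t. 1 - t) has_real_derivative - 1) (at t)" "((\<lambda>t. 1 + t) has_real_derivative 1) (at t)"
    by (auto intro!: derivative_eq_intros)
  note d = DERIV_chain2[OF flat_has_derivative 1(1)] DERIV_chain2[OF flat_has_derivative 1(2)]
  show ?thesis unfolding bump_def[abs_def]
    by (rule DERIV_cong[OF DERIV_mult[OF DERIV_cmult[OF d(1)] d(2)]]) (simp add: bump_deriv_def algebra_simps)
qed

lemma bump_bounded: "\<exists>C\<ge>1. \<forall>t. \<bar>bump t\<bar> \<le> C \<and> \<bar>bump_deriv t\<bar> \<le> C"
proof -
  have c: "continuous_on {-1..1} bump" "continuous_on {-1..1} bump_deriv"
    unfolding bump_def[abs_def] bump_deriv_def[abs_def]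
    by (intro continuous_intros continuous_on_compose2[OF flat_continuous[of UNIV]]; simp)+
  have "bounded (bump ` {-1..1})" "bounded (bump_deriv ` {-1..1})"
    using c by (auto intro!: compact_imp_bounded compact_continuous_image)
  then obtain C D where CD: "\<And>t. t \<in> {-1..1} \<Longrightarrow> \<bar>bump t\<bar> \<le> C" "\<And>t. t \<in> {-1..1} \<Longrightarrow> \<bar>bump_deriv t\<bar> \<le> D"
    unfolding bounded_iff by (metis imageI real_norm_def)
  show ?thesis
  proof (intro exI[of _ "1 + \<bar>C\<bar> + \<bar>D\<bar>"] conjI allI)
    fix t :: real
    show "\<bar>bump t\<bar> \<le> 1 + \<bar>C\<bar> + \<bar>D\<bar>"
    proof (cases "\<bar>t\<bar> \<ge> 1")
      case False
      then show ?thesis using CD(1)[of t] by (simp add: abs_le_iff) linarith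
    qed (simp add: bump_outside)
    show "\<bar>bump_deriv t\<bar> \<le> 1 + \<bar>C\<bar> + \<bar>D\<bar>"
    proof (cases "\<bar>t\<bar> \<ge> 1")
      case False
      then show ?thesis using CD(2)[of t] by (simp add: abs_le_iff) linarith
    qed (simp add: bump_outside)
  qed simp
qed

definition cutoff :: "'i set \<Rightarrow> nat \<Rightarrow> ('i \<Rightarrow> real) \<Rightarrow> real" where
  "cutoff \<Lambda> n x = (\<Prod>i\<in>\<Lambda>. bump (x i / real (Suc n)))"

lemma Ck_cutoff:
  assumes "finite \<Lambda>"
  shows "Ck_on_configs k \<Lambda> (cutoff \<Lambda> n)"
proof -
  have "Ck_on_configs k \<Lambda> (\<lambda>x. bump (x i / real (Suc n)))" if i: "i \<in> \<Lambda>" for i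
  proof -
    have "Ck_on_configs k \<Lambda> (\<lambda>x. (exp 2 * flat 1 (1 + (- 1 / real (Suc n)) * x i)) * flat 1 (1 + (1 / real (Suc n)) * x i))"
      by (intro Ck_mult Ck_const Ck_flat i)
    then show ?thesis by (rule Ck_cong[rotated]) (simp add: bump_def)
  qed
  then show ?thesis unfolding cutoff_def[abs_def] by (intro Ck_prod assms)
qed

lemma cutoff_mult_smooth_compact_support:
  assumes fin: "finite \<Lambda>" and h: "\<And>k. Ck_on_configs k \<Lambda> h"
  shows "(\<lambda>x. cutoff \<Lambda> n x * h x) \<in> smooth_compact_support \<Lambda>"
  unfolding smooth_compact_support_def
proof (intro CollectI conjI allI)
  show "Ck_on_configs k \<Lambda> (\<lambda>x. cutoff \<Lambda> n x * h x)" for k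
    by (intro Ck_mult Ck_cutoff fin h)
  let ?S = "{x \<in> configs \<Lambda>. cutoff \<Lambda> n x * h x \<noteq> 0}"
  let ?B = "Pi\<^sub>E \<Lambda> (\<lambda>_. {- real (Suc n)..real (Suc n)})"
  have B: "compact ?B" "closed ?B"
    by (intro compact_PiE_real closed_PiE_real; simp)+
  have "?S \<subseteq> ?B"
  proof
    fix x assume x: "x \<in> ?S"
    have "x i \<in> {- real (Suc n)..real (Suc n)}" if i: "i \<in> \<Lambda>" for i
    proof (rule ccontr)
      assume "x i \<notin> {- real (Suc n)..real (Suc n)}"
      then have "\<bar>x i / real (Suc n)\<bar> \<ge> 1" by (auto simp: abs_if field_simps split: if_splits)
      then have "cutoff \<Lambda> n x = 0" unfolding cutoff_def using fin i bump_outside(1) by (simp only: prod_zero_iff) blast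
      then show False using x by simp
    qed
    then show "x \<in> ?B" using x by (auto simp: PiE_def)
  qed
  then have "closure ?S \<subseteq> ?B" using B(2) by (rule closure_minimal)
  then have "closure ?S = ?B \<inter> closure ?S" by blast
  then show "compact (closure ?S)" using compact_Int_closed[OF B(1) closed_closure[of ?S]] by simp
qed

lemma cutoff_has_derivative:
  assumes fin: "finite \<Lambda>" and i: "i \<in> \<Lambda>"
  shows "((\<lambda>t. cutoff \<Lambda> n (x(i := t))) has_real_derivative
    (bump_deriv (x i / real (Suc n)) / real (Suc n)) * (\<Prod>j\<in>\<Lambda> - {i}. bump (x j / real (Suc n)))) (at (x i))"
proof -
  have eq: "cutoff \<Lambda> n (x(i := t)) = bump (t / real (Suc n)) * (\<Prod>j\<in>\<Lambda> - {i}. bump (x j / real (Suc n)))" for t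
    unfolding cutoff_def by (subst prod.remove[OF fin i]) (auto intro!: prod.cong)
  have "((\<lambda>t. t / real (Suc n)) has_real_derivative 1 / real (Suc n)) (at (x i))"
    by (auto intro!: derivative_eq_intros simp del: of_nat_Suc)
  from DERIV_cmult_right[OF DERIV_chain2[OF bump_has_derivative this]] show ?thesis
    unfolding eq by (simp del: of_nat_Suc)
qed

lemma cutoff_bounds:
  assumes fin: "finite \<Lambda>"
  shows "\<exists>K. \<forall>n x. \<bar>cutoff \<Lambda> n x\<bar> \<le> K \<and> (\<forall>i\<in>\<Lambda>. \<bar>partial_deriv i (cutoff \<Lambda> n) x\<bar> \<le> K / real (Suc n))"
proof -
  obtain C where C: "C \<ge> 1" "\<And>t. \<bar>bump t\<bar> \<le> C" "\<And>t. \<bar>bump_deriv t\<bar> \<le> C" using bump_bounded by blast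
  have p: "\<bar>\<Prod>j\<in>S. bump (y j)\<bar> \<le> C ^ card S" for S :: "'a set" and y
    unfolding abs_prod using C(2) by (intro prod_le_power) (use C(1) in auto)
  show ?thesis
  proof (intro exI[of _ "C ^ card \<Lambda>"] allI conjI ballI)
    fix n and x :: "'a \<Rightarrow> real"
    show "\<bar>cutoff \<Lambda> n x\<bar> \<le> C ^ card \<Lambda>" unfolding cutoff_def by (rule p)
    fix i assume i: "i \<in> \<Lambda>"
    have "\<bar>partial_deriv i (cutoff \<Lambda> n) x\<bar> = \<bar>bump_deriv (x i / real (Suc n))\<bar> * \<bar>\<Prod>j\<in>\<Lambda> - {i}. bump (x j / real (Suc n))\<bar> / real (Suc n)"
      unfolding partial_deriv_def DERIV_imp_deriv[OF cutoff_has_derivative[OF fin i]]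
      by (simp add: abs_mult del: of_nat_Suc)
    also have "\<dots> \<le> C * C ^ card (\<Lambda> - {i}) / real (Suc n)"
      using C by (intro divide_right_mono mult_mono p) auto
    also have "C * C ^ card (\<Lambda> - {i}) = C ^ card \<Lambda>"
      using card.remove[OF fin i] by simp
    finally show "\<bar>partial_deriv i (cutoff \<Lambda> n) x\<bar> \<le> C ^ card \<Lambda> / real (Suc n)" .
  qed
qed

lemma cutoff_tendsto:
  assumes fin: "finite \<Lambda>"
  shows "(\<lambda>n. cutoff \<Lambda> n x) \<longlonglongrightarrow> 1"
proof -
  have "(\<lambda>n. bump (x i / real (Suc n))) \<longlonglongrightarrow> bump 0" for i
  proof (rule isCont_tendsto_compose[where g=bump and l=0])
    show "isCont bump 0" by (rule DERIV_isCont[OF bump_has_derivative])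
    show "(\<lambda>n. x i / real (Suc n)) \<longlonglongrightarrow> 0"
      using tendsto_mult_right_zero[OF LIMSEQ_inverse_real_of_nat, of "x i"] by (simp add: divide_inverse)
  qed
  then have "(\<lambda>n. \<Prod>i\<in>\<Lambda>. bump (x i / real (Suc n))) \<longlonglongrightarrow> (\<Prod>i\<in>\<Lambda>. 1)"
    by (intro tendsto_prod) (simp add: bump_0)
  then show ?thesis by (simp add: cutoff_def)
qed

section \<open>From the logarithmic Sobolev inequality to the spectral gap\<close>

text \<open>
  The inequality holds for \<open>cutoff \<Lambda> n x * (c + e * f x)\<close>, and both sides converge as \<open>n\<close> tends to infinity: the gradient
  of the cut-off function is of order \<open>1 / n\<close>, and everything is bounded.
\<close>

lemma log_sobolev_affine:
  fixes \<Lambda> :: "'i set"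
  assumes fin: "finite \<Lambda>" and prob: "prob_space (gibbs_measure \<Lambda> U)"
    and lsi: "\<And>f. f \<in> smooth_compact_support \<Lambda> \<Longrightarrow>
      s * Ent (gibbs_measure \<Lambda> U) (\<lambda>x. (f x)\<^sup>2) \<le> 2 * dirichlet_form \<Lambda> U f"
    and f: "f \<in> smooth_compact_support \<Lambda>"
  shows "s * Ent (gibbs_measure \<Lambda> U) (\<lambda>x. (c + e * f x)\<^sup>2) \<le> 2 * e\<^sup>2 * dirichlet_form \<Lambda> U f"
proof -
  let ?\<mu> = "gibbs_measure \<Lambda> U" and ?\<nu> = "\<Pi>\<^sub>M i\<in>\<Lambda>. (lborel :: real measure)"
  interpret \<mu>: prob_space ?\<mu> by (rule prob)
  have sets: "sets ?\<mu> = sets ?\<nu>" by (simp add: gibbs_measure_def)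
  have space: "space ?\<mu> = configs \<Lambda>" by (simp add: gibbs_measure_def space_PiM)
  have ms: "g \<in> borel_measurable ?\<mu>" if "g \<in> borel_measurable ?\<nu>" for g :: "('i \<Rightarrow> real) \<Rightarrow> real"
    using that measurable_cong_sets[OF sets refl] by blast
  note F = smooth_compact_supportD[OF fin f]
  obtain F0 where F0: "\<And>x. x \<in> configs \<Lambda> \<Longrightarrow> \<bar>f x\<bar> \<le> F0"
    "\<And>x i. x \<in> configs \<Lambda> \<Longrightarrow> i \<in> \<Lambda> \<Longrightarrow> \<bar>partial_deriv i f x\<bar> \<le> F0" using F(3) by blast
  obtain K where K: "\<And>n x. \<bar>cutoff \<Lambda> n x\<bar> \<le> K" "\<And>n x i. i \<in> \<Lambda> \<Longrightarrow> \<bar>partial_deriv i (cutoff \<Lambda> n) x\<bar> \<le> K / real (Suc n)"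
    using cutoff_bounds[OF fin] by blast
  have K0: "K \<ge> 0" using K(1)[of 0 undefined] by linarith
  have KS: "K / real (Suc n) \<le> K" for n using K0 by (simp add: divide_le_eq mult_le_cancel_left1)
  obtain z :: "'i \<Rightarrow> real" where z: "z \<in> configs \<Lambda>" by (rule obtain_config)
  have F00: "F0 \<ge> 0" using F0(1)[OF z] by linarith
  define h where "h x = c + e * f x" for x
  define H where "H = \<bar>c\<bar> + \<bar>e\<bar> * F0"
  have hb: "\<bar>h x\<bar> \<le> H" if "x \<in> configs \<Lambda>" for x
  proof -
    have "\<bar>h x\<bar> \<le> \<bar>c\<bar> + \<bar>e * f x\<bar>" unfolding h_def by (rule abs_triangle_ineq)
    also have "\<bar>e * f x\<bar> \<le> \<bar>e\<bar> * F0" unfolding abs_mult by (intro mult_left_mono F0 that) simp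
    finally show ?thesis by (simp add: H_def)
  qed
  have Ckf: "Ck_on_configs k \<Lambda> f" for k using f by (simp add: smooth_compact_support_def)
  have Ckh: "Ck_on_configs k \<Lambda> h" for k
    unfolding h_def[abs_def] by (intro Ck_add Ck_mult Ck_const Ckf)
  define g where "g n x = cutoff \<Lambda> n x * h x" for n x
  have gs: "g n \<in> smooth_compact_support \<Lambda>" for n
    unfolding g_def[abs_def] by (rule cutoff_mult_smooth_compact_support[OF fin Ckh])
  note G = smooth_compact_supportD(1,2)[OF fin gs]
  have pg: "partial_deriv i (g n) x = partial_deriv i (cutoff \<Lambda> n) x * h x + cutoff \<Lambda> n x * (e * partial_deriv i f x)"
    if x: "x \<in> configs \<Lambda>" and i: "i \<in> \<Lambda>" for n x i
  proof -
    have "((\<lambda>t. h (x(i := t))) has_real_derivative e * partial_deriv i f x) (at (x i))"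
      unfolding h_def using F(2)[OF x i] by (auto intro!: derivative_eq_intros)
    from DERIV_mult[OF Ck_has_partial_deriv[OF Ck_cutoff[OF fin, of "Suc 0" n] x i] this]
    have "((\<lambda>t. g n (x(i := t))) has_real_derivative
      partial_deriv i (cutoff \<Lambda> n) x * h x + (e * partial_deriv i f x) * cutoff \<Lambda> n x) (at (x i))"
      unfolding g_def by (simp only: fun_upd_triv)
    then show ?thesis unfolding partial_deriv_def[of i "g n"] by (simp add: DERIV_imp_deriv mult.commute)
  qed
  have ct: "(\<lambda>n. cutoff \<Lambda> n x) \<longlonglongrightarrow> 1" for x by (rule cutoff_tendsto[OF fin])
  have limE: "(\<lambda>n. Ent ?\<mu> (\<lambda>x. (g n x)\<^sup>2)) \<longlonglongrightarrow> Ent ?\<mu> (\<lambda>x. (h x)\<^sup>2)"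
  proof (rule \<mu>.Ent_tendsto[where C="(K * H)\<^sup>2"])
    show "(\<lambda>x. (g n x)\<^sup>2) \<in> borel_measurable ?\<mu>" for n using ms[OF G(1)] by measurable
    have "h \<in> borel_measurable ?\<nu>" unfolding h_def[abs_def] using F(1) by measurable
    from ms[OF this] show "(\<lambda>x. (h x)\<^sup>2) \<in> borel_measurable ?\<mu>" by measurable
    show "(g n x)\<^sup>2 \<le> (K * H)\<^sup>2" if "x \<in> space ?\<mu>" for n x
    proof -
      have "\<bar>g n x\<bar> \<le> K * H" unfolding g_def abs_mult
        using K(1) hb that K0 by (intro mult_mono) (auto simp: space)
      then show ?thesis by (metis abs_ge_zero power2_abs power_mono)
    qed
    show "(\<lambda>n. (g n x)\<^sup>2) \<longlonglongrightarrow> (h x)\<^sup>2" for x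
      using tendsto_power[OF tendsto_mult_right[OF ct[of x], of "h x"], of 2] by (simp add: g_def)
  qed simp
  define P where "P x = (\<Sum>i\<in>\<Lambda>. (partial_deriv i f x)\<^sup>2)" for x
  have limD: "(\<lambda>n. dirichlet_form \<Lambda> U (g n)) \<longlonglongrightarrow> (\<integral>x. e\<^sup>2 * P x \<partial>?\<mu>)"
    unfolding dirichlet_form_def
  proof (rule integral_dominated_convergence[where w="\<lambda>_. real (card \<Lambda>) * (K * H + K * (\<bar>e\<bar> * F0))\<^sup>2"])
    have mf: "partial_deriv i f \<in> borel_measurable ?\<mu>" if "i \<in> \<Lambda>" for i
      by (rule ms[OF partial_deriv_measurable[OF that F(1) F(2)[OF _ that]]])
    then show "(\<lambda>x. e\<^sup>2 * P x) \<in> borel_measurable ?\<mu>" unfolding P_def by measurable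
    have mg: "partial_deriv i (g n) \<in> borel_measurable ?\<mu>" if "i \<in> \<Lambda>" for i n
      by (rule ms[OF partial_deriv_measurable[OF that G(1) G(2)[OF _ that]]])
    then show "(\<lambda>x. \<Sum>i\<in>\<Lambda>. (partial_deriv i (g n) x)\<^sup>2) \<in> borel_measurable ?\<mu>" for n by measurable
    show "AE x in ?\<mu>. (\<lambda>n. \<Sum>i\<in>\<Lambda>. (partial_deriv i (g n) x)\<^sup>2) \<longlonglongrightarrow> e\<^sup>2 * P x"
    proof (rule AE_I2)
      fix x assume "x \<in> space ?\<mu>"
      then have x: "x \<in> configs \<Lambda>" by (simp add: space)
      have "(\<lambda>n. \<Sum>i\<in>\<Lambda>. (partial_deriv i (g n) x)\<^sup>2) \<longlonglongrightarrow> (\<Sum>i\<in>\<Lambda>. (0 * h x + 1 * (e * partial_deriv i f x))\<^sup>2)"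
      proof (intro tendsto_sum tendsto_power)
        fix i assume i: "i \<in> \<Lambda>"
        have "(\<lambda>n. partial_deriv i (cutoff \<Lambda> n) x) \<longlonglongrightarrow> 0"
        proof (rule Lim_null_comparison)
          show "\<forall>\<^sub>F n in sequentially. norm (partial_deriv i (cutoff \<Lambda> n) x) \<le> K * inverse (real (Suc n))"
            using K(2)[OF i] by (intro always_eventually allI) (simp add: divide_inverse del: of_nat_Suc)
          show "(\<lambda>n. K * inverse (real (Suc n))) \<longlonglongrightarrow> 0"
            by (rule tendsto_mult_right_zero[OF LIMSEQ_inverse_real_of_nat])
        qed
        then show "(\<lambda>n. partial_deriv i (g n) x) \<longlonglongrightarrow> 0 * h x + 1 * (e * partial_deriv i f x)"
          unfolding pg[OF x i] by (intro tendsto_add tendsto_mult ct tendsto_const)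
      qed
      then show "(\<lambda>n. \<Sum>i\<in>\<Lambda>. (partial_deriv i (g n) x)\<^sup>2) \<longlonglongrightarrow> e\<^sup>2 * P x"
        by (simp add: P_def power_mult_distrib sum_distrib_left)
    qed
    show "AE x in ?\<mu>. norm (\<Sum>i\<in>\<Lambda>. (partial_deriv i (g n) x)\<^sup>2) \<le> real (card \<Lambda>) * (K * H + K * (\<bar>e\<bar> * F0))\<^sup>2" for n
    proof (rule AE_I2)
      fix x assume "x \<in> space ?\<mu>"
      then have x: "x \<in> configs \<Lambda>" by (simp add: space)
      have "(partial_deriv i (g n) x)\<^sup>2 \<le> (K * H + K * (\<bar>e\<bar> * F0))\<^sup>2" if i: "i \<in> \<Lambda>" for i
      proof -
        have "\<bar>partial_deriv i (g n) x\<bar> \<le> \<bar>partial_deriv i (cutoff \<Lambda> n) x\<bar> * \<bar>h x\<bar> + \<bar>cutoff \<Lambda> n x\<bar> * (\<bar>e\<bar> * \<bar>partial_deriv i f x\<bar>)"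
          unfolding pg[OF x i] using abs_triangle_ineq by (metis abs_mult)
        also have "\<dots> \<le> K * H + K * (\<bar>e\<bar> * F0)"
          using K0 K(1) order_trans[OF K(2)[OF i] KS] hb[OF x] F0(2)[OF x i]
          by (intro add_mono mult_mono) auto
        finally show ?thesis by (metis abs_ge_zero power2_abs power_mono)
      qed
      then have "(\<Sum>i\<in>\<Lambda>. (partial_deriv i (g n) x)\<^sup>2) \<le> real (card \<Lambda>) * (K * H + K * (\<bar>e\<bar> * F0))\<^sup>2"
        by (rule sum_bounded_above)
      then show "norm (\<Sum>i\<in>\<Lambda>. (partial_deriv i (g n) x)\<^sup>2) \<le> real (card \<Lambda>) * (K * H + K * (\<bar>e\<bar> * F0))\<^sup>2"
        by (simp add: sum_nonneg)
    qed
  qed simp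
  have "s * Ent ?\<mu> (\<lambda>x. (h x)\<^sup>2) \<le> 2 * (\<integral>x. e\<^sup>2 * P x \<partial>?\<mu>)"
    by (rule LIMSEQ_le[OF tendsto_mult_left[OF limE] tendsto_mult_left[OF limD]]) (use lsi[OF gs] in auto)
  also have "(\<integral>x. e\<^sup>2 * P x \<partial>?\<mu>) = e\<^sup>2 * dirichlet_form \<Lambda> U f"
    by (simp add: P_def dirichlet_form_def)
  finally show ?thesis by (simp add: h_def)
qed

text \<open>
  The left-hand side has the Taylor expansion \<open>2 z + 3 z\<^sup>2 + O(z\<^sup>3)\<close>. The bound with an explicit error follows from
  \<open>ln x \<ge> 2 (x - 1) / (x + 1)\<close> for \<open>x \<ge> 1\<close> and \<open>ln x \<ge> (x - 1 / x) / 2\<close> for \<open>x \<le> 1\<close>.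
\<close>

lemma square_ln_square_ge:
  fixes z :: real
  assumes "z > - 1"
  shows "(1 + z)\<^sup>2 * ln ((1 + z)\<^sup>2) \<ge> 2 * z + 3 * z\<^sup>2 - \<bar>z\<bar> ^ 3"
proof -
  have ln2: "ln ((1 + z)\<^sup>2) = 2 * ln (1 + z)" using assms by (simp add: ln_realpow)
  show ?thesis
  proof (cases "z \<ge> 0")
    case True
    define A where "A x = ln x - 2 * (x - 1) / (x + 1)" for x :: real
    have "A 1 \<le> A (1 + z)"
    proof (rule DERIV_nonneg_imp_nondecreasing[where f=A])
      show "1 \<le> 1 + z" using True by simp
      fix x :: real assume x: "1 \<le> x" "x \<le> 1 + z"
      have "(A has_real_derivative 1 / x - (2 * (x + 1) - 2 * (x - 1)) / ((x + 1) * (x + 1))) (at x)"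
        unfolding A_def using x by (auto intro!: derivative_eq_intros)
      moreover have "1 / x - (2 * (x + 1) - 2 * (x - 1)) / ((x + 1) * (x + 1)) = (x - 1)\<^sup>2 / (x * (x + 1)\<^sup>2)"
        using x by (simp add: power2_eq_square divide_simps) (simp add: algebra_simps)
      ultimately have "(A has_real_derivative (x - 1)\<^sup>2 / (x * (x + 1)\<^sup>2)) (at x)" by (simp only:)
      then show "\<exists>y. (A has_real_derivative y) (at x) \<and> 0 \<le> y" using x by force
    qed
    then have "ln (1 + z) \<ge> 2 * z / (2 + z)" by (simp add: A_def)
    then have "(1 + z)\<^sup>2 * ln ((1 + z)\<^sup>2) \<ge> (1 + z)\<^sup>2 * (2 * (2 * z / (2 + z)))"
      unfolding ln2 by (intro mult_left_mono) auto
    moreover have "(1 + z)\<^sup>2 * (2 * (2 * z / (2 + z))) - (2 * z + 3 * z\<^sup>2) = z ^ 3 / (2 + z)"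
      using True by (simp add: power2_eq_square power3_eq_cube divide_simps) (simp add: algebra_simps)
    moreover have "z ^ 3 / (2 + z) \<ge> 0" using True by simp
    moreover have "\<bar>z\<bar> ^ 3 \<ge> 0" by simp
    ultimately show ?thesis by linarith
  next
    case False
    define B where "B x = ln x - (x - 1 / x) / 2" for x :: real
    have "B (1 + z) \<ge> B 1"
    proof (rule DERIV_nonpos_imp_nonincreasing[where f=B])
      show "1 + z \<le> 1" using False by simp
      fix x :: real assume x: "1 + z \<le> x" "x \<le> 1"
      have "(B has_real_derivative 1 / x - (1 + 1 / (x * x)) / 2) (at x)"
        unfolding B_def using x assms by (auto intro!: derivative_eq_intros)
      moreover have "1 / x - (1 + 1 / (x * x)) / 2 = - ((1 - 1 / x)\<^sup>2 / 2)"
        using x assms by (simp add: power2_eq_square divide_simps) (simp add: algebra_simps)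
      ultimately have "(B has_real_derivative - ((1 - 1 / x)\<^sup>2 / 2)) (at x)" by (simp only:)
      then show "\<exists>y. (B has_real_derivative y) (at x) \<and> y \<le> 0" by force
    qed
    then have "ln (1 + z) \<ge> (1 + z - 1 / (1 + z)) / 2" by (simp add: B_def)
    then have "(1 + z)\<^sup>2 * ln ((1 + z)\<^sup>2) \<ge> (1 + z)\<^sup>2 * (2 * ((1 + z - 1 / (1 + z)) / 2))"
      unfolding ln2 by (intro mult_left_mono) auto
    moreover have "(1 + z)\<^sup>2 * (2 * ((1 + z - 1 / (1 + z)) / 2)) = 2 * z + 3 * z\<^sup>2 + z ^ 3"
      using assms by (simp add: power2_eq_square power3_eq_cube divide_simps) (simp add: algebra_simps)
    moreover have "\<bar>z\<bar> ^ 3 = - (z ^ 3)" using False by (simp add: power3_eq_cube abs_if)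
    ultimately show ?thesis by linarith
  qed
qed

text \<open>
  With \<open>w\<close> the centred function, the entropy of \<open>(1 + e w)\<^sup>2\<close> is \<open>2 e\<^sup>2 V + O(e\<^sup>3)\<close> and the Dirichlet form is \<open>e\<^sup>2 D\<close>. Centring makes
  the term of first order disappear. The claim follows on dividing by \<open>e\<^sup>2\<close>.
\<close>

lemma spectral_gap_of_log_sobolev:
  fixes \<Lambda> :: "'i set"
  assumes fin: "finite \<Lambda>" and prob: "prob_space (gibbs_measure \<Lambda> U)" and "s > 0"
    and lsi: "\<And>f. f \<in> smooth_compact_support \<Lambda> \<Longrightarrow>
      s * Ent (gibbs_measure \<Lambda> U) (\<lambda>x. (f x)\<^sup>2) \<le> 2 * dirichlet_form \<Lambda> U f"
    and f: "f \<in> smooth_compact_support \<Lambda>"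
  shows "s * Var (gibbs_measure \<Lambda> U) f \<le> dirichlet_form \<Lambda> U f"
proof -
  let ?\<mu> = "gibbs_measure \<Lambda> U" and ?\<nu> = "\<Pi>\<^sub>M i\<in>\<Lambda>. (lborel :: real measure)"
  interpret \<mu>: prob_space ?\<mu> by (rule prob)
  have sets: "sets ?\<mu> = sets ?\<nu>" by (simp add: gibbs_measure_def)
  have space: "space ?\<mu> = configs \<Lambda>" by (simp add: gibbs_measure_def space_PiM)
  note F = smooth_compact_supportD[OF fin f]
  have fm[measurable]: "f \<in> borel_measurable ?\<mu>" using F(1) measurable_cong_sets[OF sets refl] by blast
  obtain F0 where F0: "\<And>x. x \<in> configs \<Lambda> \<Longrightarrow> \<bar>f x\<bar> \<le> F0" using F(3) by blast
  define m where "m = (\<integral>x. f x \<partial>?\<mu>)"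
  define w where "w x = f x - m" for x
  define W where "W = F0 + \<bar>m\<bar> + 1"
  have wb: "\<bar>w x\<bar> \<le> W" if "x \<in> configs \<Lambda>" for x using F0[OF that] by (simp add: w_def W_def)
  obtain z :: "'i \<Rightarrow> real" where z: "z \<in> configs \<Lambda>" by (rule obtain_config)
  have W: "W > 0" using F0[OF z] by (simp add: W_def)
  have [measurable]: "w \<in> borel_measurable ?\<mu>" unfolding w_def[abs_def] by measurable
  have ib: "integrable ?\<mu> g" if "g \<in> borel_measurable ?\<mu>" "\<And>x. x \<in> configs \<Lambda> \<Longrightarrow> \<bar>g x\<bar> \<le> C" for g :: "('i \<Rightarrow> real) \<Rightarrow> real" and C
    by (rule \<mu>.integrable_const_bound[of _ C]) (use that in \<open>auto intro!: AE_I2 simp: space\<close>)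
  have if': "integrable ?\<mu> f" by (rule ib[OF fm F0])
  have iw: "integrable ?\<mu> w" by (rule ib[OF _ wb]) measurable
  have iw2: "integrable ?\<mu> (\<lambda>x. (w x)\<^sup>2)"
    by (rule ib[of _ "W\<^sup>2"]) (use wb power_mono[OF wb, of _ 2] in auto)
  have w0: "(\<integral>x. w x \<partial>?\<mu>) = 0" unfolding w_def using if' by (simp add: m_def \<mu>.prob_space)
  define V where "V = (\<integral>x. (w x)\<^sup>2 \<partial>?\<mu>)"
  define D where "D = dirichlet_form \<Lambda> U f"
  have V: "Var ?\<mu> f = V" by (simp add: Var_def V_def w_def m_def)
  have V0: "V \<ge> 0" by (simp add: V_def)
  have main: "s * (2 * V - e * W ^ 3 - e\<^sup>2 * V\<^sup>2) \<le> 2 * D" if e: "e > 0" "e * W < 1" for e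
  proof -
    have ew: "\<bar>e * w x\<bar> \<le> e * W" if "x \<in> configs \<Lambda>" for x
      unfolding abs_mult using e wb[OF that] by (simp add: mult_left_mono)
    \<comment> \<open>Centring is achieved by the constant, so that the test function stays affine in \<open>f\<close>.\<close>
    have h: "(1 - e * m) + e * f x = 1 + e * w x" for x by (simp add: w_def algebra_simps)
    have hb: "0 < 1 + e * w x" "1 + e * w x \<le> 2" if "x \<in> configs \<Lambda>" for x
    proof -
      have "e * w x \<le> e * W" "- (e * w x) \<le> e * W" using ew[OF that] by (simp_all only: abs_le_iff)
      then show "0 < 1 + e * w x" "1 + e * w x \<le> 2" using e(2) by simp_all
    qed
    have H2: "(\<integral>x. (1 + e * w x)\<^sup>2 \<partial>?\<mu>) = 1 + e\<^sup>2 * V"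
    proof -
      have "(1 + e * w x)\<^sup>2 = 1 + 2 * e * w x + e\<^sup>2 * (w x)\<^sup>2" for x by (simp add: power2_eq_square algebra_simps)
      then show ?thesis using iw iw2 w0 by (simp add: V_def \<mu>.prob_space)
    qed
    have low: "2 * (e * w x) + 3 * e\<^sup>2 * (w x)\<^sup>2 - e ^ 3 * W ^ 3 \<le> (1 + e * w x)\<^sup>2 * ln ((1 + e * w x)\<^sup>2)"
      if "x \<in> configs \<Lambda>" for x
    proof -
      have "2 * (e * w x) + 3 * (e * w x)\<^sup>2 - \<bar>e * w x\<bar> ^ 3 \<le> (1 + e * w x)\<^sup>2 * ln ((1 + e * w x)\<^sup>2)"
        using hb[OF that] by (intro square_ln_square_ge) simp
      moreover have "\<bar>e * w x\<bar> ^ 3 \<le> (e * W) ^ 3" by (intro power_mono ew that) simp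
      ultimately show ?thesis by (simp add: power_mult_distrib)
    qed
    have il: "integrable ?\<mu> (\<lambda>x. (1 + e * w x)\<^sup>2 * ln ((1 + e * w x)\<^sup>2))"
    proof (rule ib[of _ "\<bar>2 * (e * W) + 3 * e\<^sup>2 * W\<^sup>2 + e ^ 3 * W ^ 3\<bar> + 16"])
      show "\<bar>(1 + e * w x)\<^sup>2 * ln ((1 + e * w x)\<^sup>2)\<bar> \<le> \<bar>2 * (e * W) + 3 * e\<^sup>2 * W\<^sup>2 + e ^ 3 * W ^ 3\<bar> + 16"
        if x: "x \<in> configs \<Lambda>" for x
      proof -
        let ?q = "(1 + e * w x)\<^sup>2"
        have q: "0 < ?q" "?q \<le> 4" using hb[OF x] power_mono[of "1 + e * w x" 2 2] by auto
        have "ln ?q \<le> ?q - 1" using q by (intro ln_le_minus_one)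
        then have "?q * ln ?q \<le> ?q * (?q - 1)" using q by (intro mult_left_mono) auto
        also have "\<dots> \<le> ?q * ?q" using q by (intro mult_left_mono) auto
        also have "\<dots> \<le> 4 * 4" using q by (intro mult_mono) auto
        finally have "?q * ln ?q \<le> 16" by simp
        moreover have "- (2 * (e * W) + 3 * e\<^sup>2 * W\<^sup>2 + e ^ 3 * W ^ 3) \<le> ?q * ln ?q"
        proof -
          have "2 * (e * w x) \<ge> - (2 * (e * W))" using abs_le_D2[OF ew[OF x]] by linarith
          moreover have "3 * e\<^sup>2 * (w x)\<^sup>2 \<ge> 0" "3 * e\<^sup>2 * W\<^sup>2 \<ge> 0" by simp_all
          ultimately show ?thesis using low[OF x] by linarith
        qed
        ultimately show ?thesis by linarith
      qed
    qed measurable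
    have "(\<integral>x. 2 * (e * w x) + 3 * e\<^sup>2 * (w x)\<^sup>2 - e ^ 3 * W ^ 3 \<partial>?\<mu>) \<le> (\<integral>x. (1 + e * w x)\<^sup>2 * ln ((1 + e * w x)\<^sup>2) \<partial>?\<mu>)"
      using iw iw2 low by (intro integral_mono il) (auto simp: space)
    also have "(\<integral>x. 2 * (e * w x) + 3 * e\<^sup>2 * (w x)\<^sup>2 - e ^ 3 * W ^ 3 \<partial>?\<mu>) = 3 * e\<^sup>2 * V - e ^ 3 * W ^ 3"
      using iw iw2 w0 by (simp add: V_def \<mu>.prob_space)
    finally have 1: "3 * e\<^sup>2 * V - e ^ 3 * W ^ 3 \<le> (\<integral>x. (1 + e * w x)\<^sup>2 * ln ((1 + e * w x)\<^sup>2) \<partial>?\<mu>)" .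
    have "ln (1 + e\<^sup>2 * V) \<le> e\<^sup>2 * V" using V0 by (intro ln_add_one_self_le_self) simp
    then have 2: "(1 + e\<^sup>2 * V) * ln (1 + e\<^sup>2 * V) \<le> (1 + e\<^sup>2 * V) * (e\<^sup>2 * V)"
      using V0 by (intro mult_left_mono) auto
    have "e\<^sup>2 * (2 * V - e * W ^ 3 - e\<^sup>2 * V\<^sup>2) = 3 * e\<^sup>2 * V - e ^ 3 * W ^ 3 - (1 + e\<^sup>2 * V) * (e\<^sup>2 * V)"
      by (simp add: power2_eq_square power3_eq_cube algebra_simps)
    also have "\<dots> \<le> Ent ?\<mu> (\<lambda>x. (1 + e * w x)\<^sup>2)" unfolding Ent_def H2 using 1 2 by linarith
    finally have "s * (e\<^sup>2 * (2 * V - e * W ^ 3 - e\<^sup>2 * V\<^sup>2)) \<le> s * Ent ?\<mu> (\<lambda>x. (1 + e * w x)\<^sup>2)"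
      using \<open>s > 0\<close> by (intro mult_left_mono) auto
    also have "\<dots> \<le> 2 * e\<^sup>2 * D"
      using log_sobolev_affine[OF fin prob lsi f, of "1 - e * m" e] by (simp only: h D_def)
    finally have "e\<^sup>2 * (s * (2 * V - e * W ^ 3 - e\<^sup>2 * V\<^sup>2)) \<le> e\<^sup>2 * (2 * D)" by (simp only: mult_ac)
    then show ?thesis using e(1) by (simp only: mult_le_cancel_left_pos zero_less_power)
  qed
  have "((\<lambda>e. s * (2 * V - e * W ^ 3 - e\<^sup>2 * V\<^sup>2)) \<longlongrightarrow> s * (2 * V - 0 * W ^ 3 - 0\<^sup>2 * V\<^sup>2)) (at_right 0)"
    by (intro tendsto_intros)
  moreover have "\<forall>\<^sub>F e in at_right 0. s * (2 * V - e * W ^ 3 - e\<^sup>2 * V\<^sup>2) \<le> 2 * D"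
    unfolding eventually_at_right_field using W main
    by (intro exI[of _ "1 / W"]) (auto simp: field_simps)
  ultimately have "s * (2 * V - 0 * W ^ 3 - 0\<^sup>2 * V\<^sup>2) \<le> 2 * D"
    by (rule tendsto_upperbound) simp
  then show ?thesis by (simp add: V D_def)
qed

lemma dirichlet_form_nonneg: "dirichlet_form \<Lambda> U f \<ge> 0"
  unfolding dirichlet_form_def by (intro integral_nonneg_AE AE_I2 sum_nonneg) simp

theorem log_sobolev_constant_le_spectral_gap:
  assumes fin: "finite \<Lambda>" and prob: "prob_space (gibbs_measure \<Lambda> U)"
  shows "log_sobolev_constant \<Lambda> U \<le> spectral_gap \<Lambda> U"
  unfolding log_sobolev_constant_def
proof (rule Sup_least)
  fix c assume "c \<in> {ereal \<sigma> | \<sigma>. \<forall>f\<in>smooth_compact_support \<Lambda>.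
            \<sigma> * Ent (gibbs_measure \<Lambda> U) (\<lambda>x. (f x)\<^sup>2) \<le> 2 * dirichlet_form \<Lambda> U f}"
  then obtain s where s: "c = ereal s" "\<And>f. f \<in> smooth_compact_support \<Lambda> \<Longrightarrow>
      s * Ent (gibbs_measure \<Lambda> U) (\<lambda>x. (f x)\<^sup>2) \<le> 2 * dirichlet_form \<Lambda> U f" by blast
  have "s * Var (gibbs_measure \<Lambda> U) f \<le> dirichlet_form \<Lambda> U f" if f: "f \<in> smooth_compact_support \<Lambda>" for f
  proof (cases "s > 0")
    case True
    then show ?thesis by (rule spectral_gap_of_log_sobolev[OF fin prob _ s(2) f])
  next
    case False
    have "Var (gibbs_measure \<Lambda> U) f \<ge> 0" by (simp add: Var_def)
    then have "s * Var (gibbs_measure \<Lambda> U) f \<le> 0" using False by (simp add: mult_nonpos_nonneg)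
    then show ?thesis using dirichlet_form_nonneg[of \<Lambda> U f] by linarith
  qed
  then show "c \<le> spectral_gap \<Lambda> U"
    unfolding spectral_gap_def s(1) by (intro Sup_upper) blast
qed

section \<open>The lattice\<close>

lemma neighbours_sym: "j \<in> neighbours i \<longleftrightarrow> i \<in> neighbours j"
  by (simp add: neighbours_def abs_minus_commute)

lemma neighbours_irrefl: "i \<notin> neighbours i"
  by (simp add: neighbours_def)

text \<open>
  If the absolute differences add up to \<open>1\<close>, exactly one of them is \<open>1\<close>.
\<close>

lemma neighbours_subset:
  fixes i :: "int ^ 'd"
  shows "neighbours i \<subseteq> (\<lambda>(k, s). i + axis k s) ` (UNIV \<times> {1, - 1})"
proof
  fix j assume "j \<in> neighbours i"
  then have s: "(\<Sum>k\<in>UNIV. \<bar>i $ k - j $ k\<bar>) = 1" by (simp add: neighbours_def)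
  have "\<exists>k. i $ k \<noteq> j $ k"
  proof (rule ccontr)
    assume "\<not> (\<exists>k. i $ k \<noteq> j $ k)"
    then show False using s by simp
  qed
  then obtain k where k: "i $ k \<noteq> j $ k" by blast
  have "(\<Sum>k\<in>UNIV. \<bar>i $ k - j $ k\<bar>) = \<bar>i $ k - j $ k\<bar> + (\<Sum>l\<in>UNIV - {k}. \<bar>i $ l - j $ l\<bar>)"
    by (rule sum.remove) auto
  moreover have "(\<Sum>l\<in>UNIV - {k}. \<bar>i $ l - j $ l\<bar>) \<ge> 0" by (rule sum_nonneg) simp
  moreover have "\<bar>i $ k - j $ k\<bar> \<ge> 1" using k by linarith
  ultimately have 1: "\<bar>i $ k - j $ k\<bar> = 1" and 0: "(\<Sum>l\<in>UNIV - {k}. \<bar>i $ l - j $ l\<bar>) = 0"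
    using s by linarith+
  have z: "i $ l = j $ l" if "l \<noteq> k" for l
    using 0 that by (subst (asm) sum_nonneg_eq_0_iff) auto
  have "j = i + axis k (j $ k - i $ k)"
    using z by (simp add: vec_eq_iff axis_def)
  moreover have "j $ k - i $ k \<in> {1, - 1}" using 1 by auto
  ultimately show "j \<in> (\<lambda>(k, s). i + axis k s) ` (UNIV \<times> {1, - 1})"
    by (intro image_eqI[of _ _ "(k, j $ k - i $ k)"]) auto
qed

lemma finite_neighbours: "finite (neighbours (i :: int ^ 'd))"
  by (rule finite_subset[OF neighbours_subset]) simp

lemma card_neighbours_le: "card (neighbours (i :: int ^ 'd)) \<le> 2 * CARD('d)"
proof -
  have "card (neighbours i) \<le> card ((\<lambda>(k, s). i + axis k s) ` (UNIV \<times> {1, - 1 :: int}))"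
    by (rule card_mono[OF _ neighbours_subset]) simp
  also have "\<dots> \<le> card ((UNIV :: 'd set) \<times> {1, - 1 :: int})" by (rule card_image_le) simp
  also have "\<dots> = 2 * CARD('d)" by (simp add: card_cartesian_product)
  finally show ?thesis .
qed

text \<open>
  Each bond comes from exactly two ordered pairs, since its end points are distinct.
\<close>

lemma bonds_sum_eq:
  fixes \<Lambda> :: "(int ^ 'd) set" and x :: "int ^ 'd \<Rightarrow> real"
  assumes fin: "finite \<Lambda>"
  shows "2 * (\<Sum>b\<in>bonds_in \<Lambda>. \<Prod>i\<in>b. x i) = (\<Sum>i\<in>\<Lambda>. \<Sum>j\<in>\<Lambda>. if j \<in> neighbours i then x i * x j else 0)"
proof -
  define A where "A = {(i, j). i \<in> \<Lambda> \<and> j \<in> \<Lambda> \<and> j \<in> neighbours i}"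
  have AS: "A \<subseteq> \<Lambda> \<times> \<Lambda>" by (auto simp: A_def)
  have finA: "finite A" by (rule finite_subset[OF AS]) (use fin in simp)
  define e where "e = (\<lambda>(i, j). {i, j} :: (int ^ 'd) set)"
  have bonds: "bonds_in \<Lambda> = e ` A" by (auto simp: bonds_in_def A_def e_def image_iff)
  have "(\<Sum>i\<in>\<Lambda>. \<Sum>j\<in>\<Lambda>. if j \<in> neighbours i then x i * x j else 0) = (\<Sum>(i, j)\<in>\<Lambda> \<times> \<Lambda>. if j \<in> neighbours i then x i * x j else 0)"
    by (rule sum.cartesian_product)
  also have "\<dots> = (\<Sum>(i, j)\<in>A. x i * x j)"
    using fin by (intro sum.mono_neutral_cong_right) (auto simp: A_def split: if_splits)
  also have "\<dots> = (\<Sum>b\<in>bonds_in \<Lambda>. \<Sum>p\<in>{p \<in> A. e p = b}. case p of (i, j) \<Rightarrow> x i * x j)"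
    using finA by (intro sum.group[symmetric]) (auto simp: bonds)
  also have "\<dots> = (\<Sum>b\<in>bonds_in \<Lambda>. 2 * (\<Prod>i\<in>b. x i))"
  proof (rule sum.cong[OF refl])
    fix b assume "b \<in> bonds_in \<Lambda>"
    then obtain i j where ij: "(i, j) \<in> A" "b = {i, j}" by (auto simp: bonds e_def)
    then have ne: "i \<noteq> j" using neighbours_irrefl by (auto simp: A_def)
    have "{p \<in> A. e p = b} = {(i, j), (j, i)}"
      using ij ne neighbours_sym by (auto simp: A_def e_def doubleton_eq_iff)
    then show "(\<Sum>p\<in>{p \<in> A. e p = b}. case p of (i, j) \<Rightarrow> x i * x j) = 2 * (\<Prod>i\<in>b. x i)"
      using ne ij(2) by (simp add: mult.commute)
  qed
  finally show ?thesis by (simp add: sum_distrib_left)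
qed

text \<open>
  The spins outside the region act as an external field, and the row sums of the interaction matrix are at
  most \<open>2 J\<close> times \<open>2 d\<close>.
\<close>

lemma lattice_interaction:
  fixes \<Lambda> :: "(int ^ 'd) set" and \<omega> :: "int ^ 'd \<Rightarrow> real"
  assumes J: "J \<ge> 0" and fin: "finite \<Lambda>"
  defines \<kappa>_def: "\<kappa> \<equiv> \<lambda>i j :: int ^ 'd. if j \<in> neighbours i then 2 * J else 0"
    and b_def: "b \<equiv> \<lambda>i. \<Sum>j\<in>neighbours i - \<Lambda>. 2 * J * \<omega> j"
  shows "pair_interaction \<Lambda> \<kappa> (4 * real CARD('d) * J) (single_site_potential \<beta>)"
    and "\<kappa> i j \<ge> 0"
    and "pair_interaction.potential \<Lambda> \<kappa> (single_site_potential \<beta>) b = spin_potential J \<beta> \<Lambda> \<omega>"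
proof -
  show nn: "\<kappa> i j \<ge> 0" for i j using J by (simp add: \<kappa>_def)
  have sym: "\<kappa> i j = \<kappa> j i" for i j using neighbours_sym[of i j] by (simp add: \<kappa>_def)
  have row: "(\<Sum>j\<in>\<Lambda>. \<kappa> i j) \<le> 4 * real CARD('d) * J" for i
  proof -
    have "(\<Sum>j\<in>\<Lambda>. \<kappa> i j) = (\<Sum>j\<in>\<Lambda> \<inter> neighbours i. 2 * J)"
      unfolding \<kappa>_def using fin by (simp add: sum.If_cases Int_def)
    also have "\<dots> = real (card (\<Lambda> \<inter> neighbours i)) * (2 * J)" by simp
    also have "\<dots> \<le> real (2 * CARD('d)) * (2 * J)"
      using J card_neighbours_le[of i] card_mono[OF finite_neighbours, of "\<Lambda> \<inter> neighbours i" i]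
      by (intro mult_right_mono) auto
    finally show ?thesis by simp
  qed
  have coer: "(\<Sum>i\<in>\<Lambda>. \<Sum>j\<in>\<Lambda>. \<kappa> i j * y i * y j) \<le> (4 * real CARD('d) * J) * (\<Sum>i\<in>\<Lambda>. (y i)\<^sup>2)" for y
  proof -
    have "(\<Sum>i\<in>\<Lambda>. \<Sum>j\<in>\<Lambda>. \<kappa> i j * y i * y j) \<le> (\<Sum>i\<in>\<Lambda>. \<Sum>j\<in>\<Lambda>. \<kappa> i j * (y i)\<^sup>2 / 2 + \<kappa> i j * (y j)\<^sup>2 / 2)"
    proof (intro sum_mono)
      fix i j
      have "y i * y j \<le> (y i)\<^sup>2 / 2 + (y j)\<^sup>2 / 2"
        using zero_le_power2[of "y i - y j"] by (simp add: power2_diff)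
      from mult_left_mono[OF this nn[of i j]]
      show "\<kappa> i j * y i * y j \<le> \<kappa> i j * (y i)\<^sup>2 / 2 + \<kappa> i j * (y j)\<^sup>2 / 2" by (simp add: algebra_simps)
    qed
    also have "\<dots> = (\<Sum>i\<in>\<Lambda>. \<Sum>j\<in>\<Lambda>. \<kappa> i j * (y i)\<^sup>2 / 2) + (\<Sum>i\<in>\<Lambda>. \<Sum>j\<in>\<Lambda>. \<kappa> i j * (y j)\<^sup>2 / 2)"
      by (simp add: sum.distrib)
    also have "(\<Sum>i\<in>\<Lambda>. \<Sum>j\<in>\<Lambda>. \<kappa> i j * (y j)\<^sup>2 / 2) = (\<Sum>j\<in>\<Lambda>. \<Sum>i\<in>\<Lambda>. \<kappa> j i * (y j)\<^sup>2 / 2)"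
      by (subst sum.swap) (simp add: sym)
    also have "(\<Sum>i\<in>\<Lambda>. \<Sum>j\<in>\<Lambda>. \<kappa> i j * (y i)\<^sup>2 / 2) + \<dots> = (\<Sum>i\<in>\<Lambda>. (\<Sum>j\<in>\<Lambda>. \<kappa> i j) * (y i)\<^sup>2)"
      by (simp add: sum_distrib_right flip: sum.distrib)
    also have "\<dots> \<le> (\<Sum>i\<in>\<Lambda>. (4 * real CARD('d) * J) * (y i)\<^sup>2)"
      by (intro sum_mono mult_right_mono row) simp
    finally show ?thesis by (simp add: sum_distrib_left)
  qed
  show pair: "pair_interaction \<Lambda> \<kappa> (4 * real CARD('d) * J) (single_site_potential \<beta>)"
  proof unfold_locales
    show "\<kappa> i i = 0" for i by (simp add: \<kappa>_def neighbours_irrefl)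
  qed (use fin sym coer has_gaussian_tails_quartic in auto)
  show "pair_interaction.potential \<Lambda> \<kappa> (single_site_potential \<beta>) b = spin_potential J \<beta> \<Lambda> \<omega>"
  proof
    fix x
    have "(\<Sum>i\<in>\<Lambda>. \<Sum>j\<in>\<Lambda>. \<kappa> i j * x i * x j) = (2 * J) * (\<Sum>i\<in>\<Lambda>. \<Sum>j\<in>\<Lambda>. if j \<in> neighbours i then x i * x j else 0)"
    proof -
      have "\<kappa> i j * x i * x j = 2 * J * (if j \<in> neighbours i then x i * x j else 0)" for i j
        by (simp add: \<kappa>_def)
      then show ?thesis by (simp only: sum_distrib_left)
    qed
    also have "\<dots> = 2 * (2 * J * (\<Sum>b\<in>bonds_in \<Lambda>. \<Prod>i\<in>b. x i))"
      by (simp flip: bonds_sum_eq[OF fin])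
    finally have 1: "(\<Sum>i\<in>\<Lambda>. \<Sum>j\<in>\<Lambda>. \<kappa> i j * x i * x j) / 2 = 2 * J * (\<Sum>b\<in>bonds_in \<Lambda>. \<Prod>i\<in>b. x i)" by simp
    have 2: "(\<Sum>i\<in>\<Lambda>. b i * x i) = 2 * J * (\<Sum>i\<in>\<Lambda>. \<Sum>j\<in>neighbours i - \<Lambda>. x i * \<omega> j)"
      unfolding b_def by (simp add: sum_distrib_left sum_distrib_right mult_ac)
    show "pair_interaction.potential \<Lambda> \<kappa> (single_site_potential \<beta>) b x = spin_potential J \<beta> \<Lambda> \<omega> x"
      unfolding pair_interaction.potential_def[OF pair] spin_potential_def 1 2 ..
  qed
qed

theorem theorem6p3:
  fixes J \<beta> :: real
  assumes "J \<ge> 0"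
  shows "(INF \<Lambda>\<in>{\<Lambda> :: (int ^ 'd) set. finite \<Lambda> \<and> \<Lambda> \<noteq> {}}. INF \<omega>.
             spectral_gap \<Lambda> (spin_potential J \<beta> \<Lambda> \<omega>))
         \<ge> (INF \<Lambda>\<in>{\<Lambda> :: (int ^ 'd) set. finite \<Lambda> \<and> \<Lambda> \<noteq> {}}. INF \<omega>.
             log_sobolev_constant \<Lambda> (spin_potential J \<beta> \<Lambda> \<omega>))
       \<and> (INF \<Lambda>\<in>{\<Lambda> :: (int ^ 'd) set. finite \<Lambda> \<and> \<Lambda> \<noteq> {}}. INF \<omega>.
             log_sobolev_constant \<Lambda> (spin_potential J \<beta> \<Lambda> \<omega>))
         \<ge> ereal ((sqrt (\<beta>\<^sup>2 + 8) - \<beta>) / sqrt (exp 1)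
                     * exp (- (1 / 8) * \<beta> * (\<beta> + sqrt (\<beta>\<^sup>2 + 8)))
                   - 4 * real CARD('d) * J)"
proof -
  let ?\<sigma> = "(sqrt (\<beta>\<^sup>2 + 8) - \<beta>) / sqrt (exp 1) * exp (- (1 / 8) * \<beta> * (\<beta> + sqrt (\<beta>\<^sup>2 + 8)))"
  let ?c = "4 * real CARD('d) * J"
  have gap: "log_sobolev_constant \<Lambda> (spin_potential J \<beta> \<Lambda> \<omega>) \<le> spectral_gap \<Lambda> (spin_potential J \<beta> \<Lambda> \<omega>)"
    and lsi: "ereal (?\<sigma> - ?c) \<le> log_sobolev_constant \<Lambda> (spin_potential J \<beta> \<Lambda> \<omega>)"
    if fin: "finite \<Lambda>" for \<Lambda> :: "(int ^ 'd) set" and \<omega>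
  proof -
    define \<kappa> where "\<kappa> = (\<lambda>i j :: int ^ 'd. if j \<in> neighbours i then 2 * J else 0)"
    define b where "b = (\<lambda>i. \<Sum>j\<in>neighbours i - \<Lambda>. 2 * J * \<omega> j)"
    let ?u = "single_site_potential \<beta>"
    have potential: "pair_interaction.potential \<Lambda> \<kappa> ?u b = spin_potential J \<beta> \<Lambda> \<omega>"
      unfolding \<kappa>_def b_def by (rule lattice_interaction(3)[OF assms fin])
    interpret I: pair_interaction \<Lambda> \<kappa> ?c ?u b
      unfolding \<kappa>_def by (rule lattice_interaction(1)[OF assms fin])
    show "log_sobolev_constant \<Lambda> (spin_potential J \<beta> \<Lambda> \<omega>) \<le> spectral_gap \<Lambda> (spin_potential J \<beta> \<Lambda> \<omega>)"
      using log_sobolev_constant_le_spectral_gap[OF fin I.\<mu>.prob_space_axioms] by (simp only: potential)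
    have "(?\<sigma> - ?c) * Ent (gibbs_measure \<Lambda> (spin_potential J \<beta> \<Lambda> \<omega>)) (\<lambda>x. (f x)\<^sup>2)
        \<le> 2 * dirichlet_form \<Lambda> (spin_potential J \<beta> \<Lambda> \<omega>) f"
      if f: "f \<in> smooth_compact_support \<Lambda>" and pos: "?c < ?\<sigma>" for f
    proof -
      interpret S: single_site ?u ?\<sigma> by (rule single_site_quartic)
      interpret spin_system ?u ?\<sigma> \<Lambda> \<kappa> ?c b
        by unfold_locales (use assms pos S.\<sigma>_pos in \<open>auto simp: \<kappa>_def\<close>)
      obtain F where "\<And>x. x \<in> configs \<Lambda> \<Longrightarrow> \<bar>f x\<bar> \<le> F"
        "\<And>x i. x \<in> configs \<Lambda> \<Longrightarrow> i \<in> \<Lambda> \<Longrightarrow> \<bar>partial_deriv i f x\<bar> \<le> F"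
        using smooth_compact_supportD(3)[OF fin f] by blast
      from log_sobolev_bounded[OF smooth_compact_supportD(1)[OF fin f] this(1)
          smooth_compact_supportD(2)[OF fin f] this(2)]
      show ?thesis by (simp only: potential \<gamma>_def)
    qed
    then have pos_case: "ereal (?\<sigma> - ?c) \<le> log_sobolev_constant \<Lambda> (spin_potential J \<beta> \<Lambda> \<omega>)" if "?c < ?\<sigma>"
      unfolding log_sobolev_constant_def using that by (intro Sup_upper) blast
    have "ereal 0 \<le> log_sobolev_constant \<Lambda> (spin_potential J \<beta> \<Lambda> \<omega>)"
      unfolding log_sobolev_constant_def
      by (intro Sup_upper) (auto simp: dirichlet_form_nonneg intro!: exI[of _ 0])
    then show "ereal (?\<sigma> - ?c) \<le> log_sobolev_constant \<Lambda> (spin_potential J \<beta> \<Lambda> \<omega>)"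
      using pos_case by (cases "?c < ?\<sigma>") (auto elim!: order_trans[rotated])
  qed
  show ?thesis
  proof
    show "(INF \<Lambda>\<in>{\<Lambda> :: (int ^ 'd) set. finite \<Lambda> \<and> \<Lambda> \<noteq> {}}. INF \<omega>. log_sobolev_constant \<Lambda> (spin_potential J \<beta> \<Lambda> \<omega>))
      \<le> (INF \<Lambda>\<in>{\<Lambda> :: (int ^ 'd) set. finite \<Lambda> \<and> \<Lambda> \<noteq> {}}. INF \<omega>. spectral_gap \<Lambda> (spin_potential J \<beta> \<Lambda> \<omega>))"
    proof (intro INF_greatest)
      fix \<Lambda> :: "(int ^ 'd) set" and \<omega> assume "\<Lambda> \<in> {\<Lambda>. finite \<Lambda> \<and> \<Lambda> \<noteq> {}}"
      then show "(INF \<Lambda>\<in>{\<Lambda> :: (int ^ 'd) set. finite \<Lambda> \<and> \<Lambda> \<noteq> {}}. INF \<omega>. log_sobolev_constant \<Lambda> (spin_potential J \<beta> \<Lambda> \<omega>))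
          \<le> spectral_gap \<Lambda> (spin_potential J \<beta> \<Lambda> \<omega>)"
        using gap[of \<Lambda> \<omega>] by (intro INF_lower2[of \<Lambda>] INF_lower2[of \<omega>]) auto
    qed
    show "ereal (?\<sigma> - ?c)
      \<le> (INF \<Lambda>\<in>{\<Lambda> :: (int ^ 'd) set. finite \<Lambda> \<and> \<Lambda> \<noteq> {}}. INF \<omega>. log_sobolev_constant \<Lambda> (spin_potential J \<beta> \<Lambda> \<omega>))"
      by (intro INF_greatest lsi) simp
  qed
qed

end
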